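(* (i) Let $A\subset\mathbf{C}\cup\{\infty\}$ be a finite set of more than $3$ $(=1+2)$ distinct values. Then there exists a constant $C>0$, depending on $A$ only, such that for every Riemann surface $\Sigma$ and every improper affine front $\psi\colon\Sigma\to\mathbf{R}^3$ whose Lagrangian Gauss map $\nu\colon\Sigma\to\mathbf{C}\cup\{\infty\}$ omits all values in $A$, we have, for all $p\in\Sigma$, $$|K_{d\tau^2}(p)|^{1/2}\leq\frac{C}{d(p)},$$ where $K_{d\tau^2}(p)$ is the Gaussian curvature at $p$ of the metric $d\tau^2=2(|dF|^2+|dG|^2)$ associated with $\psi$, and $d(p)$ is the geodesic distance (with respect to $d\tau^2$) from $p$ to the boundary of $\Sigma$. (ii) In particular, if the Lagrangian Gauss map of a weakly complete improper affine front in $\mathbf{R}^3$ is nonconstant, then it can omit at most $3$ $(=1+2)$ values.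
   Context: Improper affine fronts are (locally strongly convex) improper affine spheres in the affine $3$-space $\mathbf{R}^3$ with certain admissible singularities; they are exactly the maps described as follows. Let $\Sigma$ be a (connected) Riemann surface and $(F,G)$ a pair of holomorphic functions on $\Sigma$ such that $\mathrm{Re}(F\,dG)$ is exact and $|dF|^2+|dG|^2$ is positive definite. Then the map $\psi\colon\Sigma\to\mathbf{R}^3=\mathbf{C}\times\mathbf{R}$ given by $$\psi=\left(G+\overline{F},\ \frac{|G|^2-|F|^2}{2}+\mathrm{Re}\left(GF-2\int F\,dG\right)\right)$$ is an improper affine front, and every improper affine front is given in this way. With $x:=G+\overline{F}$ and $n:=\overline{F}-G$, the map $L_\psi:=x+\sqrt{-1}\,n\colon\Sigma\to\mathbf{C}^2$ is a special Lagrangian immersion whose induced metric from $\mathbf{C}^2$ is $d\tau^2=2(|dF|^2+|dG|^2)$. The Lagrangian Gauss map of $\psi$ is the meromorphic function $\nu:=dF/dG\colon\Sigma\to\mathbf{C}\cup\{\infty\}$. The improper affine front $\psi$ is called weakly complete if $d\tau^2$ is complete. The map $\nu$ omits a value $\alpha$ if $\alpha\notin\nu(\Sigma)$. The geodesic distance $d(p)$ from $p$ to the boundary of $\Sigma$ is the infimum of the $d\tau^2$-lengths of the divergent curves in $\Sigma$ emanating from $p$ (a curve is divergent if it eventually leaves every compact subset of $\Sigma$); if $d(p)=+\infty$, then $C/d(p)$ is read as $0$. *)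

theory Defs
  imports "HOL-Complex_Analysis.Complex_Analysis"
begin

type_synonym 'a chart = "'a set \<times> ('a \<Rightarrow> complex)"

locale riemann_surface =
  fixes X :: "'a topology" and \<A> :: "'a chart set"
  assumes nonempty: "topspace X \<noteq> {}"
    and connected: "connected_space X"
    and Hausdorff: "Hausdorff_space X"
    and covering: "topspace X = (\<Union>(U, \<phi>) \<in> \<A>. U)"
    and chart: "\<And>U \<phi>. (U, \<phi>) \<in> \<A> \<Longrightarrow>
      openin X U \<and> open (\<phi> ` U) \<and>
      homeomorphic_map (subtopology X U) (top_of_set (\<phi> ` U)) \<phi>"
    and transition: "\<And>U \<phi> V \<eta>. (U, \<phi>) \<in> \<A> \<Longrightarrow> (V, \<eta>) \<in> \<A> \<Longrightarrow>
      (\<eta> \<circ> inv_into U \<phi>) holomorphic_on (\<phi> ` (U \<inter> V))"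

definition coord_expr :: "'a chart \<Rightarrow> ('a \<Rightarrow> 'b) \<Rightarrow> complex \<Rightarrow> 'b" where
  "coord_expr c f = f \<circ> inv_into (fst c) (snd c)"

definition coord_region :: "'a chart \<Rightarrow> complex set" where
  "coord_region c = snd c ` fst c"

definition holomorphic_fun :: "'a chart set \<Rightarrow> ('a \<Rightarrow> complex) \<Rightarrow> bool" where
  "holomorphic_fun \<A> f \<longleftrightarrow> (\<forall>c\<in>\<A>. coord_expr c f holomorphic_on coord_region c)"

text \<open>\<open>du = Re (F dG)\<close>, written out in every chart.\<close>

definition primitive_Re_FdG ::
    "'a chart set \<Rightarrow> ('a \<Rightarrow> complex) \<Rightarrow> ('a \<Rightarrow> complex) \<Rightarrow> ('a \<Rightarrow> real) \<Rightarrow> bool" where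
  "primitive_Re_FdG \<A> F G u \<longleftrightarrow>
    (\<forall>c\<in>\<A>. \<forall>z\<in>coord_region c.
      (coord_expr c u has_derivative
        (\<lambda>h. Re (coord_expr c F z * deriv (coord_expr c G) z * h))) (at z))"

text \<open>The coefficient \<open>\<rho>\<close> in \<open>d\<tau>\<^sup>2 = 2(|dF|\<^sup>2 + |dG|\<^sup>2) = \<rho> |dz|\<^sup>2\<close>, where \<open>z\<close> is the
  coordinate of the chart \<open>c\<close>.\<close>

definition metric_coeff ::
    "'a chart \<Rightarrow> ('a \<Rightarrow> complex) \<Rightarrow> ('a \<Rightarrow> complex) \<Rightarrow> complex \<Rightarrow> real" where
  "metric_coeff c F G z =
    2 * ((cmod (deriv (coord_expr c F) z))\<^sup>2 + (cmod (deriv (coord_expr c G) z))\<^sup>2)"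

text \<open>\<open>\<psi>\<close> is the improper affine front with data \<open>(F, G)\<close>. The primitive \<open>u\<close> stands for
  \<open>Re \<integral>F dG\<close>, so its choice of additive constant is the one left open by the integral.
  The data is carried along with \<open>\<psi>\<close>: it is determined by \<open>\<psi>\<close> up to additive constants, which do
  not affect \<open>dF\<close> and \<open>dG\<close>.\<close>

definition improper_affine_front ::
    "'a topology \<Rightarrow> 'a chart set \<Rightarrow> ('a \<Rightarrow> complex) \<Rightarrow> ('a \<Rightarrow> complex) \<Rightarrow>
      ('a \<Rightarrow> complex \<times> real) \<Rightarrow> bool" where
  "improper_affine_front X \<A> F G \<psi> \<longleftrightarrow>
    holomorphic_fun \<A> F \<and> holomorphic_fun \<A> G \<and>
    (\<forall>c\<in>\<A>. \<forall>z\<in>coord_region c. metric_coeff c F G z > 0) \<and>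
    (\<exists>u. primitive_Re_FdG \<A> F G u \<and>
      (\<forall>p\<in>topspace X.
        \<psi> p = (G p + cnj (F p),
               ((cmod (G p))\<^sup>2 - (cmod (F p))\<^sup>2) / 2 + (Re (G p * F p) - 2 * u p))))"

text \<open>Below, a pointwise quantity that is the same in every chart is evaluated in an arbitrary
  chart around the point.\<close>

definition chart_at :: "'a chart set \<Rightarrow> 'a \<Rightarrow> 'a chart" where
  "chart_at \<A> p = (SOME c. c \<in> \<A> \<and> p \<in> fst c)"

text \<open>The extended plane \<open>\<complex> \<union> {\<infinity>}\<close> is \<^typ>\<open>complex option\<close> with \<open>\<infinity>\<close> rendered as
  \<^const>\<open>None\<close>. On a front \<open>dF\<close> and \<open>dG\<close> have no common zero, so the value of \<open>dF/dG\<close> at a point is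
  \<open>\<infinity>\<close> exactly where \<open>dG\<close> vanishes.\<close>

definition lagrangian_gauss_map ::
    "'a chart set \<Rightarrow> ('a \<Rightarrow> complex) \<Rightarrow> ('a \<Rightarrow> complex) \<Rightarrow> 'a \<Rightarrow> complex option" where
  "lagrangian_gauss_map \<A> F G p =
    (let c = chart_at \<A> p;
         dF = deriv (coord_expr c F) (snd c p);
         dG = deriv (coord_expr c G) (snd c p)
     in if dG = 0 then None else Some (dF / dG))"

definition laplacian :: "(complex \<Rightarrow> real) \<Rightarrow> complex \<Rightarrow> real" where
  "laplacian f z =
    deriv (deriv (\<lambda>x. f (Complex x (Im z)))) (Re z) +
    deriv (deriv (\<lambda>y. f (Complex (Re z) y))) (Im z)"

text \<open>The Gaussian curvature of \<open>\<rho> |dz|\<^sup>2\<close> is \<open>- \<Delta> (log \<rho>) / (2 \<rho>)\<close>.\<close>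

definition gaussian_curvature ::
    "'a chart set \<Rightarrow> ('a \<Rightarrow> complex) \<Rightarrow> ('a \<Rightarrow> complex) \<Rightarrow> 'a \<Rightarrow> real" where
  "gaussian_curvature \<A> F G p =
    (let c = chart_at \<A> p; z = snd c p
     in - laplacian (\<lambda>w. ln (metric_coeff c F G w)) z / (2 * metric_coeff c F G z))"

text \<open>Piecewise continuously differentiable curves on an interval \<open>I\<close>; on a non-compact \<open>I\<close> the
  break points may accumulate at a missing end point.\<close>

definition piecewise_C1_curve ::
    "'a topology \<Rightarrow> 'a chart set \<Rightarrow> real set \<Rightarrow> (real \<Rightarrow> 'a) \<Rightarrow> bool" where
  "piecewise_C1_curve X \<A> I \<gamma> \<longleftrightarrow>
    continuous_map (top_of_set I) X \<gamma> \<and>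
    (\<forall>a b. \<forall>(U, \<phi>)\<in>\<A>. {a..b} \<subseteq> I \<longrightarrow> \<gamma> ` {a..b} \<subseteq> U \<longrightarrow>
      (\<phi> \<circ> \<gamma>) piecewise_C1_differentiable_on {a..b})"

text \<open>The \<open>d\<tau>\<^sup>2\<close>-length, using \<open>dF(\<gamma>') = (F \<circ> \<gamma>)'\<close> and \<open>dG(\<gamma>') = (G \<circ> \<gamma>)'\<close>.\<close>

definition curve_length ::
    "('a \<Rightarrow> complex) \<Rightarrow> ('a \<Rightarrow> complex) \<Rightarrow> real set \<Rightarrow> (real \<Rightarrow> 'a) \<Rightarrow> ennreal" where
  "curve_length F G I \<gamma> =
    (\<integral>\<^sup>+t\<in>I. ennreal (sqrt (2 * ((norm (vector_derivative (F \<circ> \<gamma>) (at t)))\<^sup>2 +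
                               (norm (vector_derivative (G \<circ> \<gamma>) (at t)))\<^sup>2))) \<partial>lborel)"

definition divergent_curve :: "'a topology \<Rightarrow> (real \<Rightarrow> 'a) \<Rightarrow> bool" where
  "divergent_curve X \<gamma> \<longleftrightarrow>
    (\<forall>K. compactin X K \<longrightarrow> (\<exists>t\<^sub>0\<in>{0..<1}. \<forall>t\<in>{t\<^sub>0..<1}. \<gamma> t \<notin> K))"

definition boundary_dist ::
    "'a topology \<Rightarrow> 'a chart set \<Rightarrow> ('a \<Rightarrow> complex) \<Rightarrow> ('a \<Rightarrow> complex) \<Rightarrow> 'a \<Rightarrow> ennreal" where
  "boundary_dist X \<A> F G p =
    Inf {curve_length F G {0..<1} \<gamma> | \<gamma>.
      piecewise_C1_curve X \<A> {0..<1} \<gamma> \<and> \<gamma> 0 = p \<and> divergent_curve X \<gamma>}"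

definition geodesic_dist ::
    "'a topology \<Rightarrow> 'a chart set \<Rightarrow> ('a \<Rightarrow> complex) \<Rightarrow> ('a \<Rightarrow> complex) \<Rightarrow> 'a \<Rightarrow> 'a \<Rightarrow> ennreal" where
  "geodesic_dist X \<A> F G p q =
    Inf {curve_length F G {a..b} \<gamma> | a b \<gamma>.
      a \<le> b \<and> piecewise_C1_curve X \<A> {a..b} \<gamma> \<and> \<gamma> a = p \<and> \<gamma> b = q}"

text \<open>Completeness of \<open>d\<tau>\<^sup>2\<close>: Cauchy sequences for its distance function converge.\<close>

definition weakly_complete ::
    "'a topology \<Rightarrow> 'a chart set \<Rightarrow> ('a \<Rightarrow> complex) \<Rightarrow> ('a \<Rightarrow> complex) \<Rightarrow> bool" where
  "weakly_complete X \<A> F G \<longleftrightarrow>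
    (\<forall>\<sigma> :: nat \<Rightarrow> 'a. range \<sigma> \<subseteq> topspace X \<and>
       (\<forall>\<epsilon>>0. \<exists>N. \<forall>m\<ge>N. \<forall>n\<ge>N. geodesic_dist X \<A> F G (\<sigma> m) (\<sigma> n) < \<epsilon>) \<longrightarrow>
       (\<exists>q\<in>topspace X. (\<lambda>n. geodesic_dist X \<A> F G (\<sigma> n) q) \<longlonglongrightarrow> 0))"

text \<open>\<open>C\<close> is admissible in the curvature estimate for the omitted set \<open>A\<close>, for all Riemann surfaces
  whose points are taken from the type \<open>'a\<close>. In \<^typ>\<open>ennreal\<close>, \<open>C / \<infinity> = 0\<close>.\<close>

definition curvature_estimate :: "'a itself \<Rightarrow> complex option set \<Rightarrow> real \<Rightarrow> bool" where
  "curvature_estimate ty A C \<longleftrightarrow>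
    (\<forall>(X :: 'a topology) \<A> F G \<psi>.
      riemann_surface X \<A> \<longrightarrow> improper_affine_front X \<A> F G \<psi> \<longrightarrow>
      lagrangian_gauss_map \<A> F G ` topspace X \<inter> A = {} \<longrightarrow>
      (\<forall>p\<in>topspace X.
        ennreal (sqrt \<bar>gaussian_curvature \<A> F G p\<bar>) \<le> ennreal C / boundary_dist X \<A> F G p))"

text \<open>A constant depending on \<open>A\<close> only must serve Riemann surfaces over all types of points at once,
  but an existential quantifier in front of all types is not available. A Riemann surface has the
  cardinality of the continuum, so up to isomorphism each one occurs with its points (not its
  topology) taken from \<^typ>\<open>complex\<close>. A type-independent constant is therefore
  expressed by two assertions: there is a \<open>C > 0\<close> with
  \<^term>\<open>curvature_estimate TYPE(complex) A C\<close>, and every such \<open>C\<close> satisfies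
  \<^term>\<open>curvature_estimate TYPE('a) A C\<close> for an arbitrary type \<open>'a\<close>.\<close>

end

theory Submission
  imports Defs
begin

text \<open>Write \<open>W = F' G'' - F'' G'\<close> for the Wronskian of the derivatives of the data, and attach to a value
  \<open>\<alpha>\<close> the 1-form \<open>dF - \<alpha> dG\<close> (\<open>dG\<close> for \<open>\<alpha> = \<infinity>\<close>); the Gauss map omits \<open>\<alpha>\<close> exactly when this form has no
  zero. Let \<open>P\<close> be the product of the forms of four omitted values. Under a change of coordinate \<open>W\<close> has
  weight 3 and \<open>P\<close> has weight 4, so \<open>V = W\<^sup>5 / P\<^sup>4\<close> has weight \<open>15 - 16 = -1\<close>: it is a holomorphic vector
  field on the whole surface (\<open>wronskian_vector_field\<close>). Its flow in complex time, started at a point \<open>p\<close>,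
  plays the part that the exponential map of a flat metric plays in Fujimoto's method, but it is single
  valued and defined at the zeros of \<open>W\<close> as well.

  In the flow coordinate \<open>\<zeta>\<close> the relation \<open>W\<^sup>5 = P\<^sup>4\<close> holds identically. On the other hand the quotient of
  two of the forms, suitably scaled, omits 0 and 1, and so does its fifth root. Schottky's theorem for that
  root bounds \<open>W\<close> in a disc of radius \<open>R\<close> about 0 by \<open>(R - |\<zeta>|)\<^sup>5 |W|\<^sup>5 \<le> C |l\<^sub>1|\<^sup>4 |l\<^sub>2|\<^sup>6\<close>, where \<open>l\<^sub>1\<close> is the smallest
  form and \<open>l\<^sub>2\<close> another one. The two facts together give, for the coefficient \<open>2 N = 2 (|F'|\<^sup>2 + |G'|\<^sup>2)\<close> of the metric,
  \<open>(R - |\<zeta>|)\<^sup>5 N\<^sup>3 \<le> C\<close> (\<open>energy_bound\<close>). Hence a radius of the flow disc has length at most a constant times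
  \<open>R\<^sup>1\<^sup>/\<^sup>6\<close>, and the curvature \<open>K = - |W|\<^sup>2 / N\<^sup>3\<close> at the centre satisfies \<open>R\<^sup>5 |K|\<^sup>1\<^sup>5 \<le> C\<close>. Flows exist for a time
  that is uniform on compact sets, so on the maximal flow disc either \<open>R = \<infinity>\<close>, and then \<open>K(p) = 0\<close>, or some
  radius is a divergent curve (\<open>integral_map_maximal\<close>), and then \<open>d(p)\<close> is at most the length of that radius.
  The powers of \<open>R\<close> cancel in the product of \<open>\<bar>K\<bar>\<^sup>1\<^sup>/\<^sup>2\<close> and \<open>d\<close> (\<open>curvature_estimate_exists\<close>).

  The exponents 5 and 4 come from the weights. For \<open>W\<^sup>b / P\<^sup>a\<close> to be a vector field one needs \<open>4 a = 3 b + 1\<close>,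
  and the radial integral converges only if \<open>a < b\<close>; the case \<open>a = b = 1\<close> fails by a logarithm, and
  \<open>a = 4\<close>, \<open>b = 5\<close> is the next integral solution.

  A constant for surfaces over the complex numbers serves for all types, because the surface has at most
  continuum many points: \<open>(F, G)\<close> is an immersion, so a path on the surface is determined by its starting point
  and its image in \<open>\<complex>\<^sup>2\<close>, and its image is determined by countably many rational cuts (\<open>ex_inj_points\<close>). The surface
  can therefore be relabelled by complex numbers (\<open>curvature_estimate_transfer\<close>).

  For the second assertion, completeness makes every divergent curve infinitely long
  (\<open>complete_imp_boundary_dist_infinite\<close>). If four values were omitted, the estimate would give \<open>K = 0\<close>
  everywhere, and a vanishing Wronskian forces the Gauss map to be constant (\<open>flat_imp_gauss_constant\<close>).\<close>

section \<open>Landau type bounds and the Wronskian\<close>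

text \<open>The Wronskian of the derivatives \<open>f'\<close>, \<open>g'\<close>, not of \<open>f\<close>, \<open>g\<close> themselves: the numerator of the derivative
  of \<open>f' / g'\<close>, up to sign.\<close>

definition wronskian :: "(complex \<Rightarrow> complex) \<Rightarrow> (complex \<Rightarrow> complex) \<Rightarrow> complex \<Rightarrow> complex" where
  "wronskian f g z = deriv f z * deriv (deriv g) z - deriv (deriv f) z * deriv g z"

lemma deriv_comp:
  assumes "f holomorphic_on D" "open D" "h holomorphic_on S" "open S" "h ` S \<subseteq> D" "z \<in> S"
  shows "deriv (f \<circ> h) z = deriv f (h z) * deriv h z"
  using assms by (intro deriv_chain) (auto intro: holomorphic_on_imp_differentiable_at)

lemma deriv_deriv_comp:
  assumes "f holomorphic_on D" "open D" "h holomorphic_on S" "open S" "h ` S \<subseteq> D" "z \<in> S"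
  shows "deriv (deriv (f \<circ> h)) z = deriv (deriv f) (h z) * (deriv h z)\<^sup>2 + deriv f (h z) * deriv (deriv h) z"
proof -
  have "deriv (deriv (f \<circ> h)) z = deriv (\<lambda>w. (deriv f \<circ> h) w * deriv h w) z"
    using assms deriv_comp[OF assms(1-5)]
    by (intro deriv_cong_ev eventually_nhds_in_open[THEN eventually_mono] refl) auto
  moreover have "deriv f holomorphic_on D" "deriv h holomorphic_on S"
    using assms by (auto intro: holomorphic_deriv)
  moreover then have "(deriv f \<circ> h) holomorphic_on S"
    using assms by (meson holomorphic_on_compose_gen image_subset_iff)
  ultimately have "deriv (deriv (f \<circ> h)) z = (deriv f \<circ> h) z * deriv (deriv h) z + deriv (deriv f \<circ> h) z * deriv h z"
    using assms by (subst (asm) deriv_mult) (auto simp: holomorphic_on_imp_differentiable_at)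
  then show ?thesis
    using deriv_comp[OF \<open>deriv f holomorphic_on D\<close> assms(2-)] by (simp add: power2_eq_square)
qed

text \<open>The terms with \<open>h''\<close> cancel, so the Wronskian is a differential of weight 3.\<close>

lemma wronskian_comp:
  assumes "f holomorphic_on D" "g holomorphic_on D" "open D" "h holomorphic_on S" "open S" "h ` S \<subseteq> D" "z \<in> S"
  shows "wronskian (f \<circ> h) (g \<circ> h) z = wronskian f g (h z) * deriv h z ^ 3"
  unfolding wronskian_def
  using assms deriv_comp[of f D h S z] deriv_comp[of g D h S z]
    deriv_deriv_comp[of f D h S z] deriv_deriv_comp[of g D h S z]
  by (simp add: algebra_simps power2_eq_square power3_eq_cube)

text \<open>Schottky's theorem bounds \<open>g\<close> on the disc of half the radius by a constant that depends on an upper bound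
  for \<open>|g z0|\<close> only, and Cauchy's inequality turns this into a bound for the derivative. The estimate is thus
  uniform as \<open>g z0\<close> tends to the omitted value 0.\<close>

lemma landau_bound:
  fixes r :: real
  obtains L where "L > 0"
    "\<And>g z0 d. \<lbrakk>0 < d; g holomorphic_on ball z0 d; \<And>z. z \<in> ball z0 d \<Longrightarrow> g z \<noteq> 0 \<and> g z \<noteq> 1; cmod (g z0) \<le> r\<rbrakk>
       \<Longrightarrow> d * cmod (deriv g z0) \<le> L"
proof -
  define B where "B = exp (pi * exp (pi * (2 + 2 * r + 12 * (1/2) / (1 - 1/2))))"
  show thesis
  proof
    show "4 * B > 0" by (simp add: B_def)
    fix g z0 and d :: real
    assume d: "0 < d" and g: "g holomorphic_on ball z0 d"
      and om: "\<And>z. z \<in> ball z0 d \<Longrightarrow> g z \<noteq> 0 \<and> g z \<noteq> 1" and r: "cmod (g z0) \<le> r"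
    \<comment> \<open>Schottky's theorem is for functions on the closed unit disc, hence the radius \<open>d / 2\<close>.\<close>
    define a where "a = complex_of_real (d / 2)"
    have a: "cmod a = d / 2" using d by (simp add: a_def)
    have in_ball: "z0 + a * z \<in> ball z0 d" if "z \<in> cball 0 1" for z
    proof -
      have "cmod (a * z) \<le> d / 2 * 1"
        unfolding norm_mult a using that d by (intro mult_left_mono) auto
      then show ?thesis using d by (simp add: dist_norm)
    qed
    have bd: "cmod (g (z0 + a * z)) \<le> B" if "cmod z \<le> 1/2" for z
    proof -
      have "((\<lambda>z. g (z0 + a * z))) holomorphic_on cball 0 1"
        using in_ball by (intro holomorphic_on_compose_gen[OF _ g, unfolded comp_def]) (auto intro!: holomorphic_intros)
      from Schottky[OF this, of r "1/2" z] show ?thesis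
        using r om in_ball that by (auto simp: B_def)
    qed
    have "norm ((deriv ^^ 1) g z0) \<le> fact 1 * B / (d / 4) ^ 1"
    proof (rule Cauchy_inequality)
      show "g holomorphic_on ball z0 (d / 4)" "continuous_on (cball z0 (d / 4)) g"
        using d by (auto intro!: holomorphic_on_imp_continuous_on intro: holomorphic_on_subset[OF g])
      show "d / 4 > 0" using d by simp
      fix x assume x: "cmod (z0 - x) = d / 4"
      have "cmod ((x - z0) / a) \<le> 1 / 2" using x d by (simp add: norm_divide a norm_minus_commute)
      moreover have "a \<noteq> 0" using a d by auto
      then have "z0 + a * ((x - z0) / a) = x" by simp
      ultimately show "cmod (g x) \<le> B" using bd[of "(x - z0) / a"] by simp
    qed
    then show "d * cmod (deriv g z0) \<le> 4 * B" using d by (simp add: field_simps)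
  qed
qed

text \<open>A fifth root \<open>g\<close> of \<open>\<phi>\<close> omits 0 and 1 as well, and \<open>\<phi>' = 5 g\<^sup>4 g'\<close>. Near the omitted value 0
  this bounds \<open>|\<phi>'|\<close> by \<open>|\<phi>|\<^sup>4\<^sup>/\<^sup>5\<close>, in place of the sharp \<open>|\<phi>| log (1 / |\<phi>|)\<close> of the hyperbolic metric.\<close>

lemma landau_fifth_power:
  fixes r :: real
  obtains L where "L > 0"
    "\<And>\<phi> z0 d. \<lbrakk>0 < d; \<phi> holomorphic_on ball z0 d; \<And>z. z \<in> ball z0 d \<Longrightarrow> \<phi> z \<noteq> 0 \<and> \<phi> z \<noteq> 1; cmod (\<phi> z0) \<le> r\<rbrakk>
       \<Longrightarrow> (d * cmod (deriv \<phi> z0)) ^ 5 \<le> L * cmod (\<phi> z0) ^ 4"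
proof -
  obtain L where L: "L > 0" 
    "\<And>g z0 d. \<lbrakk>0 < d; g holomorphic_on ball z0 d; \<And>z. z \<in> ball z0 d \<Longrightarrow> g z \<noteq> 0 \<and> g z \<noteq> 1; cmod (g z0) \<le> max 1 r\<rbrakk>
       \<Longrightarrow> d * cmod (deriv g z0) \<le> L" using landau_bound[of "max 1 r"] by blast
  show thesis
  proof
    show "(5 * L) ^ 5 > 0" using L by simp
    fix \<phi> z0 and d :: real
    assume d: "0 < d" and hol: "\<phi> holomorphic_on ball z0 d"
      and om: "\<And>z. z \<in> ball z0 d \<Longrightarrow> \<phi> z \<noteq> 0 \<and> \<phi> z \<noteq> 1" and r: "cmod (\<phi> z0) \<le> r"
    obtain l where l: "l holomorphic_on ball z0 d" "\<And>z. z \<in> ball z0 d \<Longrightarrow> \<phi> z = exp (l z)"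
      using contractible_imp_holomorphic_log[OF hol] om by (metis convex_ball convex_imp_contractible)
    define g where "g = (\<lambda>z. exp (l z / 5))"
    have g5: "g z ^ 5 = \<phi> z" if "z \<in> ball z0 d" for z
      using l(2)[OF that] by (simp add: g_def flip: exp_of_nat_mult)
    have g: "g holomorphic_on ball z0 d" unfolding g_def by (intro holomorphic_intros l) auto
    have c: "z0 \<in> ball z0 d" using d by simp
    have "cmod (g z0) \<le> max 1 r"
    proof (rule ccontr)
      assume n: "\<not> ?thesis"
      then have "cmod (g z0) ^ 1 \<le> cmod (g z0) ^ 5" by (intro power_increasing) auto
      also have "\<dots> = cmod (\<phi> z0)" using g5[OF c] by (simp flip: norm_power)
      finally show False using r n by simp
    qed
    moreover have "g z \<noteq> 0 \<and> g z \<noteq> 1" if "z \<in> ball z0 d" for z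
      using g5[OF that] om[OF that] by auto
    ultimately have b: "d * cmod (deriv g z0) \<le> L" using L(2)[OF d g] by blast
    have "deriv \<phi> z0 = deriv (\<lambda>z. g z ^ 5) z0"
      using c g5 by (intro deriv_cong_ev eventually_nhds_in_open[of "ball z0 d", THEN eventually_mono]) auto
    also have "\<dots> = 5 * g z0 ^ 4 * deriv g z0"
      using holomorphic_derivI[OF g open_ball c] by (intro DERIV_imp_deriv) (auto intro!: derivative_eq_intros)
    finally have "cmod (deriv \<phi> z0) = 5 * cmod (g z0) ^ 4 * cmod (deriv g z0)"
      by (simp add: norm_mult norm_power)
    then have "(d * cmod (deriv \<phi> z0)) ^ 5 = (5 * (d * cmod (deriv g z0))) ^ 5 * cmod (g z0 ^ 5) ^ 4"
      by (simp add: norm_power power_mult_distrib mult_ac)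
    also have "\<dots> = (5 * (d * cmod (deriv g z0))) ^ 5 * cmod (\<phi> z0) ^ 4" using g5[OF c] by simp
    also have "\<dots> \<le> (5 * L) ^ 5 * cmod (\<phi> z0) ^ 4"
      using b d by (intro mult_right_mono power_mono) auto
    finally show "(d * cmod (deriv \<phi> z0)) ^ 5 \<le> (5 * L) ^ 5 * cmod (\<phi> z0) ^ 4" .
  qed
qed

section \<open>The linear forms of the omitted values\<close>

text \<open>The linear form on \<open>\<complex>\<^sup>2\<close> whose kernel is the line of slope \<open>a / b = \<alpha>\<close>, where \<open>None\<close> stands for \<open>\<infinity>\<close>.\<close>

definition value_form :: "complex option \<Rightarrow> complex \<Rightarrow> complex \<Rightarrow> complex" where
  "value_form \<alpha> a b = (case \<alpha> of None \<Rightarrow> b | Some x \<Rightarrow> a - x * b)"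

lemma value_form_scale: "value_form \<alpha> (a * c) (b * c) = value_form \<alpha> a b * c"
  by (simp add: value_form_def algebra_simps split: option.splits)

lemma value_form_bound:
  obtains k where "k > 0" "\<And>a b. (cmod (value_form \<alpha> a b))\<^sup>2 \<le> k * ((cmod a)\<^sup>2 + (cmod b)\<^sup>2)"
proof (cases \<alpha>)
  case None
  then show thesis by (intro that[of 1]) (auto simp: value_form_def)
next
  case (Some x)
  show thesis
  proof (rule that)
    show "0 < 2 * (1 + (cmod x)\<^sup>2)" by (simp add: add_pos_nonneg)
    fix a b
    have "(cmod (a - x * b))\<^sup>2 \<le> (cmod a + cmod (x * b))\<^sup>2" by (intro power_mono norm_triangle_ineq4) auto
    also have "\<dots> \<le> 2 * ((cmod a)\<^sup>2 + (cmod (x * b))\<^sup>2)"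
      using sum_squares_bound[of "cmod a" "cmod (x * b)"] by (simp add: power2_sum)
    also have "\<dots> \<le> 2 * (1 + (cmod x)\<^sup>2) * ((cmod a)\<^sup>2 + (cmod b)\<^sup>2)"
      by (simp add: norm_mult power_mult_distrib algebra_simps)
    finally show "(cmod (value_form \<alpha> a b))\<^sup>2 \<le> 2 * (1 + (cmod x)\<^sup>2) * ((cmod a)\<^sup>2 + (cmod b)\<^sup>2)"
      by (simp add: value_form_def Some)
  qed
qed

lemma value_form_solve:
  assumes "\<alpha> \<noteq> \<beta>"
  obtains p q r s where
    "\<And>a b. a = p * value_form \<alpha> a b + q * value_form \<beta> a b"
    "\<And>a b. b = r * value_form \<alpha> a b + s * value_form \<beta> a b"
proof -
  show thesis
  proof (cases \<alpha>)
    case None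
    then obtain x where "\<beta> = Some x" using assms by (cases \<beta>) auto
    then show thesis using None by (intro that[of x 1 1 0]) (auto simp: value_form_def)
  next
    case (Some x)
    show thesis
    proof (cases \<beta>)
      case None
      then show thesis using Some by (intro that[of 1 x 0 1]) (auto simp: value_form_def)
    next
      case (Some y)
      with \<open>\<alpha> = Some x\<close> assms have "y - x \<noteq> 0" by auto
      then obtain c where "c * (y - x) = 1" by (metis left_inverse)
      then have "a = (y * c) * (a - x * b) + (- x * c) * (a - y * b)" "b = c * (a - x * b) + (- c) * (a - y * b)" for a b
        by algebra+
      then show thesis using Some \<open>\<alpha> = Some x\<close>
        by (intro that[of "y * c" "- x * c" c "- c"]) (simp_all add: value_form_def)
    qed
  qed
qed

text \<open>The kernels of two different forms meet in 0 only, so the larger of the two controls the whole vector.\<close>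

lemma value_form_coercive:
  assumes "\<alpha> \<noteq> \<beta>"
  obtains k where "k > 0"
    "\<And>a b. cmod (value_form \<alpha> a b) \<le> cmod (value_form \<beta> a b) \<Longrightarrow> (cmod a)\<^sup>2 + (cmod b)\<^sup>2 \<le> k * (cmod (value_form \<beta> a b))\<^sup>2"
proof -
  obtain p q r s where pq: "\<And>a b. a = p * value_form \<alpha> a b + q * value_form \<beta> a b"
    "\<And>a b. b = r * value_form \<alpha> a b + s * value_form \<beta> a b" using value_form_solve[OF assms] by blast
  have *: "(cmod (p * u + q * v))\<^sup>2 \<le> (cmod p + cmod q)\<^sup>2 * (cmod v)\<^sup>2" if "cmod u \<le> cmod v" for p q u v
  proof -
    have "cmod (p * u + q * v) \<le> cmod p * cmod u + cmod q * cmod v" by (metis norm_mult norm_triangle_ineq)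
    also have "\<dots> \<le> (cmod p + cmod q) * cmod v" using that by (simp add: distrib_right mult_left_mono)
    finally show ?thesis by (metis power_mono norm_ge_zero power_mult_distrib)
  qed
  show thesis
  proof (rule that)
    show "0 < 1 + (cmod p + cmod q)\<^sup>2 + (cmod r + cmod s)\<^sup>2" by (simp add: add_pos_nonneg)
    fix a b assume le: "cmod (value_form \<alpha> a b) \<le> cmod (value_form \<beta> a b)"
    have "(cmod a)\<^sup>2 \<le> (cmod p + cmod q)\<^sup>2 * (cmod (value_form \<beta> a b))\<^sup>2"
      by (subst pq(1)[of a b], rule *[OF le])
    moreover have "(cmod b)\<^sup>2 \<le> (cmod r + cmod s)\<^sup>2 * (cmod (value_form \<beta> a b))\<^sup>2"
      by (subst pq(2)[of b a], rule *[OF le])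
    ultimately show "(cmod a)\<^sup>2 + (cmod b)\<^sup>2 \<le> (1 + (cmod p + cmod q)\<^sup>2 + (cmod r + cmod s)\<^sup>2) * (cmod (value_form \<beta> a b))\<^sup>2"
      using zero_le_power2[of "cmod (value_form \<beta> a b)"] unfolding distrib_right mult_1 by linarith
  qed
qed

lemma value_form_third:
  assumes "\<alpha> \<noteq> \<beta>" "\<alpha> \<noteq> \<gamma>" "\<beta> \<noteq> \<gamma>"
  obtains s t where "s \<noteq> 0" "t \<noteq> 0" "\<And>a b. value_form \<gamma> a b = s * value_form \<alpha> a b + t * value_form \<beta> a b"
proof (cases \<gamma>)
  case None
  then obtain x y where "\<alpha> = Some x" "\<beta> = Some y" "y - x \<noteq> 0" using assms by (cases \<alpha>; cases \<beta>; auto)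
  then obtain c where "c * (y - x) = 1" by (metis left_inverse)
  moreover from this have "b = c * (a - x * b) + (- c) * (a - y * b)" for a b
    by algebra
  ultimately show thesis using None \<open>\<alpha> = Some x\<close> \<open>\<beta> = Some y\<close>
    by (intro that[of c "- c"]) (auto simp: value_form_def)
next
  case (Some z)
  show thesis
  proof (cases \<alpha>)
    case None
    then obtain y where "\<beta> = Some y" "y - z \<noteq> 0" using assms Some by (cases \<beta>) auto
    then show thesis using None Some
      by (intro that[of "y - z" 1]) (auto simp: value_form_def algebra_simps)
  next
    case A: (Some x)
    show thesis
    proof (cases \<beta>)
      case None
      then show thesis using A Some assms by (intro that[of 1 "x - z"]) (auto simp: value_form_def algebra_simps)
    next
      case B: (Some y)
      have "y - x \<noteq> 0" "y - z \<noteq> 0" "z - x \<noteq> 0" using A B Some assms by auto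
      moreover from this obtain c where c: "c * (y - x) = 1" by (metis left_inverse)
      moreover from c have "c \<noteq> 0" by auto
      moreover from c have "a - z * b = ((y - z) * c) * (a - x * b) + ((z - x) * c) * (a - y * b)" for a b
        by algebra
      ultimately show thesis using A B Some
        by (intro that[of "(y - z) * c" "(z - x) * c"]) (simp_all add: value_form_def)
    qed
  qed
qed

text \<open>The determinant of two derivatives of forms is, up to a constant, the Wronskian of the data.\<close>

lemma value_form_det:
  assumes "\<alpha> \<noteq> \<beta>"
  obtains c where "c \<noteq> 0" "\<And>a b a' b'. value_form \<alpha> a' b' * value_form \<beta> a b - value_form \<alpha> a b * value_form \<beta> a' b' = c * (a * b' - a' * b)"
proof (cases \<alpha>)
  case None
  then obtain x where "\<beta> = Some x" using assms by (cases \<beta>) auto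
  then show thesis using None by (intro that[of 1]) (auto simp: value_form_def algebra_simps)
next
  case (Some x)
  show thesis
  proof (cases \<beta>)
    case None
    then show thesis using Some by (intro that[of "-1"]) (auto simp: value_form_def algebra_simps)
  next
    case B: (Some y)
    then have "x - y \<noteq> 0" using Some assms by auto
    moreover have "(a' - x * b') * (a - y * b) - (a - x * b) * (a' - y * b') = (y - x) * (a * b' - a' * b)" for a b a' b'
      by algebra
    ultimately show thesis using Some B by (intro that[of "y - x"]) (simp_all add: value_form_def)
  qed
qed

lemma value_form_holomorphic [holomorphic_intros]:
  assumes "a holomorphic_on S" "b holomorphic_on S"
  shows "(\<lambda>z. value_form \<alpha> (a z) (b z)) holomorphic_on S"
  using assms unfolding value_form_def by (cases \<alpha>) (auto intro!: holomorphic_intros)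

lemma value_form_deriv:
  assumes "(a has_field_derivative a') (at z)" "(b has_field_derivative b') (at z)"
  shows "((\<lambda>z. value_form \<alpha> (a z) (b z)) has_field_derivative value_form \<alpha> a' b') (at z)"
  using assms unfolding value_form_def by (cases \<alpha>) (auto intro!: derivative_eq_intros)

section \<open>The energy bound under the relation between Wronskian and forms\<close>

text \<open>The arithmetic that converts an estimate for \<open>\<phi> = k u / v\<close> into one for \<open>u\<close> and \<open>v\<close>.\<close>

lemma clear_power_denominators:
  fixes v p d w L k u :: real
  assumes "v > 0" "p > 0" "(d * (p * w / v\<^sup>2)) ^ 5 \<le> L * (k * u / v) ^ 4"
  shows "(d * w) ^ 5 \<le> L * k ^ 4 / p ^ 5 * u ^ 4 * v ^ 6"
proof -
  have "(d * w) ^ 5 = (d * (p * w / v\<^sup>2)) ^ 5 * ((v\<^sup>2) ^ 5 / p ^ 5)"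
    using assms by (simp add: power_mult_distrib power_divide)
  also have "\<dots> \<le> (L * (k * u / v) ^ 4) * ((v\<^sup>2) ^ 5 / p ^ 5)"
    using assms by (intro mult_right_mono) auto
  also have "(v\<^sup>2) ^ 5 = v ^ 4 * v ^ 6" by (simp flip: power_add power_mult)
  also have "(L * (k * u / v) ^ 4) * (v ^ 4 * v ^ 6 / p ^ 5) = L * k ^ 4 / p ^ 5 * u ^ 4 * v ^ 6 * (v ^ 4 / v ^ 4)"
    by (simp only: power_mult_distrib power_divide) (simp only: divide_inverse mult_ac)
  also have "\<dots> = L * k ^ 4 / p ^ 5 * u ^ 4 * v ^ 6" using assms(1) by simp
  finally show ?thesis .
qed

text \<open>With the third form written as \<open>s u + t v\<close> in the first two, the function \<open>\<phi> = - s u / (t v)\<close> takes neither the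
  value 0 nor the value 1, and its derivative is a constant multiple of \<open>W / v\<^sup>2\<close>.\<close>

lemma wronskian_bound:
  assumes "\<alpha> \<noteq> \<beta>" "\<alpha> \<noteq> \<gamma>" "\<beta> \<noteq> \<gamma>"
  obtains L where "L > 0"
    "\<And>a b z0 d. \<lbrakk>0 < d; a holomorphic_on ball z0 d; b holomorphic_on ball z0 d;
       \<And>z \<delta>. \<lbrakk>z \<in> ball z0 d; \<delta> \<in> {\<alpha>, \<beta>, \<gamma>}\<rbrakk> \<Longrightarrow> value_form \<delta> (a z) (b z) \<noteq> 0;
       cmod (value_form \<alpha> (a z0) (b z0)) \<le> cmod (value_form \<beta> (a z0) (b z0))\<rbrakk>
      \<Longrightarrow> (d * cmod (a z0 * deriv b z0 - deriv a z0 * b z0)) ^ 5 \<le>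
          L * cmod (value_form \<alpha> (a z0) (b z0)) ^ 4 * cmod (value_form \<beta> (a z0) (b z0)) ^ 6"
proof -
  obtain s t where st: "s \<noteq> 0" "t \<noteq> 0" "\<And>a b. value_form \<gamma> a b = s * value_form \<alpha> a b + t * value_form \<beta> a b"
    using value_form_third[OF assms] by blast
  obtain c where c: "c \<noteq> 0" "\<And>a b a' b'. value_form \<alpha> a' b' * value_form \<beta> a b - value_form \<alpha> a b * value_form \<beta> a' b' = c * (a * b' - a' * b)"
    using value_form_det[OF assms(1)] by blast
  define k where "k = - s / t"
  have k: "k \<noteq> 0" using st by (simp add: k_def)
  obtain L where L: "L > 0"
    "\<And>\<phi> z0 d. \<lbrakk>0 < d; \<phi> holomorphic_on ball z0 d; \<And>z. z \<in> ball z0 d \<Longrightarrow> \<phi> z \<noteq> 0 \<and> \<phi> z \<noteq> 1; cmod (\<phi> z0) \<le> cmod k\<rbrakk>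
       \<Longrightarrow> (d * cmod (deriv \<phi> z0)) ^ 5 \<le> L * cmod (\<phi> z0) ^ 4"
    using landau_fifth_power[of "cmod k"] by blast
  show thesis
  proof
    show "L * cmod k ^ 4 / cmod (k * c) ^ 5 > 0" using L k c by simp
    fix a b z0 and d :: real
    assume d: "0 < d" and hol: "a holomorphic_on ball z0 d" "b holomorphic_on ball z0 d"
      and nz: "\<And>z \<delta>. \<lbrakk>z \<in> ball z0 d; \<delta> \<in> {\<alpha>, \<beta>, \<gamma>}\<rbrakk> \<Longrightarrow> value_form \<delta> (a z) (b z) \<noteq> 0"
      and le: "cmod (value_form \<alpha> (a z0) (b z0)) \<le> cmod (value_form \<beta> (a z0) (b z0))"
    define u where "u = (\<lambda>z. value_form \<alpha> (a z) (b z))"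
    define v where "v = (\<lambda>z. value_form \<beta> (a z) (b z))"
    define \<phi> where "\<phi> = (\<lambda>z. k * u z / v z)"
    have z0: "z0 \<in> ball z0 d" using d by simp
    have uv: "u z \<noteq> 0" "v z \<noteq> 0" if "z \<in> ball z0 d" for z using nz[OF that] by (auto simp: u_def v_def)
    have "\<phi> holomorphic_on ball z0 d"
      unfolding \<phi>_def using uv by (auto simp: u_def v_def intro!: holomorphic_intros hol)
    moreover have "\<phi> z \<noteq> 0 \<and> \<phi> z \<noteq> 1" if "z \<in> ball z0 d" for z
    proof
      show "\<phi> z \<noteq> 0" using uv[OF that] k by (simp add: \<phi>_def)
      show "\<phi> z \<noteq> 1"
      proof
        assume "\<phi> z = 1"
        then have "- (s * u z) = t * v z" using uv[OF that] st by (simp add: \<phi>_def k_def field_simps)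
        then have "s * u z + t * v z = 0" by (metis add.right_inverse)
        then show False using nz[OF that, of \<gamma>] st(3) by (simp add: u_def v_def)
      qed
    qed
    moreover have "cmod (\<phi> z0) \<le> cmod k"
      using le uv[OF z0] by (simp add: \<phi>_def norm_mult norm_divide u_def v_def divide_le_eq mult_left_mono)
    ultimately have *: "(d * cmod (deriv \<phi> z0)) ^ 5 \<le> L * cmod (\<phi> z0) ^ 4" using L(2)[OF d] by blast
    have da: "(a has_field_derivative deriv a z0) (at z0)" and db: "(b has_field_derivative deriv b z0) (at z0)"
      using hol z0 by (auto intro: holomorphic_derivI)
    have "(u has_field_derivative value_form \<alpha> (deriv a z0) (deriv b z0)) (at z0)"
      "(v has_field_derivative value_form \<beta> (deriv a z0) (deriv b z0)) (at z0)"
      unfolding u_def v_def by (intro value_form_deriv da db)+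
    then have "((\<lambda>z. u z / v z) has_field_derivative (value_form \<alpha> (deriv a z0) (deriv b z0) * v z0 - u z0 * value_form \<beta> (deriv a z0) (deriv b z0)) / (v z0 * v z0)) (at z0)"
      by (rule DERIV_divide) (rule uv(2)[OF z0])
    then have "(\<phi> has_field_derivative k * ((value_form \<alpha> (deriv a z0) (deriv b z0) * v z0 - u z0 * value_form \<beta> (deriv a z0) (deriv b z0)) / (v z0 * v z0))) (at z0)"
      unfolding \<phi>_def times_divide_eq_right[symmetric] by (rule DERIV_cmult)
    then have "deriv \<phi> z0 = k * (c * (a z0 * deriv b z0 - deriv a z0 * b z0) / (v z0 * v z0))"
      unfolding u_def v_def c(2) by (rule DERIV_imp_deriv)
    then have eq: "cmod (deriv \<phi> z0) = cmod (k * c) * cmod (a z0 * deriv b z0 - deriv a z0 * b z0) / (cmod (v z0))\<^sup>2"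
      by (simp add: norm_mult norm_divide power2_eq_square)
    define w where "w = cmod (a z0 * deriv b z0 - deriv a z0 * b z0)"
    have v0: "cmod (v z0) > 0" and kc: "cmod (k * c) > 0" using uv[OF z0] k c by auto
    have "cmod (\<phi> z0) = cmod k * cmod (u z0) / cmod (v z0)"
      by (simp add: \<phi>_def norm_mult norm_divide)
    with * eq have "(d * (cmod (k * c) * w / (cmod (v z0))\<^sup>2)) ^ 5 \<le> L * (cmod k * cmod (u z0) / cmod (v z0)) ^ 4"
      by (simp add: w_def)
    from clear_power_denominators[OF v0 kc this]
    show "(d * cmod (a z0 * deriv b z0 - deriv a z0 * b z0)) ^ 5 \<le>
       L * cmod k ^ 4 / cmod (k * c) ^ 5 * cmod (value_form \<alpha> (a z0) (b z0)) ^ 4 * cmod (value_form \<beta> (a z0) (b z0)) ^ 6"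
      by (simp add: w_def u_def v_def)
  qed
qed

definition form_prod :: "complex option set \<Rightarrow> complex \<Rightarrow> complex \<Rightarrow> complex" where
  "form_prod B a b = (\<Prod>\<alpha>\<in>B. value_form \<alpha> a b)"

text \<open>At the centre the forms of \<open>\<beta>\<close>, \<open>\<gamma>\<close>, \<open>\<delta>\<close> are all comparable with the square root of \<open>N = |a|\<^sup>2 + |b|\<^sup>2\<close>, because the form
  of \<open>\<alpha>\<close> is the smallest. So \<open>|W|\<^sup>5 = |P|\<^sup>4\<close> is at least a multiple of \<open>|l\<^sub>\<alpha>|\<^sup>4 N\<^sup>6\<close>, whereas the Wronskian bound is a multiple
  of \<open>|l\<^sub>\<alpha>|\<^sup>4 N\<^sup>3 / d\<^sup>5\<close>. The factor \<open>|l\<^sub>\<alpha>|\<^sup>4\<close>, which has no lower bound, cancels.\<close>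

lemma energy_bound_smallest:
  assumes "distinct [\<alpha>, \<beta>, \<gamma>, \<delta>]"
  obtains C where "C > 0"
    "\<And>a b z0 d. \<lbrakk>0 < d; a holomorphic_on ball z0 d; b holomorphic_on ball z0 d;
       \<And>z \<epsilon>. \<lbrakk>z \<in> ball z0 d; \<epsilon> \<in> {\<alpha>, \<beta>, \<gamma>, \<delta>}\<rbrakk> \<Longrightarrow> value_form \<epsilon> (a z) (b z) \<noteq> 0;
       (a z0 * deriv b z0 - deriv a z0 * b z0) ^ 5 = form_prod {\<alpha>, \<beta>, \<gamma>, \<delta>} (a z0) (b z0) ^ 4;
       \<And>\<epsilon>. \<epsilon> \<in> {\<beta>, \<gamma>, \<delta>} \<Longrightarrow> cmod (value_form \<alpha> (a z0) (b z0)) \<le> cmod (value_form \<epsilon> (a z0) (b z0))\<rbrakk>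
      \<Longrightarrow> d ^ 5 * ((cmod (a z0))\<^sup>2 + (cmod (b z0))\<^sup>2) ^ 3 \<le> C"
proof -
  obtain k1 where k1: "k1 > 0"  "\<And>a b. cmod (value_form \<alpha> a b) \<le> cmod (value_form \<beta> a b) \<Longrightarrow> (cmod a)\<^sup>2 + (cmod b)\<^sup>2 \<le> k1 * (cmod (value_form \<beta> a b))\<^sup>2"
    using value_form_coercive[of \<alpha> \<beta>] assms by auto
  obtain k2 where k2: "k2 > 0"  "\<And>a b. cmod (value_form \<alpha> a b) \<le> cmod (value_form \<gamma> a b) \<Longrightarrow> (cmod a)\<^sup>2 + (cmod b)\<^sup>2 \<le> k2 * (cmod (value_form \<gamma> a b))\<^sup>2"
    using value_form_coercive[of \<alpha> \<gamma>] assms by auto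
  obtain k3 where k3: "k3 > 0"  "\<And>a b. cmod (value_form \<alpha> a b) \<le> cmod (value_form \<delta> a b) \<Longrightarrow> (cmod a)\<^sup>2 + (cmod b)\<^sup>2 \<le> k3 * (cmod (value_form \<delta> a b))\<^sup>2"
    using value_form_coercive[of \<alpha> \<delta>] assms by auto
  obtain m where m: "m > 0" "\<And>a b. (cmod (value_form \<beta> a b))\<^sup>2 \<le> m * ((cmod a)\<^sup>2 + (cmod b)\<^sup>2)"
    using value_form_bound by blast
  obtain L where L: "L > 0"
    "\<And>a b z0 d. \<lbrakk>0 < d; a holomorphic_on ball z0 d; b holomorphic_on ball z0 d;
       \<And>z \<epsilon>. \<lbrakk>z \<in> ball z0 d; \<epsilon> \<in> {\<alpha>, \<beta>, \<gamma>}\<rbrakk> \<Longrightarrow> value_form \<epsilon> (a z) (b z) \<noteq> 0;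
       cmod (value_form \<alpha> (a z0) (b z0)) \<le> cmod (value_form \<beta> (a z0) (b z0))\<rbrakk>
      \<Longrightarrow> (d * cmod (a z0 * deriv b z0 - deriv a z0 * b z0)) ^ 5 \<le>
          L * cmod (value_form \<alpha> (a z0) (b z0)) ^ 4 * cmod (value_form \<beta> (a z0) (b z0)) ^ 6"
    using wronskian_bound[of \<alpha> \<beta> \<gamma>] assms by auto
  show thesis
  proof
    show "L * m ^ 3 * (k1 * k2 * k3) ^ 2 > 0" using L m k1 k2 k3 by simp
    fix a b z0 and d :: real
    assume d: "0 < d" and hol: "a holomorphic_on ball z0 d" "b holomorphic_on ball z0 d"
      and nz: "\<And>z \<epsilon>. \<lbrakk>z \<in> ball z0 d; \<epsilon> \<in> {\<alpha>, \<beta>, \<gamma>, \<delta>}\<rbrakk> \<Longrightarrow> value_form \<epsilon> (a z) (b z) \<noteq> 0"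
      and eq: "(a z0 * deriv b z0 - deriv a z0 * b z0) ^ 5 = form_prod {\<alpha>, \<beta>, \<gamma>, \<delta>} (a z0) (b z0) ^ 4"
      and le: "\<And>\<epsilon>. \<epsilon> \<in> {\<beta>, \<gamma>, \<delta>} \<Longrightarrow> cmod (value_form \<alpha> (a z0) (b z0)) \<le> cmod (value_form \<epsilon> (a z0) (b z0))"
    define N where "N = (cmod (a z0))\<^sup>2 + (cmod (b z0))\<^sup>2"
    define f where "f = (\<lambda>\<epsilon>. cmod (value_form \<epsilon> (a z0) (b z0)))"
    have N0: "N \<ge> 0" by (simp add: N_def)
    have "value_form \<alpha> (a z0) (b z0) \<noteq> 0" using nz[of z0 \<alpha>] d by simp
    moreover from this have "N \<noteq> 0" by (auto simp: N_def value_form_def add_nonneg_eq_0_iff split: option.splits)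
    ultimately have pos: "f \<alpha> > 0" "N > 0" using N0 by (auto simp: f_def)
    have b1: "N \<le> k1 * (f \<beta>)\<^sup>2" "N \<le> k2 * (f \<gamma>)\<^sup>2" "N \<le> k3 * (f \<delta>)\<^sup>2"
      using k1(2)[OF le] k2(2)[OF le] k3(2)[OF le] by (simp_all add: N_def f_def)
    have "N ^ 3 = N * N * N" by (simp add: power3_eq_cube)
    also have "\<dots> \<le> (k1 * (f \<beta>)\<^sup>2) * (k2 * (f \<gamma>)\<^sup>2) * (k3 * (f \<delta>)\<^sup>2)"
      using b1 N0 k1 k2 k3 by (intro mult_mono) auto
    finally have "N ^ 3 \<le> (k1 * k2 * k3) * (f \<beta> * f \<gamma> * f \<delta>)\<^sup>2" by (simp add: power_mult_distrib mult_ac)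
    from power_mono[OF this, of 2] N0
    have b2: "N ^ 6 \<le> (k1 * k2 * k3) ^ 2 * (f \<beta> * f \<gamma> * f \<delta>) ^ 4" by (simp add: power_mult_distrib flip: power_mult)
    have "cmod (a z0 * deriv b z0 - deriv a z0 * b z0) ^ 5 = (f \<alpha> * (f \<beta> * f \<gamma> * f \<delta>)) ^ 4"
      using arg_cong[OF eq, of cmod] assms by (simp add: norm_power form_prod_def f_def norm_mult mult_ac)
    then have "d ^ 5 * (f \<alpha> ^ 4 * (f \<beta> * f \<gamma> * f \<delta>) ^ 4) = (d * cmod (a z0 * deriv b z0 - deriv a z0 * b z0)) ^ 5"
      by (simp add: power_mult_distrib)
    also have "\<dots> \<le> L * f \<alpha> ^ 4 * f \<beta> ^ 6"
      using L(2)[OF d hol nz le] by (auto simp: f_def)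
    also have "f \<beta> ^ 6 = ((f \<beta>)\<^sup>2) ^ 3" by (simp flip: power_mult)
    also have "L * f \<alpha> ^ 4 * \<dots> \<le> L * f \<alpha> ^ 4 * (m * N) ^ 3"
      using m(2) L by (intro mult_left_mono power_mono) (auto simp: f_def N_def)
    finally have "f \<alpha> ^ 4 * (d ^ 5 * (f \<beta> * f \<gamma> * f \<delta>) ^ 4) \<le> f \<alpha> ^ 4 * (L * m ^ 3 * N ^ 3)"
      by (simp add: power_mult_distrib mult_ac)
    then have b3: "d ^ 5 * (f \<beta> * f \<gamma> * f \<delta>) ^ 4 \<le> L * m ^ 3 * N ^ 3"
      using pos by (simp add: mult_le_cancel_left)
    have "N ^ 3 * (d ^ 5 * N ^ 3) = d ^ 5 * N ^ 6" by (simp flip: power_add)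
    also have "\<dots> \<le> d ^ 5 * ((k1 * k2 * k3) ^ 2 * (f \<beta> * f \<gamma> * f \<delta>) ^ 4)"
      using b2 d by (intro mult_left_mono) auto
    also have "\<dots> = (k1 * k2 * k3) ^ 2 * (d ^ 5 * (f \<beta> * f \<gamma> * f \<delta>) ^ 4)" by simp
    also have "\<dots> \<le> (k1 * k2 * k3) ^ 2 * (L * m ^ 3 * N ^ 3)" using b3 by (intro mult_left_mono) auto
    also have "\<dots> = N ^ 3 * (L * m ^ 3 * (k1 * k2 * k3) ^ 2)" by simp
    finally show "d ^ 5 * ((cmod (a z0))\<^sup>2 + (cmod (b z0))\<^sup>2) ^ 3 \<le> L * m ^ 3 * (k1 * k2 * k3) ^ 2"
      unfolding N_def[symmetric] using pos by (simp add: mult_le_cancel_left)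
  qed
qed

definition energy_const :: "complex option set \<Rightarrow> real \<Rightarrow> bool" where
  "energy_const B C \<longleftrightarrow> C > 0 \<and> (\<forall>a b z0 d. 0 < d \<longrightarrow> a holomorphic_on ball z0 d \<longrightarrow> b holomorphic_on ball z0 d \<longrightarrow>
       (\<forall>z\<in>ball z0 d. \<forall>\<epsilon>\<in>B. value_form \<epsilon> (a z) (b z) \<noteq> 0) \<longrightarrow>
       (a z0 * deriv b z0 - deriv a z0 * b z0) ^ 5 = form_prod B (a z0) (b z0) ^ 4 \<longrightarrow>
       d ^ 5 * ((cmod (a z0))\<^sup>2 + (cmod (b z0))\<^sup>2) ^ 3 \<le> C)"

lemma energy_constD:
  assumes "energy_const B C" "0 < d" "a holomorphic_on ball z0 d" "b holomorphic_on ball z0 d"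
    "\<And>z \<epsilon>. z \<in> ball z0 d \<Longrightarrow> \<epsilon> \<in> B \<Longrightarrow> value_form \<epsilon> (a z) (b z) \<noteq> 0"
    "(a z0 * deriv b z0 - deriv a z0 * b z0) ^ 5 = form_prod B (a z0) (b z0) ^ 4"
  shows "d ^ 5 * ((cmod (a z0))\<^sup>2 + (cmod (b z0))\<^sup>2) ^ 3 \<le> C"
  using assms unfolding energy_const_def by blast

definition product_const :: "complex option set \<Rightarrow> real \<Rightarrow> bool" where
  "product_const B k \<longleftrightarrow> k > 0 \<and> (\<forall>a b. (cmod (form_prod B a b))\<^sup>2 \<le> k * ((cmod a)\<^sup>2 + (cmod b)\<^sup>2) ^ 4)"

text \<open>The constant is uniform in the functions and the disc: it is the largest one over the four choices of the smallest form.\<close>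

lemma energy_bound:
  assumes "card B = 4"
  obtains C where "energy_const B C"
proof -
  have fin: "finite B" using assms by (intro card_ge_0_finite) simp
  define good where "good = (\<lambda>\<alpha> C. C > 0 \<and> (\<forall>a b z0 d. 0 < d \<longrightarrow> a holomorphic_on ball z0 d \<longrightarrow> b holomorphic_on ball z0 d \<longrightarrow>
       (\<forall>z\<in>ball z0 d. \<forall>\<epsilon>\<in>B. value_form \<epsilon> (a z) (b z) \<noteq> 0) \<longrightarrow>
       (a z0 * deriv b z0 - deriv a z0 * b z0) ^ 5 = form_prod B (a z0) (b z0) ^ 4 \<longrightarrow>
       (\<forall>\<epsilon>\<in>B. cmod (value_form \<alpha> (a z0) (b z0)) \<le> cmod (value_form \<epsilon> (a z0) (b z0))) \<longrightarrow>
       d ^ 5 * ((cmod (a z0))\<^sup>2 + (cmod (b z0))\<^sup>2) ^ 3 \<le> C))"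
  have "\<exists>C. good \<alpha> C" if "\<alpha> \<in> B" for \<alpha>
  proof -
    have "card (B - {\<alpha>}) = 3" using assms that fin by simp
    then obtain \<beta> \<gamma> \<delta> where e: "B - {\<alpha>} = {\<beta>, \<gamma>, \<delta>}" and d: "\<beta> \<noteq> \<gamma>" "\<beta> \<noteq> \<delta>" "\<gamma> \<noteq> \<delta>" by (auto simp: card_3_iff)
    then have B: "B = {\<alpha>, \<beta>, \<gamma>, \<delta>}" and dis: "distinct [\<alpha>, \<beta>, \<gamma>, \<delta>]" using that by auto
    from energy_bound_smallest[OF dis] obtain C where "C > 0"
    "\<And>a b z0 d. \<lbrakk>0 < d; a holomorphic_on ball z0 d; b holomorphic_on ball z0 d;
       \<And>z \<epsilon>. \<lbrakk>z \<in> ball z0 d; \<epsilon> \<in> B\<rbrakk> \<Longrightarrow> value_form \<epsilon> (a z) (b z) \<noteq> 0;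
       (a z0 * deriv b z0 - deriv a z0 * b z0) ^ 5 = form_prod B (a z0) (b z0) ^ 4;
       \<And>\<epsilon>. \<epsilon> \<in> {\<beta>, \<gamma>, \<delta>} \<Longrightarrow> cmod (value_form \<alpha> (a z0) (b z0)) \<le> cmod (value_form \<epsilon> (a z0) (b z0))\<rbrakk>
      \<Longrightarrow> d ^ 5 * ((cmod (a z0))\<^sup>2 + (cmod (b z0))\<^sup>2) ^ 3 \<le> C" unfolding B[symmetric] by blast
    moreover have "{\<beta>, \<gamma>, \<delta>} \<subseteq> B" using B by auto
    ultimately have "good \<alpha> C" unfolding good_def by blast
    then show ?thesis ..
  qed
  then obtain C where C: "\<And>\<alpha>. \<alpha> \<in> B \<Longrightarrow> good \<alpha> (C \<alpha>)" by metis
  have ne: "B \<noteq> {}" using assms by auto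
  have "energy_const B (Max (C ` B))"
    unfolding energy_const_def
  proof (intro conjI allI impI)
    show "Max (C ` B) > 0" using C ne fin by (auto simp: Max_gr_iff good_def)
    fix a b z0 and d :: real
    assume *: "0 < d" "a holomorphic_on ball z0 d" "b holomorphic_on ball z0 d"
       "\<forall>z\<in>ball z0 d. \<forall>\<epsilon>\<in>B. value_form \<epsilon> (a z) (b z) \<noteq> 0"
       "(a z0 * deriv b z0 - deriv a z0 * b z0) ^ 5 = form_prod B (a z0) (b z0) ^ 4"
    define f where "f = (\<lambda>\<epsilon>. cmod (value_form \<epsilon> (a z0) (b z0)))"
    have "Min (f ` B) \<in> f ` B" using fin ne by (intro Min_in) auto
    then obtain \<alpha> where \<alpha>: "\<alpha> \<in> B" "f \<alpha> = Min (f ` B)" by auto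
    then have "\<forall>\<epsilon>\<in>B. f \<alpha> \<le> f \<epsilon>" using fin by simp
    then have "d ^ 5 * ((cmod (a z0))\<^sup>2 + (cmod (b z0))\<^sup>2) ^ 3 \<le> C \<alpha>"
      using C[OF \<alpha>(1)] * unfolding good_def f_def by blast
    also have "\<dots> \<le> Max (C ` B)" using fin \<alpha> by simp
    finally show "d ^ 5 * ((cmod (a z0))\<^sup>2 + (cmod (b z0))\<^sup>2) ^ 3 \<le> Max (C ` B)" .
  qed
  then show thesis by (rule that)
qed

lemma form_prod_bound:
  assumes "card B = 4"
  obtains k where "product_const B k"
proof -
  have "\<forall>\<alpha>. \<exists>k>0. \<forall>a b. (cmod (value_form \<alpha> a b))\<^sup>2 \<le> k * ((cmod a)\<^sup>2 + (cmod b)\<^sup>2)"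
    by (rule allI, rule value_form_bound, blast)
  then obtain k where k: "\<And>\<alpha>. k \<alpha> > 0" "\<And>\<alpha> a b. (cmod (value_form \<alpha> a b))\<^sup>2 \<le> k \<alpha> * ((cmod a)\<^sup>2 + (cmod b)\<^sup>2)"
    by metis
  have "product_const B (\<Prod>\<alpha>\<in>B. k \<alpha>)"
    unfolding product_const_def
  proof (intro conjI allI)
    show "(\<Prod>\<alpha>\<in>B. k \<alpha>) > 0" using k by (simp add: prod_pos)
    fix a b
    have "(cmod (form_prod B a b))\<^sup>2 = (\<Prod>\<alpha>\<in>B. (cmod (value_form \<alpha> a b))\<^sup>2)"
      by (simp add: form_prod_def prod_power_distrib flip: prod_norm)
    also have "\<dots> \<le> (\<Prod>\<alpha>\<in>B. k \<alpha> * ((cmod a)\<^sup>2 + (cmod b)\<^sup>2))"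
      by (intro prod_mono) (auto simp: k)
    finally show "(cmod (form_prod B a b))\<^sup>2 \<le> (\<Prod>\<alpha>\<in>B. k \<alpha>) * ((cmod a)\<^sup>2 + (cmod b)\<^sup>2) ^ 4"
      by (simp add: prod.distrib assms)
  qed
  then show thesis by (rule that)
qed

section \<open>Holomorphic differential equations\<close>

lemma holomorphic_locally_lipschitz:
  assumes "v holomorphic_on D" "open D" "z0 \<in> D"
  obtains e M K :: real where "e > 0" "M > 0" "K > 0" "cball z0 e \<subseteq> D"
    "\<And>x. x \<in> cball z0 e \<Longrightarrow> cmod (v x) \<le> M"
    "\<And>x y. x \<in> cball z0 e \<Longrightarrow> y \<in> cball z0 e \<Longrightarrow> cmod (v x - v y) \<le> K * cmod (x - y)"
proof -
  obtain e where e: "e > 0" "cball z0 e \<subseteq> D" using assms open_contains_cball by blast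
  have "continuous_on (cball z0 e) v" "continuous_on (cball z0 e) (deriv v)"
    using assms e holomorphic_deriv holomorphic_on_imp_continuous_on holomorphic_on_subset by blast+
  then have "bounded (v ` cball z0 e)" "bounded (deriv v ` cball z0 e)"
    by (auto intro!: compact_imp_bounded compact_continuous_image)
  then obtain M K where MK: "M > 0" "\<forall>x\<in>v ` cball z0 e. cmod x \<le> M" "K > 0" "\<forall>x\<in>deriv v ` cball z0 e. cmod x \<le> K"
    unfolding bounded_pos by blast
  have "cmod (v x - v y) \<le> K * cmod (x - y)" if "x \<in> cball z0 e" "y \<in> cball z0 e" for x y
  proof (rule field_differentiable_bound[OF convex_cball _ _ that])
    fix z assume z: "z \<in> cball z0 e"
    show "(v has_field_derivative deriv v z) (at z within cball z0 e)"
      using assms e z by (meson has_field_derivative_at_within holomorphic_derivI subsetD)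
    show "cmod (deriv v z) \<le> K" using MK z by auto
  qed
  then show thesis using that[OF e(1) MK(1,3) e(2)] MK(2) by auto
qed

lemma holomorphic_primitive_on_ball:
  assumes "f holomorphic_on ball 0 r" "0 < r"
  shows "\<exists>g. g 0 = z1 \<and> (\<forall>\<zeta>\<in>ball 0 r. (g has_field_derivative f \<zeta>) (at \<zeta>))"
proof -
  obtain g where g: "\<And>x. x \<in> ball 0 r \<Longrightarrow> (g has_field_derivative f x) (at x within ball 0 r)"
    using holomorphic_convex_primitive'[OF convex_ball open_ball assms(1)] by blast
  have "((\<lambda>x. g x - g 0 + z1) has_field_derivative f x) (at x)" if "x \<in> ball 0 r" for x
    using g[OF that] that by (auto intro!: derivative_eq_intros simp: at_within_open[OF _ open_ball])
  then show ?thesis by (intro exI[of _ "\<lambda>x. g x - g 0 + z1"]) auto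
qed

lemma ball_growth_bound:
  fixes g :: "complex \<Rightarrow> complex"
  assumes "\<And>\<zeta>. \<zeta> \<in> ball a r \<Longrightarrow> (g has_field_derivative g' \<zeta>) (at \<zeta>)" "\<And>\<zeta>. \<zeta> \<in> ball a r \<Longrightarrow> cmod (g' \<zeta>) \<le> B"
    and "\<zeta> \<in> ball a r"
  shows "cmod (g \<zeta> - g a) \<le> B * r"
proof -
  have "r > 0" using assms(3) by (smt (verit) mem_ball zero_le_dist)
  have "cmod (g \<zeta> - g a) \<le> B * cmod (\<zeta> - a)"
    using assms \<open>r > 0\<close> by (intro field_differentiable_bound[of "ball a r"]) (auto intro: has_field_derivative_at_within)
  also have "\<dots> \<le> B * r"
    using assms(3) assms(2)[of a] \<open>r > 0\<close> norm_ge_zero[of "g' a"]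
    by (intro mult_left_mono) (auto simp: dist_norm norm_minus_commute simp del: norm_ge_zero)
  finally show ?thesis .
qed

text \<open>Picard iteration in complex time. The radius \<open>r\<close> is common to all initial values near \<open>z0\<close>, zeros of \<open>v\<close>
  included; this uniformity is used on compact sets below.\<close>

lemma holomorphic_ode_local_existence:
  assumes "v holomorphic_on D" "open D" "z0 \<in> D"
  obtains e r :: real where "e > 0" "r > 0" "ball z0 e \<subseteq> D"
    "\<And>z1. z1 \<in> ball z0 e \<Longrightarrow> \<exists>\<phi>. \<phi> 0 = z1 \<and> \<phi> ` ball 0 r \<subseteq> D \<and>
       (\<forall>\<zeta>\<in>ball 0 r. (\<phi> has_field_derivative v (\<phi> \<zeta>)) (at \<zeta>))"
proof -
  obtain e2 M K where e2: "e2 > 0" and MK: "M > 0" "K > 0" and sub: "cball z0 e2 \<subseteq> D"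
    and M: "\<And>x. x \<in> cball z0 e2 \<Longrightarrow> cmod (v x) \<le> M"
    and K: "\<And>x y. x \<in> cball z0 e2 \<Longrightarrow> y \<in> cball z0 e2 \<Longrightarrow> cmod (v x - v y) \<le> K * cmod (x - y)"
    using holomorphic_locally_lipschitz[OF assms] by blast
  \<comment> \<open>An initial value within \<open>e\<close> of the centre may move by another \<open>e\<close> without leaving the disc where the bounds hold.\<close>
  define e where "e = e2 / 2"
  have e: "e > 0" using e2 by (simp add: e_def)
  \<comment> \<open>The first bound keeps the iterates in that disc, the second one makes the iteration a contraction by \<open>1/2\<close>.\<close>
  define r where "r = min (e / M) (1 / (2 * K))"
  have r: "r > 0" "M * r \<le> e" "K * r \<le> 1 / 2"
    using e MK by (auto simp: r_def min_def field_simps)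
  show thesis
  proof (rule that[OF e r(1)])
    show "ball z0 e \<subseteq> D" using sub e2 by (auto simp: e_def subset_iff)
    fix z1 assume z1: "z1 \<in> ball z0 e"
    define good where "good = (\<lambda>\<phi>. \<phi> holomorphic_on ball 0 r \<and> \<phi> 0 = z1 \<and> \<phi> ` ball 0 r \<subseteq> cball z0 e2)"
    define T where "T = (\<lambda>\<phi>. SOME g. g 0 = z1 \<and> (\<forall>\<zeta>\<in>ball 0 r. (g has_field_derivative v (\<phi> \<zeta>)) (at \<zeta>)))"
    have T: "T \<phi> 0 = z1 \<and> (\<forall>\<zeta>\<in>ball 0 r. (T \<phi> has_field_derivative v (\<phi> \<zeta>)) (at \<zeta>))" if "good \<phi>" for \<phi>
    proof -
      have "(\<lambda>\<zeta>. v (\<phi> \<zeta>)) holomorphic_on ball 0 r"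
        using that assms(1) sub holomorphic_on_compose_gen[of \<phi> "ball 0 r" v D] by (auto simp: good_def comp_def)
      from someI_ex[OF holomorphic_primitive_on_ball[OF this r(1), of z1]] show ?thesis unfolding T_def .
    qed
    have near: "z \<in> cball z0 e2" if "cmod (z - z1) \<le> e" for z
      using that z1 dist_triangle[of z0 z z1] by (simp add: e_def dist_norm norm_minus_commute)
    have good_T: "good (T \<phi>)" if "good \<phi>" for \<phi>
    proof -
      have "T \<phi> holomorphic_on ball 0 r"
        using T[OF that] by (metis holomorphic_onI has_field_derivative_at_within field_differentiable_def)
      moreover have "T \<phi> \<zeta> \<in> cball z0 e2" if z: "\<zeta> \<in> ball 0 r" for \<zeta>
      proof (rule near)
        have "cmod (T \<phi> \<zeta> - T \<phi> 0) \<le> M * r"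
          using T[OF \<open>good \<phi>\<close>] \<open>good \<phi>\<close>
          by (intro ball_growth_bound[of _ _ _ "\<lambda>\<zeta>. v (\<phi> \<zeta>)", OF _ M z]) (auto simp: good_def image_subset_iff)
        then show "cmod (T \<phi> \<zeta> - z1) \<le> e" using T[OF \<open>good \<phi>\<close>] r by simp
      qed
      ultimately show ?thesis using T[OF that] by (auto simp: good_def)
    qed
    define \<phi> where "\<phi> = (\<lambda>n. (T ^^ n) (\<lambda>_. z1))"
    have phi0: "\<phi> 0 = (\<lambda>_. z1)" and phiS: "\<phi> (Suc n) = T (\<phi> n)" for n by (auto simp: \<phi>_def)
    have good: "good (\<phi> n)" for n
    proof (induction n)
      case 0 then show ?case using near[of z1] e by (auto simp: phi0 good_def)
    next
      case (Suc n) then show ?case by (simp add: phiS good_T)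
    qed
    have step: "cmod (\<phi> (Suc n) \<zeta> - \<phi> n \<zeta>) \<le> e * (1/2) ^ n" if "\<zeta> \<in> ball 0 r" for n \<zeta>
      using that
    proof (induction n arbitrary: \<zeta>)
      case 0
      have "cmod (T (\<phi> 0) \<zeta> - T (\<phi> 0) 0) \<le> M * r"
        using T[OF good[of 0]] good[of 0]
        by (intro ball_growth_bound[of _ _ _ "\<lambda>\<zeta>. v (\<phi> 0 \<zeta>)", OF _ M 0]) (auto simp: good_def image_subset_iff)
      then show ?case using T[OF good[of 0]] r by (simp add: phiS) (simp add: phi0)
    next
      case (Suc n)
      have "cmod ((\<phi> (Suc (Suc n)) \<zeta> - \<phi> (Suc n) \<zeta>) - (\<phi> (Suc (Suc n)) 0 - \<phi> (Suc n) 0)) \<le> (K * (e * (1/2) ^ n)) * r"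
      proof (rule ball_growth_bound[OF _ _ Suc.prems])
        fix w :: complex assume w: "w \<in> ball 0 r"
        show "((\<lambda>\<zeta>. \<phi> (Suc (Suc n)) \<zeta> - \<phi> (Suc n) \<zeta>) has_field_derivative v (\<phi> (Suc n) w) - v (\<phi> n w)) (at w)"
          using T[OF good[of "Suc n"]] T[OF good[of n]] w
          by (auto intro!: derivative_eq_intros simp: phiS)
        have "cmod (v (\<phi> (Suc n) w) - v (\<phi> n w)) \<le> K * cmod (\<phi> (Suc n) w - \<phi> n w)"
          using good[of "Suc n"] good[of n] w by (intro K) (auto simp: good_def image_subset_iff)
        also have "\<dots> \<le> K * (e * (1/2) ^ n)" using Suc.IH[OF w] MK by (intro mult_left_mono) auto
        finally show "cmod (v (\<phi> (Suc n) w) - v (\<phi> n w)) \<le> K * (e * (1/2) ^ n)" .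
      qed
      also have "\<phi> (Suc (Suc n)) 0 - \<phi> (Suc n) 0 = 0" using good[of "Suc n"] good[of "Suc (Suc n)"] by (simp add: good_def)
      also have "(K * (e * (1/2) ^ n)) * r = (K * r) * (e * (1/2) ^ n)" by simp
      also have "\<dots> \<le> (1/2) * (e * (1/2) ^ n)" using r e by (intro mult_right_mono) auto
      finally show ?case by simp
    qed
    define \<psi> where "\<psi> = (\<lambda>\<zeta>. (\<Sum>i. \<phi> (Suc i) \<zeta> - \<phi> i \<zeta>) + z1)"
    have "uniform_limit (ball 0 r) (\<lambda>n \<zeta>. \<Sum>i<n. \<phi> (Suc i) \<zeta> - \<phi> i \<zeta>) (\<lambda>\<zeta>. \<Sum>i. \<phi> (Suc i) \<zeta> - \<phi> i \<zeta>) sequentially"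
      using step by (intro Weierstrass_m_test[where M = "\<lambda>n. e * (1/2) ^ n"] summable_mult) auto
    then have "uniform_limit (ball 0 r) (\<lambda>n \<zeta>. (\<Sum>i<n. \<phi> (Suc i) \<zeta> - \<phi> i \<zeta>) + z1) \<psi> sequentially"
      unfolding \<psi>_def by (intro uniform_limit_intros)
    moreover have "(\<Sum>i<n. \<phi> (Suc i) \<zeta> - \<phi> i \<zeta>) + z1 = \<phi> n \<zeta>" for n \<zeta>
      by (subst sum_lessThan_telescope) (simp add: phi0)
    ultimately have ul: "uniform_limit (ball 0 r) \<phi> \<psi> sequentially" by (simp add: fun_eq_iff)
    have lim: "(\<lambda>n. \<phi> n \<zeta>) \<longlonglongrightarrow> \<psi> \<zeta>" if "\<zeta> \<in> ball 0 r" for \<zeta>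
      using tendsto_uniform_limitI[OF ul that] .
    have in_e2: "\<psi> \<zeta> \<in> cball z0 e2" if "\<zeta> \<in> ball 0 r" for \<zeta>
      using good that by (intro closed_sequentially[OF closed_cball _ lim]) (auto simp: good_def image_subset_iff)
    have "\<exists>g'. \<forall>x\<in>ball 0 r. (\<psi> has_field_derivative g' x) (at x) \<and> ((\<lambda>n. v (\<phi> n x)) \<longlonglongrightarrow> g' x)"
    proof -
      have ul': "uniform_limit (ball 0 r) (\<lambda>n. \<phi> (Suc n)) \<psi> sequentially"
        using ul by (simp add: filterlim_sequentially_Suc[of "\<phi>"])
      show ?thesis
      proof (intro has_complex_derivative_uniform_sequence[of _ "\<lambda>n. \<phi> (Suc n)"])
        fix x :: complex assume "x \<in> ball 0 r"
        then obtain d where "d > 0" "cball x d \<subseteq> ball 0 r" using open_contains_cball_eq[OF open_ball] by blast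
        then show "\<exists>d>0. cball x d \<subseteq> ball 0 r \<and> uniform_limit (cball x d) (\<lambda>n. \<phi> (Suc n)) \<psi> sequentially"
          using ul' uniform_limit_on_subset by blast
      qed (use T good in \<open>auto simp: phiS\<close>)
    qed
    then obtain g' where g': "\<And>x. x\<in>ball 0 r \<Longrightarrow> (\<psi> has_field_derivative g' x) (at x)"
      "\<And>x. x\<in>ball 0 r \<Longrightarrow> (\<lambda>n. v (\<phi> n x)) \<longlonglongrightarrow> g' x" by blast
    have "g' x = v (\<psi> x)" if x: "x \<in> ball 0 r" for x
    proof (rule LIMSEQ_unique[OF g'(2)[OF x]])
      have "isCont v (\<psi> x)"
        using assms in_e2[OF x] sub by (meson continuous_on_eq_continuous_at holomorphic_on_imp_continuous_on subsetD)
      then show "(\<lambda>n. v (\<phi> n x)) \<longlonglongrightarrow> v (\<psi> x)" using lim[OF x] by (rule isCont_tendsto_compose)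
    qed
    moreover have "\<psi> 0 = z1"
      using lim[of 0] good r by (intro LIMSEQ_unique[OF lim[of 0]]) (auto simp: good_def)
    ultimately show "\<exists>\<phi>. \<phi> 0 = z1 \<and> \<phi> ` ball 0 r \<subseteq> D \<and>
       (\<forall>\<zeta>\<in>ball 0 r. (\<phi> has_field_derivative v (\<phi> \<zeta>)) (at \<zeta>))"
      using g'(1) in_e2 sub by (intro exI[of _ \<psi>]) auto
  qed
qed

text \<open>On a small disc the difference of two solutions is at most half of any bound for it, hence 0.\<close>

lemma holomorphic_ode_local_uniqueness:
  assumes v: "v holomorphic_on D" "open D" and s: "s > 0"
    and phi: "\<And>\<zeta>. \<zeta> \<in> ball a s \<Longrightarrow> (\<phi> has_field_derivative v (\<phi> \<zeta>)) (at \<zeta>)"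
    and psi: "\<And>\<zeta>. \<zeta> \<in> ball a s \<Longrightarrow> (\<psi> has_field_derivative v (\<psi> \<zeta>)) (at \<zeta>)"
    and eq: "\<phi> a = \<psi> a" and D: "\<phi> a \<in> D"
  obtains t where "t > 0" "t \<le> s" "\<And>\<zeta>. \<zeta> \<in> ball a t \<Longrightarrow> \<phi> \<zeta> = \<psi> \<zeta>"
proof -
  obtain e M K where e: "e > 0" and MK: "M > 0" "K > 0" and "cball (\<phi> a) e \<subseteq> D"
    and "\<And>x. x \<in> cball (\<phi> a) e \<Longrightarrow> cmod (v x) \<le> M"
    and K: "\<And>x y. x \<in> cball (\<phi> a) e \<Longrightarrow> y \<in> cball (\<phi> a) e \<Longrightarrow> cmod (v x - v y) \<le> K * cmod (x - y)"
    using holomorphic_locally_lipschitz[OF v D] by blast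
  have "isCont \<phi> a" "isCont \<psi> a" using phi[of a] psi[of a] s DERIV_isCont by auto
  then obtain t1 t2 where t12: "t1 > 0" "t2 > 0" "\<And>x. dist x a < t1 \<Longrightarrow> dist (\<phi> x) (\<phi> a) < e"
      "\<And>x. dist x a < t2 \<Longrightarrow> dist (\<psi> x) (\<psi> a) < e" using e unfolding continuous_at_eps_delta by metis
  define t where "t = min (min t1 t2) (min s (1 / (2 * K)))"
  have t: "t > 0" "t \<le> s" "t \<le> t1" "t \<le> t2" using t12 s MK by (auto simp: t_def)
  have "t \<le> 1 / (2 * K)" by (simp add: t_def)
  then have Kt: "K * t \<le> 1/2" using MK by (simp add: field_simps)
  have inb: "\<phi> x \<in> cball (\<phi> a) e" "\<psi> x \<in> cball (\<phi> a) e" if "x \<in> ball a t" for x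
    using t12(3)[of x] t12(4)[of x] that t eq by (auto simp: dist_commute)
  have *: "cmod (\<phi> x - \<psi> x) \<le> 2 * e * (1/2) ^ n" if "x \<in> ball a t" for x n
    using that
  proof (induction n arbitrary: x)
    case 0
    then show ?case using inb[OF 0] dist_triangle_le[of "\<phi> x" "\<phi> a" "\<psi> x" "2 * e"] by (simp add: dist_norm norm_minus_commute)
  next
    case (Suc n)
    have "cmod ((\<phi> x - \<psi> x) - (\<phi> a - \<psi> a)) \<le> (K * (2 * e * (1/2) ^ n)) * t"
    proof (rule ball_growth_bound[OF _ _ Suc.prems])
      fix w assume w: "w \<in> ball a t"
      then show "((\<lambda>x. \<phi> x - \<psi> x) has_field_derivative v (\<phi> w) - v (\<psi> w)) (at w)"
        using t by (intro DERIV_diff phi psi) auto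
      have "cmod (v (\<phi> w) - v (\<psi> w)) \<le> K * cmod (\<phi> w - \<psi> w)" using inb[OF w] by (intro K)
      also have "\<dots> \<le> K * (2 * e * (1/2) ^ n)" using Suc.IH[OF w] MK by (intro mult_left_mono) auto
      finally show "cmod (v (\<phi> w) - v (\<psi> w)) \<le> K * (2 * e * (1/2) ^ n)" .
    qed
    also have "\<dots> = (K * t) * (2 * e * (1/2) ^ n)" by simp
    also have "\<dots> \<le> (1/2) * (2 * e * (1/2) ^ n)" using Kt e by (intro mult_right_mono) auto
    finally show ?case using eq by simp
  qed
  have "\<phi> x = \<psi> x" if "x \<in> ball a t" for x
  proof -
    have "(\<lambda>n. 2 * e * (1/2) ^ n) \<longlonglongrightarrow> 2 * e * 0" by (intro tendsto_mult_left LIMSEQ_power_zero) auto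
    then have "cmod (\<phi> x - \<psi> x) \<le> 2 * e * 0" by (rule LIMSEQ_le_const) (use *[OF that] in auto)
    then show ?thesis by simp
  qed
  then show thesis using that[OF t(1,2)] by blast
qed

section \<open>Flows in complex time on a Riemann surface\<close>

text \<open>A vector field is given by its coefficient \<open>v c\<close> in each chart, subject to the transformation law of weight \<open>-1\<close>.\<close>

definition vector_field :: "'a chart set \<Rightarrow> ('a chart \<Rightarrow> complex \<Rightarrow> complex) \<Rightarrow> bool" where
  "vector_field \<A> v \<longleftrightarrow> (\<forall>c\<in>\<A>. v c holomorphic_on coord_region c) \<and>
    (\<forall>c\<in>\<A>. \<forall>d\<in>\<A>. \<forall>p\<in>fst c \<inter> fst d.
       v d (snd d p) = deriv (coord_expr c (snd d)) (snd c p) * v c (snd c p))"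

text \<open>Solutions of \<open>\<Phi>' = V(\<Phi>)\<close> in complex time. The derivative condition is demanded in every chart around the point;
  for a vector field one chart suffices.\<close>

definition integral_map ::
    "'a topology \<Rightarrow> 'a chart set \<Rightarrow> ('a chart \<Rightarrow> complex \<Rightarrow> complex) \<Rightarrow> complex set \<Rightarrow> (complex \<Rightarrow> 'a) \<Rightarrow> bool" where
  "integral_map X \<A> v S \<Phi> \<longleftrightarrow> continuous_map (top_of_set S) X \<Phi> \<and>
    (\<forall>c\<in>\<A>. \<forall>\<zeta>\<in>S. \<Phi> \<zeta> \<in> fst c \<longrightarrow> ((snd c \<circ> \<Phi>) has_field_derivative v c (snd c (\<Phi> \<zeta>))) (at \<zeta>))"

context riemann_surface
begin

lemma chart_openin: "c \<in> \<A> \<Longrightarrow> openin X (fst c)"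
  and region_open: "c \<in> \<A> \<Longrightarrow> open (coord_region c)"
  and chart_homeo: "c \<in> \<A> \<Longrightarrow> homeomorphic_map (subtopology X (fst c)) (top_of_set (coord_region c)) (snd c)"
  using chart[of "fst c" "snd c"] by (auto simp: coord_region_def)

lemma chart_topspace: "c \<in> \<A> \<Longrightarrow> fst c \<subseteq> topspace X"
  using chart_openin openin_subset by blast

lemma chart_inj: "c \<in> \<A> \<Longrightarrow> inj_on (snd c) (fst c)"
  using homeomorphic_imp_injective_map[OF chart_homeo] chart_topspace
  by (simp add: inf_absorb2)

lemma chart_in: "p \<in> fst c \<Longrightarrow> snd c p \<in> coord_region c"
  by (simp add: coord_region_def)

lemma inv_chart [simp]: "c \<in> \<A> \<Longrightarrow> p \<in> fst c \<Longrightarrow> inv_into (fst c) (snd c) (snd c p) = p"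
  using chart_inj by (rule inv_into_f_f)

lemma chart_inv [simp]: "z \<in> coord_region c \<Longrightarrow> snd c (inv_into (fst c) (snd c) z) = z"
  unfolding coord_region_def by (rule f_inv_into_f)

lemma inv_in_chart: "z \<in> coord_region c \<Longrightarrow> inv_into (fst c) (snd c) z \<in> fst c"
  unfolding coord_region_def by (rule inv_into_into)

lemma coord_expr_at: "c \<in> \<A> \<Longrightarrow> p \<in> fst c \<Longrightarrow> coord_expr c f (snd c p) = f p"
  by (simp add: coord_expr_def)

lemma ex_chart: "p \<in> topspace X \<Longrightarrow> \<exists>c\<in>\<A>. p \<in> fst c"
  using covering by force

lemma chart_cont: "c \<in> \<A> \<Longrightarrow> continuous_map (subtopology X (fst c)) (top_of_set (coord_region c)) (snd c)"
  using chart_homeo homeomorphic_imp_continuous_map by blast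

lemma inv_chart_cont:
  assumes c: "c \<in> \<A>"
  shows "continuous_map (top_of_set (coord_region c)) X (inv_into (fst c) (snd c))"
proof -
  obtain g where g: "homeomorphic_maps (subtopology X (fst c)) (top_of_set (coord_region c)) (snd c) g"
    using chart_homeo[OF c] homeomorphic_map_maps by blast
  have "continuous_map (top_of_set (coord_region c)) (subtopology X (fst c)) (inv_into (fst c) (snd c))"
  proof (rule continuous_map_eq[of _ _ g])
    show "continuous_map (top_of_set (coord_region c)) (subtopology X (fst c)) g"
      using g by (simp add: homeomorphic_maps_def)
    fix z assume "z \<in> topspace (top_of_set (coord_region c))"
    then have z: "z \<in> coord_region c" by simp
    then have "snd c (g z) = z" "g z \<in> fst c"
      using g by (auto simp: homeomorphic_maps_def continuous_map_def)
    then show "g z = inv_into (fst c) (snd c) z" using inv_chart[OF c, of "g z"] by simp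
  qed
  then show ?thesis by (rule continuous_map_into_fulltopology)
qed

lemma chart_image_open:
  assumes c: "c \<in> \<A>" and V: "openin X V" "V \<subseteq> fst c"
  shows "open (snd c ` V)"
proof -
  have "openin (subtopology X (fst c)) V" using V chart_openin[OF c] by (simp add: openin_open_subtopology)
  then have "openin (top_of_set (coord_region c)) (snd c ` V)"
    using homeomorphic_imp_open_map[OF chart_homeo[OF c]] by (simp add: open_map_def)
  then show ?thesis using region_open[OF c] by (simp add: openin_open_eq)
qed

lemma inv_image_openin:
  assumes c: "c \<in> \<A>" and V: "open V" "V \<subseteq> coord_region c"
  shows "openin X (inv_into (fst c) (snd c) ` V)"
proof -
  have "inv_into (fst c) (snd c) ` V = {p \<in> fst c. snd c p \<in> V}"
  proof safe
    fix z assume "z \<in> V"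
    then show "inv_into (fst c) (snd c) z \<in> fst c" "snd c (inv_into (fst c) (snd c) z) \<in> V"
      using V inv_in_chart[of z c] chart_inv[of z c] by auto
  next
    fix p assume "p \<in> fst c" "snd c p \<in> V"
    then show "p \<in> inv_into (fst c) (snd c) ` V" using inv_chart[OF c, of p] by (metis imageI)
  qed
  moreover have "openin (subtopology X (fst c)) {p \<in> topspace (subtopology X (fst c)). snd c p \<in> V}"
    using V region_open[OF c]
    by (intro openin_continuous_map_preimage[OF chart_cont[OF c]]) (auto simp: openin_open_eq)
  moreover have "topspace (subtopology X (fst c)) = fst c" using chart_topspace[OF c] by auto
  ultimately have "openin (subtopology X (fst c)) (inv_into (fst c) (snd c) ` V)" by metis
  then show ?thesis using chart_openin[OF c] by (simp add: openin_open_subtopology)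
qed

lemma transition_holomorphic:
  assumes "c \<in> \<A>" "d \<in> \<A>"
  shows "coord_expr c (snd d) holomorphic_on snd c ` (fst c \<inter> fst d)"
  using transition[of "fst c" "snd c" "fst d" "snd d"] assms by (simp add: coord_expr_def)

lemma overlap_open:
  assumes "c \<in> \<A>" "d \<in> \<A>"
  shows "open (snd c ` (fst c \<inter> fst d))"
  using assms by (intro chart_image_open) (auto intro: chart_openin)

lemma transition_image:
  assumes "c \<in> \<A>" "d \<in> \<A>"
  shows "coord_expr c (snd d) ` (snd c ` (fst c \<inter> fst d)) \<subseteq> coord_region d"
  using assms by (auto simp: coord_expr_def intro!: chart_in)

lemma transition_coord_expr:
  assumes "c \<in> \<A>" "d \<in> \<A>" "z \<in> snd c ` (fst c \<inter> fst d)"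
  shows "coord_expr c f z = (coord_expr d f \<circ> coord_expr c (snd d)) z"
  using assms by (auto simp: coord_expr_def)

lemma transition_coord_expr_ev:
  assumes "c \<in> \<A>" "d \<in> \<A>" "p \<in> fst c \<inter> fst d"
  shows "eventually (\<lambda>z. coord_expr c f z = (coord_expr d f \<circ> coord_expr c (snd d)) z) (nhds (snd c p))"
proof -
  have "eventually (\<lambda>z. z \<in> snd c ` (fst c \<inter> fst d)) (nhds (snd c p))"
    by (intro eventually_nhds_in_open overlap_open assms imageI)
  then show ?thesis by eventually_elim (rule transition_coord_expr[OF assms(1,2)])
qed

lemma transition_deriv_nonzero:
  assumes "c \<in> \<A>" "d \<in> \<A>" "p \<in> fst c \<inter> fst d"
  shows "deriv (coord_expr c (snd d)) (snd c p) \<noteq> 0"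
proof -
  let ?S = "snd c ` (fst c \<inter> fst d)" and ?T = "snd d ` (fst d \<inter> fst c)"
  have im: "coord_expr c (snd d) ` ?S \<subseteq> ?T" using assms by (auto simp: coord_expr_def)
  have "deriv (coord_expr d (snd c) \<circ> coord_expr c (snd d)) (snd c p) =
    deriv (coord_expr d (snd c)) (coord_expr c (snd d) (snd c p)) * deriv (coord_expr c (snd d)) (snd c p)"
    using assms by (intro deriv_comp[OF transition_holomorphic[of d c] overlap_open[of d c]
        transition_holomorphic[of c d] overlap_open[of c d] im]) auto
  moreover have "deriv (coord_expr d (snd c) \<circ> coord_expr c (snd d)) (snd c p) = deriv (\<lambda>z. z) (snd c p)"
  proof (intro deriv_cong_ev refl)
    have "eventually (\<lambda>z. z \<in> snd c ` (fst c \<inter> fst d)) (nhds (snd c p))"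
      by (intro eventually_nhds_in_open overlap_open assms imageI)
    then show "eventually (\<lambda>z. (coord_expr d (snd c) \<circ> coord_expr c (snd d)) z = z) (nhds (snd c p))"
      by eventually_elim (use assms in \<open>auto simp: coord_expr_def\<close>)
  qed
  ultimately show ?thesis by auto
qed

lemma chart_comp_deriv_transfer:
  assumes c: "c \<in> \<A>" and d: "d \<in> \<A>" and S: "open S" "\<zeta> \<in> S"
    and \<Phi>: "continuous_map (top_of_set S) X \<Phi>" "\<Phi> \<zeta> \<in> fst c \<inter> fst d"
    and D: "((snd c \<circ> \<Phi>) has_field_derivative D) (at \<zeta>)"
  shows "((snd d \<circ> \<Phi>) has_field_derivative deriv (coord_expr c (snd d)) (snd c (\<Phi> \<zeta>)) * D) (at \<zeta>)"
proof -
  have "openin (top_of_set S) {w \<in> topspace (top_of_set S). \<Phi> w \<in> fst c \<inter> fst d}"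
    by (intro openin_continuous_map_preimage[OF \<Phi>(1)] openin_Int chart_openin c d)
  then have "open {w \<in> S. \<Phi> w \<in> fst c \<inter> fst d}" using S by (simp add: openin_open_eq)
  then have ev: "eventually (\<lambda>w. w \<in> {w \<in> S. \<Phi> w \<in> fst c \<inter> fst d}) (nhds \<zeta>)"
    using S \<Phi> by (intro eventually_nhds_in_open) auto
  have "(coord_expr c (snd d) has_field_derivative deriv (coord_expr c (snd d)) (snd c (\<Phi> \<zeta>))) (at ((snd c \<circ> \<Phi>) \<zeta>))"
    using holomorphic_derivI[OF transition_holomorphic[OF c d] overlap_open[OF c d]] \<Phi>(2) by auto
  from DERIV_chain[OF this D]
  have "((coord_expr c (snd d) \<circ> (snd c \<circ> \<Phi>)) has_field_derivative deriv (coord_expr c (snd d)) (snd c (\<Phi> \<zeta>)) * D) (at \<zeta>)" .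
  moreover have "eventually (\<lambda>w. (coord_expr c (snd d) \<circ> (snd c \<circ> \<Phi>)) w = (snd d \<circ> \<Phi>) w) (nhds \<zeta>)"
    using ev by eventually_elim (use c in \<open>auto simp: coord_expr_def\<close>)
  ultimately show ?thesis by (subst (asm) DERIV_cong_ev[OF refl _ refl]) auto
qed

lemma preimage_chart_open:
  assumes "continuous_map (top_of_set S) X \<Phi>" "open S" "openin X V"
  shows "open {w \<in> S. \<Phi> w \<in> V}"
  using openin_continuous_map_preimage[OF assms(1,3)] assms(2) by (simp add: openin_open_eq)

lemma integral_mapI:
  assumes "vector_field \<A> v" "open S" "continuous_map (top_of_set S) X \<Phi>"
    "\<And>\<zeta>. \<zeta> \<in> S \<Longrightarrow> \<exists>c\<in>\<A>. \<Phi> \<zeta> \<in> fst c \<and> ((snd c \<circ> \<Phi>) has_field_derivative v c (snd c (\<Phi> \<zeta>))) (at \<zeta>)"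
  shows "integral_map X \<A> v S \<Phi>"
  unfolding integral_map_def
proof (intro conjI ballI impI assms(3))
  fix d \<zeta> assume d: "d \<in> \<A>" "\<zeta> \<in> S" "\<Phi> \<zeta> \<in> fst d"
  obtain c where c: "c \<in> \<A>" "\<Phi> \<zeta> \<in> fst c" "((snd c \<circ> \<Phi>) has_field_derivative v c (snd c (\<Phi> \<zeta>))) (at \<zeta>)"
    using assms(4)[OF d(2)] by blast
  have "v d (snd d (\<Phi> \<zeta>)) = deriv (coord_expr c (snd d)) (snd c (\<Phi> \<zeta>)) * v c (snd c (\<Phi> \<zeta>))"
    using assms(1) c d unfolding vector_field_def by blast
  then show "((snd d \<circ> \<Phi>) has_field_derivative v d (snd d (\<Phi> \<zeta>))) (at \<zeta>)"
    using chart_comp_deriv_transfer[OF c(1) d(1) assms(2) d(2) assms(3) _ c(3)] c d by simp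
qed

lemma integral_map_local_cong:
  assumes "vector_field \<A> v" "open S"
    "\<And>\<zeta>. \<zeta> \<in> S \<Longrightarrow> \<exists>T \<Psi>. open T \<and> \<zeta> \<in> T \<and> T \<subseteq> S \<and> integral_map X \<A> v T \<Psi> \<and> (\<forall>w\<in>T. \<Phi> w = \<Psi> w)"
  shows "integral_map X \<A> v S \<Phi>"
proof (rule integral_mapI[OF assms(1,2)])
  show "continuous_map (top_of_set S) X \<Phi>"
    unfolding continuous_map_def
  proof (intro conjI allI impI)
    show "\<Phi> \<in> topspace (top_of_set S) \<rightarrow> topspace X"
    proof
      fix \<zeta> assume "\<zeta> \<in> topspace (top_of_set S)"
      then obtain T \<Psi> where T: "\<zeta> \<in> T" "integral_map X \<A> v T \<Psi>" "\<forall>w\<in>T. \<Phi> w = \<Psi> w" using assms(3)[of \<zeta>] by auto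
      then show "\<Phi> \<zeta> \<in> topspace X" by (auto simp: integral_map_def continuous_map_def)
    qed
    fix U assume U: "openin X U"
    show "openin (top_of_set S) {x \<in> topspace (top_of_set S). \<Phi> x \<in> U}"
      unfolding openin_open_eq[OF assms(2)]
    proof
      show "open {x \<in> topspace (top_of_set S). \<Phi> x \<in> U}"
      proof (subst open_subopen, intro ballI)
        fix \<zeta> assume z: "\<zeta> \<in> {x \<in> topspace (top_of_set S). \<Phi> x \<in> U}"
        then obtain T \<Psi> where T: "open T" "\<zeta> \<in> T" "T \<subseteq> S" "integral_map X \<A> v T \<Psi>" "\<forall>w\<in>T. \<Phi> w = \<Psi> w" using assms(3)[of \<zeta>] by auto
        then have "open {w \<in> T. \<Psi> w \<in> U}" by (intro preimage_chart_open U) (auto simp: integral_map_def)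
        then show "\<exists>W. open W \<and> \<zeta> \<in> W \<and> W \<subseteq> {x \<in> topspace (top_of_set S). \<Phi> x \<in> U}"
          using T z by (intro exI[of _ "{w \<in> T. \<Psi> w \<in> U}"]) auto
      qed
    qed auto
  qed
  fix \<zeta> assume "\<zeta> \<in> S"
  then obtain T \<Psi> where T: "open T" "\<zeta> \<in> T" "T \<subseteq> S" "integral_map X \<A> v T \<Psi>" "\<forall>w\<in>T. \<Phi> w = \<Psi> w" using assms(3)[of \<zeta>] by auto
  then have "\<Psi> \<zeta> \<in> topspace X" by (auto simp: integral_map_def continuous_map_def)
  then obtain c where c: "c \<in> \<A>" "\<Psi> \<zeta> \<in> fst c" using ex_chart by blast
  then have "((snd c \<circ> \<Psi>) has_field_derivative v c (snd c (\<Psi> \<zeta>))) (at \<zeta>)" using T by (auto simp: integral_map_def)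
  moreover have "eventually (\<lambda>w. (snd c \<circ> \<Psi>) w = (snd c \<circ> \<Phi>) w) (nhds \<zeta>)"
    using eventually_nhds_in_open[OF T(1,2)] by eventually_elim (use T in auto)
  ultimately have "((snd c \<circ> \<Phi>) has_field_derivative v c (snd c (\<Psi> \<zeta>))) (at \<zeta>)"
    by (subst (asm) DERIV_cong_ev[OF refl _ refl]) auto
  then show "\<exists>c\<in>\<A>. \<Phi> \<zeta> \<in> fst c \<and> ((snd c \<circ> \<Phi>) has_field_derivative v c (snd c (\<Phi> \<zeta>))) (at \<zeta>)"
    using c T by auto
qed

lemma integral_map_subset:
  assumes "integral_map X \<A> v S \<Phi>" "T \<subseteq> S"
  shows "integral_map X \<A> v T \<Phi>"
  using assms by (auto simp: integral_map_def intro: continuous_map_from_subtopology_mono)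

lemma integral_map_translate:
  assumes v: "vector_field \<A> v" and \<Phi>: "integral_map X \<A> v (ball 0 r) \<Phi>"
  shows "integral_map X \<A> v (ball a r) (\<lambda>z. \<Phi> (z - a))"
  unfolding integral_map_def
proof (intro conjI ballI impI)
  have "continuous_map (top_of_set (ball a r)) (top_of_set (ball 0 r)) (\<lambda>z. z - a)"
    by (auto intro!: continuous_intros simp: dist_norm norm_minus_commute)
  then show "continuous_map (top_of_set (ball a r)) X (\<lambda>z. \<Phi> (z - a))"
    using continuous_map_compose[of "top_of_set (ball a r)" "top_of_set (ball 0 r)" "\<lambda>z. z - a" X \<Phi>] \<Phi>
    unfolding integral_map_def comp_def by blast
  fix c \<zeta> assume c: "c \<in> \<A>" "\<zeta> \<in> ball a r" "\<Phi> (\<zeta> - a) \<in> fst c"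
  then have "\<zeta> - a \<in> ball 0 r" by (simp add: dist_norm norm_minus_commute)
  with c \<Phi> have "((snd c \<circ> \<Phi>) has_field_derivative v c (snd c (\<Phi> (\<zeta> - a)))) (at (\<zeta> - a))"
    unfolding integral_map_def by blast
  then have "((snd c \<circ> \<Phi>) has_field_derivative v c (snd c (\<Phi> (\<zeta> - a)))) (at (\<zeta> + - a))" by simp
  then show "((snd c \<circ> (\<lambda>z. \<Phi> (z - a))) has_field_derivative v c (snd c (\<Phi> (\<zeta> - a)))) (at \<zeta>)"
    by (subst (asm) DERIV_shift) (auto simp: comp_def)
qed

text \<open>The set where two solutions agree is closed because the surface is Hausdorff, and open by local uniqueness.\<close>

lemma integral_map_unique:
  assumes v: "vector_field \<A> v" and S: "open S" "connected S" "a \<in> S"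
    and \<Phi>: "integral_map X \<A> v S \<Phi>" and \<Psi>: "integral_map X \<A> v S \<Psi>" and eq: "\<Phi> a = \<Psi> a"
    and z: "z \<in> S"
  shows "\<Phi> z = \<Psi> z"
proof -
  let ?E = "{x \<in> S. \<Phi> x = \<Psi> x}"
  have cont: "continuous_map (top_of_set S) X \<Phi>" "continuous_map (top_of_set S) X \<Psi>"
    using \<Phi> \<Psi> by (auto simp: integral_map_def)
  have "closedin (top_of_set S) {x \<in> topspace (top_of_set S). \<Phi> x = \<Psi> x}"
    using closedin_continuous_maps_eq[OF Hausdorff cont] .
  then have cl: "closedin (top_of_set S) ?E" by simp
  have "open ?E"
  proof (subst open_subopen, intro ballI)
    fix b assume b: "b \<in> ?E"
    then have "\<Phi> b \<in> topspace X" using cont by (auto simp: continuous_map_def)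
    then obtain c where c: "c \<in> \<A>" "\<Phi> b \<in> fst c" using ex_chart by blast
    have "open ({w \<in> S. \<Phi> w \<in> fst c} \<inter> {w \<in> S. \<Psi> w \<in> fst c})"
      using cont S c chart_openin by (intro open_Int preimage_chart_open) auto
    then obtain s where s: "s > 0" "ball b s \<subseteq> {w \<in> S. \<Phi> w \<in> fst c} \<inter> {w \<in> S. \<Psi> w \<in> fst c}"
      using b c by (subst (asm) open_contains_ball) (auto dest!: bspec[of _ _ b])
    have hol: "v c holomorphic_on coord_region c" using v c by (auto simp: vector_field_def)
    obtain t where t: "t > 0" "t \<le> s" "\<And>\<zeta>. \<zeta> \<in> ball b t \<Longrightarrow> (snd c \<circ> \<Phi>) \<zeta> = (snd c \<circ> \<Psi>) \<zeta>"
    proof (rule holomorphic_ode_local_uniqueness[OF hol region_open[OF c(1)] s(1), of b "snd c \<circ> \<Phi>" "snd c \<circ> \<Psi>"])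
      fix w assume "w \<in> ball b s"
      then have w: "w \<in> S" "\<Phi> w \<in> fst c" "\<Psi> w \<in> fst c" using s by auto
      show "((snd c \<circ> \<Phi>) has_field_derivative v c ((snd c \<circ> \<Phi>) w)) (at w)"
        "((snd c \<circ> \<Psi>) has_field_derivative v c ((snd c \<circ> \<Psi>) w)) (at w)"
        using \<Phi> \<Psi> w c by (auto simp: integral_map_def)
    qed (use b c in \<open>auto intro: chart_in\<close>)
    have "ball b t \<subseteq> ?E"
    proof
      fix w assume w: "w \<in> ball b t"
      then have "w \<in> ball b s" using t by auto
      then have "w \<in> S" "\<Phi> w \<in> fst c" "\<Psi> w \<in> fst c" using s by auto
      moreover have "snd c (\<Phi> w) = snd c (\<Psi> w)" using t(3)[OF w] by simp
      ultimately show "w \<in> ?E" using chart_inj[OF c(1)] by (auto dest: inj_onD)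
    qed
    then show "\<exists>T. open T \<and> b \<in> T \<and> T \<subseteq> ?E" using t by (intro exI[of _ "ball b t"]) auto
  qed
  then have "openin (top_of_set S) ?E" using S by (auto simp: openin_open_eq)
  moreover have "?E \<noteq> {}" using S eq by auto
  ultimately have "?E = S" using S(2) cl by (metis (lifting) connected_clopen)
  then show ?thesis using z by blast
qed

lemma integral_map_local:
  assumes v: "vector_field \<A> v" and p: "p \<in> topspace X"
  obtains U r where "openin X U" "p \<in> U" "(r::real) > 0"
    "\<And>q. q \<in> U \<Longrightarrow> \<exists>\<Phi>. integral_map X \<A> v (ball 0 r) \<Phi> \<and> \<Phi> 0 = q"
proof -
  obtain c where c: "c \<in> \<A>" "p \<in> fst c" using ex_chart[OF p] by blast
  let ?i = "inv_into (fst c) (snd c)"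
  have hol: "v c holomorphic_on coord_region c" using v c by (auto simp: vector_field_def)
  obtain e r :: real where er: "e > 0" "r > 0" "ball (snd c p) e \<subseteq> coord_region c"
    and ex: "\<And>z1. z1 \<in> ball (snd c p) e \<Longrightarrow> \<exists>\<phi>. \<phi> 0 = z1 \<and> \<phi> ` ball 0 r \<subseteq> coord_region c \<and>
       (\<forall>\<zeta>\<in>ball 0 r. (\<phi> has_field_derivative v c (\<phi> \<zeta>)) (at \<zeta>))"
    using holomorphic_ode_local_existence[OF hol region_open[OF c(1)] chart_in[OF c(2)]] by blast
  show thesis
  proof (rule that)
    show "openin X (?i ` ball (snd c p) e)" using inv_image_openin[OF c(1) _ er(3)] by simp
    have "?i (snd c p) \<in> ?i ` ball (snd c p) e" using er by (intro imageI) simp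
    then show "p \<in> ?i ` ball (snd c p) e" using c by simp
    show "r > 0" by fact
    fix q assume "q \<in> ?i ` ball (snd c p) e"
    then obtain z1 where z1: "z1 \<in> ball (snd c p) e" "q = ?i z1" by auto
    obtain \<phi> where \<phi>: "\<phi> 0 = z1" "\<phi> ` ball 0 r \<subseteq> coord_region c"
       "\<forall>\<zeta>\<in>ball 0 r. (\<phi> has_field_derivative v c (\<phi> \<zeta>)) (at \<zeta>)" using ex[OF z1(1)] by blast
    have \<phi>r: "\<phi> w \<in> coord_region c" if "w \<in> ball 0 r" for w using \<phi>(2) that by auto
    have "integral_map X \<A> v (ball 0 r) (?i \<circ> \<phi>)"
    proof (rule integral_mapI[OF v])
      have "continuous_on (ball 0 r) \<phi>" using \<phi>(3) by (meson DERIV_isCont continuous_at_imp_continuous_on)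
      then have "continuous_map (top_of_set (ball 0 r)) (top_of_set (coord_region c)) \<phi>" using \<phi>(2) by auto
      then show "continuous_map (top_of_set (ball 0 r)) X (?i \<circ> \<phi>)"
        using inv_chart_cont[OF c(1)] by (rule continuous_map_compose)
      fix \<zeta> :: complex assume z: "\<zeta> \<in> ball 0 r"
      have "eventually (\<lambda>w. \<phi> w = (snd c \<circ> (?i \<circ> \<phi>)) w) (nhds \<zeta>)"
        using eventually_nhds_in_open[OF open_ball z] by eventually_elim (simp add: \<phi>r)
      from DERIV_cong_ev[OF refl this refl] have "((snd c \<circ> (?i \<circ> \<phi>)) has_field_derivative v c (\<phi> \<zeta>)) (at \<zeta>)"
        using \<phi>(3) z by blast
      moreover have "\<phi> \<zeta> \<in> coord_region c" using \<phi>(2) z by auto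
      ultimately show "\<exists>c\<in>\<A>. (?i \<circ> \<phi>) \<zeta> \<in> fst c \<and> ((snd c \<circ> (?i \<circ> \<phi>)) has_field_derivative v c (snd c ((?i \<circ> \<phi>) \<zeta>))) (at \<zeta>)"
        using c by (intro bexI[of _ c]) (auto intro: inv_in_chart)
    qed auto
    then show "\<exists>\<Phi>. integral_map X \<A> v (ball 0 r) \<Phi> \<and> \<Phi> 0 = q" using \<phi>(1) z1 by (intro exI[of _ "?i \<circ> \<phi>"]) auto
  qed
qed

lemma integral_map_uniform:
  assumes v: "vector_field \<A> v" and K: "compactin X K"
  obtains r where "(r::real) > 0" "\<And>q. q \<in> K \<Longrightarrow> \<exists>\<Phi>. integral_map X \<A> v (ball 0 r) \<Phi> \<and> \<Phi> 0 = q"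
proof -
  define ok where "ok = (\<lambda>r q. \<exists>\<Phi>. integral_map X \<A> v (ball 0 r) \<Phi> \<and> \<Phi> 0 = q)"
  have mono: "ok s q" if "ok r q" "s \<le> r" for r s q
  proof -
    obtain \<Phi> where "integral_map X \<A> v (ball 0 r) \<Phi>" "\<Phi> 0 = q" using \<open>ok r q\<close> by (auto simp: ok_def)
    moreover from this(1) have "integral_map X \<A> v (ball 0 s) \<Phi>"
      by (rule integral_map_subset) (rule subset_ball[OF \<open>s \<le> r\<close>])
    ultimately show ?thesis by (auto simp: ok_def)
  qed
  define \<U> where "\<U> = {U. openin X U \<and> (\<exists>r>0. \<forall>q\<in>U. ok r q)}"
  have "K \<subseteq> \<Union>\<U>"
  proof
    fix p assume "p \<in> K"
    then have "p \<in> topspace X" using K by (auto simp: compactin_def)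
    from integral_map_local[OF v this] obtain U r where "openin X U" "p \<in> U" "(r::real) > 0"
    "\<And>q. q \<in> U \<Longrightarrow> ok r q" unfolding ok_def by metis
    then show "p \<in> \<Union>\<U>" unfolding \<U>_def by blast
  qed
  then obtain \<F> where F: "finite \<F>" "\<F> \<subseteq> \<U>" "K \<subseteq> \<Union>\<F>"
    using K unfolding compactin_def \<U>_def by (metis (no_types, lifting) mem_Collect_eq)
  then have "\<forall>U\<in>\<F>. \<exists>r>0. \<forall>q\<in>U. ok r q" unfolding \<U>_def by blast
  then obtain \<rho> where \<rho>: "\<And>U. U \<in> \<F> \<Longrightarrow> \<rho> U > 0 \<and> (\<forall>q\<in>U. ok (\<rho> U) q)" by metis
  define r where "r = Min (insert 1 (\<rho> ` \<F>))"
  have "r > 0" using F \<rho> by (auto simp: r_def)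
  moreover have "ok r q" if qK: "q \<in> K" for q
  proof -
    obtain U where "U \<in> \<F>" "q \<in> U" using F(3) qK by blast
    moreover from this have "r \<le> \<rho> U" using F(1) by (simp add: r_def)
    ultimately show ?thesis using \<rho>[of U] mono[of "\<rho> U" q r] by blast
  qed
  ultimately show thesis using that unfolding ok_def by blast
qed

lemma integral_map_glue:
  assumes v: "vector_field \<A> v" and op: "\<And>i. i \<in> I \<Longrightarrow> open (S i)"
    and \<Phi>: "\<And>i. i \<in> I \<Longrightarrow> integral_map X \<A> v (S i) (\<Phi> i)"
    and agree: "\<And>i j z. \<lbrakk>i \<in> I; j \<in> I; z \<in> S i; z \<in> S j\<rbrakk> \<Longrightarrow> \<Phi> i z = \<Phi> j z"
  obtains \<Psi> where "integral_map X \<A> v (\<Union>i\<in>I. S i) \<Psi>" "\<And>i z. i \<in> I \<Longrightarrow> z \<in> S i \<Longrightarrow> \<Psi> z = \<Phi> i z"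
proof -
  define \<Psi> where "\<Psi> = (\<lambda>z. \<Phi> (SOME i. i \<in> I \<and> z \<in> S i) z)"
  have eq: "\<Psi> z = \<Phi> i z" if "i \<in> I" "z \<in> S i" for i z
  proof -
    have "(SOME i. i \<in> I \<and> z \<in> S i) \<in> I \<and> z \<in> S (SOME i. i \<in> I \<and> z \<in> S i)"
      using that by (intro someI[of "\<lambda>i. i \<in> I \<and> z \<in> S i" i]) auto
    then show ?thesis unfolding \<Psi>_def by (intro agree) (use that in auto)
  qed
  have "integral_map X \<A> v (\<Union>i\<in>I. S i) \<Psi>"
  proof (rule integral_map_local_cong[OF v])
    show "open (\<Union>i\<in>I. S i)" using op by blast
    fix z assume "z \<in> (\<Union>i\<in>I. S i)"
    then obtain i where "i \<in> I" "z \<in> S i" by blast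
    then show "\<exists>T \<Psi>'. open T \<and> z \<in> T \<and> T \<subseteq> (\<Union>i\<in>I. S i) \<and> integral_map X \<A> v T \<Psi>' \<and> (\<forall>w\<in>T. \<Psi> w = \<Psi>' w)"
      using op \<Phi> eq by (intro exI[of _ "S i"] exI[of _ "\<Phi> i"]) auto
  qed
  with eq that show thesis by blast
qed

text \<open>Solutions on concentric discs glue, which gives a solution on the disc of supremal radius \<open>R\<close>. If no radius of it
  diverged, every radius would return to a compact set arbitrarily close to its end, and the uniform local existence
  would continue the solution to a disc around each boundary point. By compactness of the circle, the glued
  continuations would cover a larger disc.\<close>

lemma integral_map_maximal:
  assumes v: "vector_field \<A> v" and p: "p \<in> topspace X"
  obtains (entire) "\<And>r. (r::real) > 0 \<Longrightarrow> \<exists>\<Phi>. integral_map X \<A> v (ball 0 r) \<Phi> \<and> \<Phi> 0 = p"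
  | (bounded) R \<Phi> b where "(R::real) > 0" "integral_map X \<A> v (ball 0 R) \<Phi>" "\<Phi> 0 = p" "cmod b = R"
      "divergent_curve X (\<lambda>t. \<Phi> (of_real t * b))"
proof -
  define S where "S = {r::real. r > 0 \<and> (\<exists>\<Phi>. integral_map X \<A> v (ball 0 r) \<Phi> \<and> \<Phi> 0 = p)}"
  have SD: "\<exists>\<Phi>. integral_map X \<A> v (ball 0 r) \<Phi> \<and> \<Phi> 0 = p" if "s \<in> S" "r \<le> s" for r s
  proof -
    obtain \<Phi> where "integral_map X \<A> v (ball 0 s) \<Phi>" "\<Phi> 0 = p" using \<open>s \<in> S\<close> by (auto simp: S_def)
    then show ?thesis using integral_map_subset[OF _ subset_ball[OF \<open>r \<le> s\<close>]] by blast
  qed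
  have "S \<noteq> {}"
  proof -
    obtain U and r :: real where "r > 0" "p \<in> U" "\<And>q. q \<in> U \<Longrightarrow> \<exists>\<Phi>. integral_map X \<A> v (ball 0 r) \<Phi> \<and> \<Phi> 0 = q"
      using integral_map_local[OF v p] by metis
    then show ?thesis by (auto simp: S_def)
  qed
  show thesis
  proof (cases "bdd_above S")
    case False
    show thesis
    proof (rule entire)
      fix r :: real
      from False obtain s where "s \<in> S" "r < s" unfolding bdd_above_def by (meson not_le)
      then show "\<exists>\<Phi>. integral_map X \<A> v (ball 0 r) \<Phi> \<and> \<Phi> 0 = p" using SD[of s r] by simp
    qed
  next
    case bdd: True
    define R where "R = Sup S"
    have R_ge: "r \<le> R" if "r \<in> S" for r unfolding R_def by (rule cSup_upper[OF that bdd])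
    have R: "R > 0" using \<open>S \<noteq> {}\<close> R_ge by (force simp: S_def)
    have "\<forall>r\<in>S. \<exists>\<Phi>. integral_map X \<A> v (ball 0 r) \<Phi> \<and> \<Phi> 0 = p" by (auto simp: S_def)
    then obtain \<Phi>s where \<Phi>s: "\<And>r. r \<in> S \<Longrightarrow> integral_map X \<A> v (ball 0 r) (\<Phi>s r) \<and> \<Phi>s r 0 = p" by metis
    obtain \<Phi> where \<Phi>: "integral_map X \<A> v (\<Union>r\<in>S. ball 0 r) \<Phi>" "\<And>r z. r \<in> S \<Longrightarrow> z \<in> ball 0 r \<Longrightarrow> \<Phi> z = \<Phi>s r z"
    proof (rule integral_map_glue[OF v, of S "\<lambda>r. ball 0 r" \<Phi>s])
      fix i j z assume ij: "i \<in> S" "j \<in> S" "z \<in> ball (0::complex) i" "z \<in> ball 0 j"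
      show "\<Phi>s i z = \<Phi>s j z"
      proof (rule integral_map_unique[OF v, of "ball 0 i \<inter> ball 0 j" 0])
        show "connected (ball 0 i \<inter> ball (0::complex) j)" by (intro convex_connected convex_Int convex_ball)
        show "integral_map X \<A> v (ball 0 i \<inter> ball 0 j) (\<Phi>s i)" "integral_map X \<A> v (ball 0 i \<inter> ball 0 j) (\<Phi>s j)"
          using \<Phi>s ij by (auto intro: integral_map_subset)
      qed (use ij \<Phi>s in \<open>auto simp: S_def\<close>)
    qed (use \<Phi>s in auto)
    have "(\<Union>r\<in>S. ball 0 r) = ball (0::complex) R"
    proof (intro equalityI subsetI)
      fix z :: complex assume "z \<in> ball 0 R"
      then have "cmod z < Sup S" by (simp add: R_def)
      then obtain r where "r \<in> S" "cmod z < r" using less_cSupD[OF \<open>S \<noteq> {}\<close>] by blast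
      then show "z \<in> (\<Union>r\<in>S. ball 0 r)" by auto
    qed (use R_ge in force)
    with \<Phi> have \<Phi>R: "integral_map X \<A> v (ball 0 R) \<Phi>" by simp
    obtain s where "s \<in> S" using \<open>S \<noteq> {}\<close> by blast
    then have \<Phi>0: "\<Phi> 0 = p" using \<Phi>(2)[of s 0] \<Phi>s[of s] by (simp add: S_def)
    have "\<exists>b. cmod b = R \<and> divergent_curve X (\<lambda>t. \<Phi> (of_real t * b))"
    proof (rule ccontr)
      assume no: "\<not> ?thesis"
      have "\<exists>e \<Psi>. e > 0 \<and> integral_map X \<A> v (ball b e) \<Psi> \<and> (\<forall>z\<in>ball b e \<inter> ball 0 R. \<Psi> z = \<Phi> z)" if b: "cmod b = R" for b
      proof -
        have "\<not> divergent_curve X (\<lambda>t. \<Phi> (of_real t * b))" using no b by blast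
        then obtain K where K: "compactin X K" "\<forall>t0\<in>{0..<1}. \<exists>t\<in>{t0..<1}. \<Phi> (of_real t * b) \<in> K"
          unfolding divergent_curve_def by blast
        obtain r :: real where r: "r > 0" "\<And>q. q \<in> K \<Longrightarrow> \<exists>\<Phi>. integral_map X \<A> v (ball 0 r) \<Phi> \<and> \<Phi> 0 = q"
          using integral_map_uniform[OF v K(1)] by blast
        \<comment> \<open>After this time the point \<open>t b\<close> is within \<open>r / 2\<close> of \<open>b\<close>, so a solution on the disc of radius \<open>r\<close> about
          \<open>t b\<close> is defined on the disc of radius \<open>r / 2\<close> about \<open>b\<close>.\<close>
        define t0 where "t0 = max 0 (1 - r / (2 * R))"
        have "t0 \<in> {0..<1}" using r R by (auto simp: t0_def)
        with K(2) obtain t where t: "t0 \<le> t" "t < 1" "\<Phi> (of_real t * b) \<in> K" by force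
        have t': "0 \<le> t" "(1 - t) * R \<le> r / 2"
        proof -
          show "0 \<le> t" using t by (simp add: t0_def)
          have "1 - t \<le> r / (2 * R)" using t by (simp add: t0_def)
          then show "(1 - t) * R \<le> r / 2" using R by (simp add: field_simps)
        qed
        define a where "a = of_real t * b"
        have "cmod a = t * R" using b t' by (simp add: a_def norm_mult)
        then have aR: "a \<in> ball 0 R" using t R by simp
        have "b - a = of_real (1 - t) * b" by (simp add: a_def algebra_simps)
        then have "cmod (b - a) = (1 - t) * R" using t b by (simp add: norm_mult del: of_real_diff)
        then have ba: "dist a b \<le> r / 2" using t' by (simp add: dist_norm norm_minus_commute)
        obtain \<Psi> where \<Psi>: "integral_map X \<A> v (ball 0 r) \<Psi>" "\<Psi> 0 = \<Phi> a" using r(2)[OF t(3)] by (auto simp: a_def)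
        have T: "integral_map X \<A> v (ball a r) (\<lambda>z. \<Psi> (z - a))" by (rule integral_map_translate[OF v \<Psi>(1)])
        have eq: "\<Psi> (z - a) = \<Phi> z" if z: "z \<in> ball a r \<inter> ball 0 R" for z
        proof (rule integral_map_unique[OF v, of "ball a r \<inter> ball 0 R" a])
          show "connected (ball a r \<inter> ball 0 R)" by (intro convex_connected convex_Int convex_ball)
          show "integral_map X \<A> v (ball a r \<inter> ball 0 R) (\<lambda>z. \<Psi> (z - a))" "integral_map X \<A> v (ball a r \<inter> ball 0 R) \<Phi>"
            using T \<Phi>R by (auto intro: integral_map_subset)
        qed (use z aR r \<Psi> in auto)
        have sub: "ball b (r / 2) \<subseteq> ball a r"
        proof
          fix x assume "x \<in> ball b (r / 2)"
          then show "x \<in> ball a r" using ba dist_triangle[of a x b] by simp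
        qed
        show ?thesis
          using r sub eq integral_map_subset[OF T sub] by (intro exI[of _ "r / 2"] exI[of _ "\<lambda>z. \<Psi> (z - a)"]) auto
      qed
      then obtain e \<Psi> where e: "\<And>b. cmod b = R \<Longrightarrow> e b > 0" "\<And>b. cmod b = R \<Longrightarrow> integral_map X \<A> v (ball b (e b)) (\<Psi> b)"
        and agr: "\<And>b z. \<lbrakk>cmod b = R; z \<in> ball b (e b); z \<in> ball 0 R\<rbrakk> \<Longrightarrow> \<Psi> b z = \<Phi> z" by (metis IntI)
      define I where "I = insert None (Some ` sphere (0::complex) R)"
      define W where "W = (\<lambda>i. case i of None \<Rightarrow> ball 0 R | Some b \<Rightarrow> ball b (e b))"
      define \<Theta> where "\<Theta> = (\<lambda>i. case i of None \<Rightarrow> \<Phi> | Some b \<Rightarrow> \<Psi> b)"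
      have agr2: "\<Psi> b z = \<Psi> b' z" if b: "cmod b = R" "cmod b' = R" and z: "z \<in> ball b (e b)" "z \<in> ball b' (e b')" for b b' z
      proof (cases "b = b'")
        case False
        \<comment> \<open>Two of the new discs that meet also meet inside the old one: the point of the segment from \<open>b\<close> to \<open>b'\<close>
          that divides it in the ratio of the radii lies in both, and strict convexity puts it inside the circle.\<close>
        let ?u = "e b / (e b + e b')"
        define w where "w = (1 - ?u) *\<^sub>R b + ?u *\<^sub>R b'"
        have ee: "e b > 0" "e b' > 0" using e(1) b by auto
        have u: "0 < ?u" "?u < 1" using ee by auto
        have "w \<in> open_segment b b'" using False u unfolding w_def in_segment by blast
        then have "dist w 0 < R" using dist_decreases_open_segment[of w b b' 0] b by auto
        then have wR: "w \<in> ball 0 R" by simp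
        have bb: "dist b b' < e b + e b'" using dist_triangle_less_add[of z b' "e b'" b "e b"] z
          by (smt (verit, best) dist_commute dist_triangle mem_ball)
        have "w - b = ?u *\<^sub>R (b' - b)" "w - b' = (1 - ?u) *\<^sub>R (b - b')" by (simp_all add: w_def algebra_simps)
        then have "cmod (w - b) = \<bar>?u\<bar> * cmod (b' - b)" "cmod (w - b') = \<bar>1 - ?u\<bar> * cmod (b - b')"
          by (simp_all only: norm_scaleR)
        moreover have "1 - ?u = e b' / (e b + e b')" using ee by (simp add: field_simps)
        moreover define \<rho> where "\<rho> = dist b b' / (e b + e b')"
        ultimately have "dist b w = e b * \<rho>" "dist b' w = e b' * \<rho>"
          using ee by (simp_all add: dist_norm norm_minus_commute)
        moreover have "\<rho> < 1" using bb ee by (simp add: \<rho>_def)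
        ultimately have "dist b w < e b" "dist b' w < e b'" using ee by simp_all
        then have w: "w \<in> ball b (e b) \<inter> ball b' (e b')" by simp
        show ?thesis
        proof (rule integral_map_unique[OF v, of "ball b (e b) \<inter> ball b' (e b')" w])
          show "connected (ball b (e b) \<inter> ball b' (e b'))" by (intro convex_connected convex_Int convex_ball)
          show "integral_map X \<A> v (ball b (e b) \<inter> ball b' (e b')) (\<Psi> b)" "integral_map X \<A> v (ball b (e b) \<inter> ball b' (e b')) (\<Psi> b')"
            using e(2) b by (auto intro: integral_map_subset)
          show "\<Psi> b w = \<Psi> b' w" using agr[OF b(1) _ wR] agr[OF b(2) _ wR] w by simp
        qed (use w z in auto)
      qed simp
      obtain \<Xi> where \<Xi>: "integral_map X \<A> v (\<Union>i\<in>I. W i) \<Xi>" "\<And>i z. i \<in> I \<Longrightarrow> z \<in> W i \<Longrightarrow> \<Xi> z = \<Theta> i z"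
      proof (rule integral_map_glue[OF v, of I W \<Theta>])
        fix i assume "i \<in> I"
        then show "open (W i)" "integral_map X \<A> v (W i) (\<Theta> i)" using \<Phi>R e(2) by (auto simp: I_def W_def \<Theta>_def)
        fix j z assume "j \<in> I" and z: "z \<in> W i" "z \<in> W j"
        have bR: "cmod b = R" if "k \<in> I" "k = Some b" for k b using that by (auto simp: I_def)
        show "\<Theta> i z = \<Theta> j z"
        proof (cases i)
          case i: None
          show ?thesis
          proof (cases j)
            case (Some b)
            then show ?thesis using z i agr[OF bR[OF \<open>j \<in> I\<close> Some], of z] by (auto simp: W_def \<Theta>_def)
          qed (simp add: i)
        next
          case i: (Some b)
          show ?thesis
          proof (cases j)
            case None
            then show ?thesis using z i agr[OF bR[OF \<open>i \<in> I\<close> i], of z] by (auto simp: W_def \<Theta>_def)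
          next
            case (Some b')
            have "\<Psi> b z = \<Psi> b' z"
              by (rule agr2[OF bR[OF \<open>i \<in> I\<close> i] bR[OF \<open>j \<in> I\<close> Some]]) (use z i Some in \<open>auto simp: W_def\<close>)
            then show ?thesis using i Some by (simp add: \<Theta>_def)
          qed
        qed
      qed (rule that, blast+)
      have W1: "cball 0 R \<subseteq> (\<Union>i\<in>I. W i)"
      proof
        fix z :: complex assume z: "z \<in> cball 0 R"
        show "z \<in> (\<Union>i\<in>I. W i)"
        proof (cases "cmod z < R")
          case True then show ?thesis by (intro UN_I[of None]) (auto simp: I_def W_def)
        next
          case False then show ?thesis using z e(1)[of z] by (intro UN_I[of "Some z"]) (auto simp: I_def W_def)
        qed
      qed
      have W2: "open (\<Union>i\<in>I. W i)" by (auto simp: W_def split: option.splits)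
      obtain d where d: "d > 0" "(\<Union>x\<in>cball 0 R. ball x d) \<subseteq> (\<Union>i\<in>I. W i)"
        by (rule compact_subset_open_imp_ball_epsilon_subset[OF compact_cball W2 W1])
      have "ball 0 (R + d) \<subseteq> (\<Union>i\<in>I. W i)"
      proof (rule order_trans[OF _ d(2)], rule subsetI)
        fix z :: complex assume z: "z \<in> ball 0 (R + d)"
        show "z \<in> (\<Union>x\<in>cball 0 R. ball x d)"
        proof (cases "cmod z \<le> R")
          case True then show ?thesis using d by (intro UN_I[of z]) auto
        next
          case False
          then have z0: "cmod z > R" "z \<noteq> 0" using R by auto
          define y where "y = of_real (R / cmod z) * z"
          have "cmod y = \<bar>R / cmod z\<bar> * cmod z" unfolding y_def by (simp only: norm_mult norm_of_real)
          then have "cmod y = R" using z0 R by simp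
          moreover have "z - y = of_real (1 - R / cmod z) * z" by (simp add: y_def algebra_simps)
          then have "cmod (z - y) = (1 - R / cmod z) * cmod z" using z0 R by (simp only: norm_mult norm_of_real) simp
          then have "cmod (z - y) = cmod z - R" using z0 by (simp add: left_diff_distrib)
          ultimately show ?thesis using z by (intro UN_I[of y]) (auto simp: dist_norm norm_minus_commute)
        qed
      qed
      then have "integral_map X \<A> v (ball 0 (R + d)) \<Xi>" using \<Xi>(1) integral_map_subset by blast
      moreover have "\<Xi> 0 = p" using \<Xi>(2)[of None 0] R \<Phi>0 by (auto simp: I_def W_def \<Theta>_def)
      ultimately have "R + d \<in> S" using R d by (auto simp: S_def)
      then show False using R_ge[of "R + d"] d by simp
    qed
    then show thesis using bounded[OF R \<Phi>R \<Phi>0] by blast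
  qed
qed

end

section \<open>The Laplacian of the logarithm of the metric\<close>

lemma cmod_power2_inner: "(cmod z)\<^sup>2 = inner z z"
  by (simp add: power2_norm_eq_inner)

text \<open>The formula is for an arbitrary line \<open>P\<close> with direction \<open>e\<close>; the Laplacian is the sum over \<open>e = 1\<close> and \<open>e = \<i>\<close>.\<close>

lemma second_derivative_ln_energy:
  fixes P :: "real \<Rightarrow> complex"
  assumes hol: "f holomorphic_on D" "g holomorphic_on D" "open D"
    and pos: "\<And>z. z \<in> D \<Longrightarrow> (cmod (f z))\<^sup>2 + (cmod (g z))\<^sup>2 > 0"
    and P: "\<And>t. (P has_vector_derivative e) (at t)" and s: "P s \<in> D"
  defines "n \<equiv> (\<lambda>z. (cmod (f z))\<^sup>2 + (cmod (g z))\<^sup>2)"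
    and "n1 \<equiv> (\<lambda>z. 2 * (inner (f z) (e * deriv f z) + inner (g z) (e * deriv g z)))"
    and "n2 \<equiv> (\<lambda>z. 2 * (inner (f z) (e * (e * deriv (deriv f) z)) + inner (g z) (e * (e * deriv (deriv g) z)) +
           (cmod (e * deriv f z))\<^sup>2 + (cmod (e * deriv g z))\<^sup>2))"
  shows "deriv (deriv (\<lambda>t. ln (2 * n (P t)))) s = (n2 (P s) * n (P s) - (n1 (P s))\<^sup>2) / (n (P s))\<^sup>2"
proof -
  have chain: "((\<lambda>t. h (P t)) has_vector_derivative e * deriv h (P t)) (at t)" if "h holomorphic_on D" "P t \<in> D" for h t
    using field_vector_diff_chain_at[OF P holomorphic_derivI[OF that(1) hol(3) that(2)]] by (simp add: comp_def)
  have inn: "((\<lambda>t. inner (u t) (w t)) has_real_derivative inner (u t) w' + inner u' (w t)) (at t)"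
    if "(u has_vector_derivative u') (at t)" "(w has_vector_derivative w') (at t)" for u w :: "real \<Rightarrow> complex" and u' w' t
    using bounded_bilinear.has_vector_derivative[OF bounded_bilinear_inner that]
    by (simp add: has_real_derivative_iff_has_vector_derivative)
  have hol': "deriv f holomorphic_on D" "deriv g holomorphic_on D"
    using hol by (auto intro: holomorphic_deriv)
  have d1: "((\<lambda>t. n (P t)) has_real_derivative n1 (P t)) (at t)" if "P t \<in> D" for t
  proof -
    have "((\<lambda>t. inner (f (P t)) (f (P t)) + inner (g (P t)) (g (P t))) has_real_derivative
      (inner (f (P t)) (e * deriv f (P t)) + inner (e * deriv f (P t)) (f (P t))) +
      (inner (g (P t)) (e * deriv g (P t)) + inner (e * deriv g (P t)) (g (P t)))) (at t)"
      by (intro DERIV_add inn chain hol that)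
    then show ?thesis unfolding n_def n1_def cmod_power2_inner by (simp add: inner_commute algebra_simps)
  qed
  have d2: "((\<lambda>t. n1 (P t)) has_real_derivative n2 (P t)) (at t)" if "P t \<in> D" for t
  proof -
    have ce: "((\<lambda>t. e * deriv h (P t)) has_vector_derivative e * (e * deriv (deriv h) (P t))) (at t)" if "deriv h holomorphic_on D" for h
      using bounded_linear.has_vector_derivative[OF bounded_linear_mult_right chain[OF that \<open>P t \<in> D\<close>], of e] .
    have "((\<lambda>t. 2 * (inner (f (P t)) (e * deriv f (P t)) + inner (g (P t)) (e * deriv g (P t)))) has_real_derivative
      2 * ((inner (f (P t)) (e * (e * deriv (deriv f) (P t))) + inner (e * deriv f (P t)) (e * deriv f (P t))) +
      (inner (g (P t)) (e * (e * deriv (deriv g) (P t))) + inner (e * deriv g (P t)) (e * deriv g (P t))))) (at t)"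
      by (intro DERIV_add DERIV_cmult inn chain ce hol hol' that)
    then show ?thesis unfolding n1_def n2_def cmod_power2_inner by (simp add: algebra_simps)
  qed
  have "continuous_on UNIV P" using P by (meson continuous_at_imp_continuous_on has_vector_derivative_continuous)
  then have op: "open (P -` D)" using hol(3) by (rule open_vimage[rotated])
  have npos: "n z > 0" if "z \<in> D" for z using pos[OF that] by (simp add: n_def)
  have first: "deriv (\<lambda>t. ln (2 * n (P t))) t = n1 (P t) / n (P t)" if "P t \<in> D" for t
    by (rule DERIV_imp_deriv) (use npos[OF that] in \<open>auto intro!: derivative_eq_intros d1 that simp: field_simps\<close>)
  have "deriv (deriv (\<lambda>t. ln (2 * n (P t)))) s = deriv (\<lambda>t. n1 (P t) / n (P t)) s"
  proof (intro deriv_cong_ev refl)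
    have "eventually (\<lambda>t. t \<in> P -` D) (nhds s)" using op s by (intro eventually_nhds_in_open) auto
    then show "eventually (\<lambda>t. deriv (\<lambda>t. ln (2 * n (P t))) t = n1 (P t) / n (P t)) (nhds s)"
      by eventually_elim (auto intro: first)
  qed
  also have "\<dots> = (n2 (P s) * n (P s) - n1 (P s) * n1 (P s)) / (n (P s) * n (P s))"
    using npos[OF s] by (intro DERIV_imp_deriv DERIV_divide d1 d2 s) auto
  finally show ?thesis by (simp add: power2_eq_square)
qed

text \<open>The second derivatives of \<open>f\<close> and \<open>g\<close> cancel in the sum, and Lagrange's identity leaves the square of the
  determinant of \<open>(f, g)\<close> and \<open>(f', g')\<close>.\<close>

lemma laplacian_ln_energy:
  assumes hol: "f holomorphic_on D" "g holomorphic_on D" "open D" "z \<in> D"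
    and pos: "\<And>z. z \<in> D \<Longrightarrow> (cmod (f z))\<^sup>2 + (cmod (g z))\<^sup>2 > 0"
  shows "laplacian (\<lambda>w. ln (2 * ((cmod (f w))\<^sup>2 + (cmod (g w))\<^sup>2))) z =
    4 * (cmod (f z * deriv g z - deriv f z * g z))\<^sup>2 / ((cmod (f z))\<^sup>2 + (cmod (g z))\<^sup>2)\<^sup>2"
proof -
  let ?P = "\<lambda>x. Complex x (Im z)" and ?Q = "\<lambda>y. Complex (Re z) y"
  have P: "(?P has_vector_derivative 1) (at t)" for t
  proof -
    have "((\<lambda>x. of_real x + \<i> * of_real (Im z)) has_vector_derivative 1) (at t)"
      by (auto intro!: derivative_eq_intros has_vector_derivative_real_field)
    then show ?thesis by (simp add: complex_eq_iff Complex_eq)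
  qed
  have Q: "(?Q has_vector_derivative \<i>) (at t)" for t
  proof -
    have "((\<lambda>x. of_real (Re z) + \<i> * of_real x) has_vector_derivative \<i>) (at t)"
      by (auto intro!: derivative_eq_intros has_vector_derivative_real_field)
    then show ?thesis by (simp add: complex_eq_iff Complex_eq)
  qed
  have PQ: "?P (Re z) \<in> D" "?Q (Im z) \<in> D" using hol by (simp_all add: complex_surj)
  have eq: "4 * (cmod (f z * deriv g z - deriv f z * g z))\<^sup>2 =
      2 * (inner (f z) (1 * (1 * deriv (deriv f) z)) + inner (g z) (1 * (1 * deriv (deriv g) z)) +
        (cmod (1 * deriv f z))\<^sup>2 + (cmod (1 * deriv g z))\<^sup>2) * ((cmod (f z))\<^sup>2 + (cmod (g z))\<^sup>2) -
      (2 * (inner (f z) (1 * deriv f z) + inner (g z) (1 * deriv g z)))\<^sup>2 +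
      (2 * (inner (f z) (\<i> * (\<i> * deriv (deriv f) z)) + inner (g z) (\<i> * (\<i> * deriv (deriv g) z)) +
        (cmod (\<i> * deriv f z))\<^sup>2 + (cmod (\<i> * deriv g z))\<^sup>2) * ((cmod (f z))\<^sup>2 + (cmod (g z))\<^sup>2) -
      (2 * (inner (f z) (\<i> * deriv f z) + inner (g z) (\<i> * deriv g z)))\<^sup>2)"
    unfolding inner_complex_def cmod_power2 by simp algebra
  show ?thesis
    unfolding laplacian_def eq add_divide_distrib
    using second_derivative_ln_energy[where P = ?P and s = "Re z", OF hol(1-3) pos P PQ(1)]
      second_derivative_ln_energy[where P = ?Q and s = "Im z", OF hol(1-3) pos Q PQ(2)]
    by (simp only: complex_surj)
qed

section \<open>Lengths and lower integrals\<close>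

text \<open>The integral of an arbitrary nonnegative function is the supremum over the simple functions below it, and a sum of simple
  functions is simple. The speed of a curve whose break points accumulate is treated as such an arbitrary function.\<close>

lemma nn_integral_superadditive:
  assumes "\<And>x. f x + g x \<le> h x"
  shows "nn_integral M f + nn_integral M g \<le> nn_integral M h"
proof -
  have *: "integral\<^sup>S M u + integral\<^sup>S M w \<le> nn_integral M h"
    if u: "simple_function M u" "u \<le> f" and w: "simple_function M w" "w \<le> g" for u w
  proof -
    have "integral\<^sup>S M u + integral\<^sup>S M w = integral\<^sup>S M (\<lambda>x. u x + w x)" using u w by (simp add: simple_integral_add)
    also have "\<dots> \<le> nn_integral M h"
      unfolding nn_integral_def
    proof (rule SUP_upper, safe)
      show "simple_function M (\<lambda>x. u x + w x)" using u w by simp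
      show "(\<lambda>x. u x + w x) \<le> h"
        using u(2) w(2) assms by (auto simp: le_fun_def intro: order_trans[OF add_mono])
    qed
    finally show ?thesis .
  qed
  let ?A = "\<lambda>f. {u. simple_function M u \<and> u \<le> f}"
  have ne: "?A f \<noteq> {}" for f :: "'a \<Rightarrow> ennreal" by (auto intro!: exI[of _ "\<lambda>_. 0"] simp: le_fun_def)
  have "nn_integral M f + nn_integral M g = (SUP u\<in>?A f. integral\<^sup>S M u + nn_integral M g)"
    unfolding nn_integral_def[of M f] by (rule ennreal_SUP_add_left[symmetric, OF ne])
  also have "\<dots> \<le> nn_integral M h"
  proof (rule SUP_least, safe)
    fix u assume u: "simple_function M u" "u \<le> f"
    have "integral\<^sup>S M u + nn_integral M g = (SUP w\<in>?A g. integral\<^sup>S M u + integral\<^sup>S M w)"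
      unfolding nn_integral_def[of M g] by (rule ennreal_SUP_add_right[OF ne])
    also have "\<dots> \<le> nn_integral M h" by (rule SUP_least) (use * u in auto)
    finally show "integral\<^sup>S M u + nn_integral M g \<le> nn_integral M h" .
  qed
  finally show ?thesis .
qed

text \<open>Reflection is a measure preserving involution, and one inequality for all functions is enough.\<close>

lemma nn_integral_reflect:
  "nn_integral lborel (\<lambda>t::real. f (- t)) = nn_integral lborel f"
proof -
  have le: "nn_integral lborel g \<le> nn_integral lborel (\<lambda>t::real. g (- t))" for g
    unfolding nn_integral_def[of lborel g]
  proof (rule SUP_least, safe)
    fix u assume u: "simple_function lborel u" "u \<le> g"
    have m: "u \<in> borel_measurable borel" using borel_measurable_simple_function[OF u(1)] by simp
    have "integral\<^sup>S lborel u = nn_integral lborel u" using u by (simp add: nn_integral_eq_simple_integral)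
    also have "\<dots> = nn_integral (distr lborel borel uminus) u" by (simp add: lborel_distr_uminus)
    also have "\<dots> = nn_integral lborel (\<lambda>t. u (- t))" by (intro nn_integral_distr) (use m in auto)
    also have "\<dots> \<le> nn_integral lborel (\<lambda>t. g (- t))" using u(2) by (intro nn_integral_mono) (auto simp: le_fun_def)
    finally show "integral\<^sup>S lborel u \<le> nn_integral lborel (\<lambda>t. g (- t))" .
  qed
  show ?thesis using le[of f] le[of "\<lambda>t. f (- t)"] by (intro antisym) auto
qed

text \<open>The speed may be unbounded at the break points. If its integral is finite then the derivative is integrable and the
  fundamental theorem of calculus applies; otherwise there is nothing to show.\<close>

lemma piecewise_C1_increment_le_length:
  fixes f :: "real \<Rightarrow> complex"
  assumes "a \<le> b" and f: "f piecewise_C1_differentiable_on {a..b}"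
  shows "ennreal (cmod (f b - f a)) \<le> (\<integral>\<^sup>+t\<in>{a..b}. ennreal (norm (vector_derivative f (at t))) \<partial>lborel)"
proof -
  obtain S where S: "finite S" "f C1_differentiable_on ({a..b} - S)" and cont: "continuous_on {a..b} f"
    using f by (auto simp: piecewise_C1_differentiable_on_def)
  let ?f' = "\<lambda>t. vector_derivative f (at t)"
  define J where "J = {a<..<b} - S"
  have J: "open J" "J \<subseteq> {a..b} - S" using S by (auto simp: J_def intro: open_Diff finite_imp_closed)
  have d: "(f has_vector_derivative ?f' x) (at x)" if "x \<in> J" for x
    using S(2) J that by (meson C1_differentiable_on_eq subsetD vector_derivative_works)
  have "continuous_on J ?f'"
    using S(2) J continuous_on_subset unfolding C1_differentiable_on_eq by blast
  then have m: "(\<lambda>t. indicator J t *\<^sub>R ?f' t) \<in> borel_measurable borel"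
    using J by (intro borel_measurable_continuous_on_indicator) auto
  show ?thesis
  proof (cases "(\<integral>\<^sup>+t\<in>{a..b}. ennreal (norm (?f' t)) \<partial>lborel) = \<infinity>")
    case False
    have le: "(\<integral>\<^sup>+t. ennreal (norm (indicator J t *\<^sub>R ?f' t)) \<partial>lborel) \<le> (\<integral>\<^sup>+t\<in>{a..b}. ennreal (norm (?f' t)) \<partial>lborel)"
      using J by (intro nn_integral_mono) (auto simp: indicator_def)
    then have int: "integrable lborel (\<lambda>t. indicator J t *\<^sub>R ?f' t)"
      using False m by (intro integrableI_bounded) (auto simp: top.not_eq_extremum)
    have "((\<lambda>t. indicator J t *\<^sub>R ?f' t) has_integral (LINT t|lborel. indicator J t *\<^sub>R ?f' t)) UNIV"
      by (rule has_integral_integral_lborel[OF int])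
    moreover have "(?f' has_integral (f b - f a)) {a..b}"
      using d by (intro fundamental_theorem_of_calculus_interior_strong[OF S(1) \<open>a \<le> b\<close> _ cont]) (auto simp: J_def)
    then have "((\<lambda>t. indicator J t *\<^sub>R ?f' t) has_integral (f b - f a)) {a..b}"
      by (rule has_integral_spike_finite[rotated 2, of _ _ _ "insert a (insert b S)"]) (use S in \<open>auto simp: J_def\<close>)
    then have "((\<lambda>t. indicator J t *\<^sub>R ?f' t) has_integral (f b - f a)) UNIV"
      by (rule has_integral_on_superset) (use J in \<open>auto simp: indicator_def\<close>)
    ultimately have "f b - f a = (LINT t|lborel. indicator J t *\<^sub>R ?f' t)" by (rule has_integral_unique[rotated])
    then have "ennreal (cmod (f b - f a)) \<le> (\<integral>\<^sup>+t. ennreal (norm (indicator J t *\<^sub>R ?f' t)) \<partial>lborel)"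
      using integral_norm_bound_ennreal[OF int] by simp
    with le show ?thesis by (rule order_trans[rotated])
  qed simp
qed

lemma ray_integral:
  "(\<integral>\<^sup>+t\<in>{0..<1}. ennreal ((1 - t) powr (- 5 / 6)) \<partial>lborel) \<le> ennreal 6"
proof -
  let ?f = "\<lambda>t::real. (1 - t) powr (- 5 / 6) * indicator {0..<1} t"
  have "((\<lambda>t. (1 - t) powr (- 5 / 6)) has_integral (- 6 * (1 - 1) powr (1 / 6) - (- 6 * (1 - 0) powr (1 / 6)))) {0..1::real}"
  proof (rule fundamental_theorem_of_calculus_interior)
    show "continuous_on {0..1} (\<lambda>t::real. - 6 * (1 - t) powr (1 / 6))"
      by (intro continuous_on_mult continuous_on_const continuous_on_powr' continuous_on_diff continuous_on_id) auto
    fix x :: real assume "x \<in> {0<..<1}"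
    then have "((\<lambda>t. - 6 * (1 - t) powr (1 / 6)) has_real_derivative - 6 * ((1 / 6) * (1 - x) powr (1 / 6 - 1) * (- 1))) (at x)"
      by (intro DERIV_cmult DERIV_fun_powr[where r = "1 / 6", simplified]) (auto intro!: derivative_eq_intros)
    then show "((\<lambda>t. - 6 * (1 - t) powr (1 / 6)) has_vector_derivative (1 - x) powr (- 5 / 6)) (at x)"
      by (simp add: has_real_derivative_iff_has_vector_derivative)
  qed simp
  then have "((\<lambda>t. (1 - t) powr (- 5 / 6)) has_integral 6) {0..1::real}" by simp
  then have "((\<lambda>t. ?f t) has_integral 6) {0..1}"
    by (rule has_integral_spike_finite[rotated 2, of _ _ _ "{1}"]) auto
  then have "((\<lambda>t. ?f t) has_integral 6) UNIV"
    by (rule has_integral_on_superset) (auto simp: indicator_def)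
  then have "nn_integral lborel (\<lambda>t. ennreal (?f t)) = ennreal 6"
    by (intro nn_integral_has_integral_lborel) auto
  moreover have "ennreal ((1 - t) powr (- 5 / 6)) * indicator {0..<1} t = ennreal (?f t)" for t :: real
    by (auto simp: indicator_def)
  ultimately show ?thesis by simp
qed

abbreviation speed :: "('a \<Rightarrow> complex) \<Rightarrow> ('a \<Rightarrow> complex) \<Rightarrow> (real \<Rightarrow> 'a) \<Rightarrow> real \<Rightarrow> real" where
  "speed F G \<gamma> t \<equiv> sqrt (2 * ((norm (vector_derivative (F \<circ> \<gamma>) (at t)))\<^sup>2 +
    (norm (vector_derivative (G \<circ> \<gamma>) (at t)))\<^sup>2))"

section \<open>Fronts in local coordinates\<close>

lemma wronskian_cong_ev:
  assumes "eventually (\<lambda>w. f w = f' w) (nhds z)" "eventually (\<lambda>w. g w = g' w) (nhds z)"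
  shows "wronskian f g z = wronskian f' g' z"
proof -
  have *: "deriv h z = deriv h' z \<and> deriv (deriv h) z = deriv (deriv h') z"
    if "eventually (\<lambda>w. h w = h' w) (nhds z)" for h h' :: "complex \<Rightarrow> complex"
  proof
    show "deriv h z = deriv h' z" using that by (rule deriv_cong_ev) simp
    have "eventually (\<lambda>w. eventually (\<lambda>w. h w = h' w) (nhds w)) (nhds z)"
      using that by (simp add: eventually_eventually)
    then have "eventually (\<lambda>w. deriv h w = deriv h' w) (nhds z)"
      by eventually_elim (rule deriv_cong_ev, simp_all)
    then show "deriv (deriv h) z = deriv (deriv h') z" by (rule deriv_cong_ev) simp
  qed
  show ?thesis unfolding wronskian_def using *[OF assms(1)] *[OF assms(2)] by simp
qed

definition energy :: "'a chart \<Rightarrow> ('a \<Rightarrow> complex) \<Rightarrow> ('a \<Rightarrow> complex) \<Rightarrow> complex \<Rightarrow> real" where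
  "energy c F G z = (cmod (deriv (coord_expr c F) z))\<^sup>2 + (cmod (deriv (coord_expr c G) z))\<^sup>2"

lemma metric_coeff_energy: "metric_coeff c F G z = 2 * energy c F G z"
  by (simp add: metric_coeff_def energy_def)

context riemann_surface
begin

lemma coord_expr_holomorphic:
  "holomorphic_fun \<A> F \<Longrightarrow> c \<in> \<A> \<Longrightarrow> coord_expr c F holomorphic_on coord_region c"
  by (simp add: holomorphic_fun_def)

lemma deriv_coord_expr_transition:
  assumes F: "holomorphic_fun \<A> F" and c: "c \<in> \<A>" "d \<in> \<A>" "p \<in> fst c \<inter> fst d"
  shows "deriv (coord_expr c F) (snd c p) =
    deriv (coord_expr d F) (snd d p) * deriv (coord_expr c (snd d)) (snd c p)"
proof -
  have "deriv (coord_expr c F) (snd c p) = deriv (coord_expr d F \<circ> coord_expr c (snd d)) (snd c p)"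
    by (intro deriv_cong_ev transition_coord_expr_ev c refl)
  also have "\<dots> = deriv (coord_expr d F) (coord_expr c (snd d) (snd c p)) * deriv (coord_expr c (snd d)) (snd c p)"
    using c by (intro deriv_comp[OF coord_expr_holomorphic[OF F] region_open transition_holomorphic overlap_open transition_image]) auto
  finally show ?thesis using c by (simp add: coord_expr_at)
qed

lemma wronskian_coord_expr_transition:
  assumes F: "holomorphic_fun \<A> F" "holomorphic_fun \<A> G" and c: "c \<in> \<A>" "d \<in> \<A>" "p \<in> fst c \<inter> fst d"
  shows "wronskian (coord_expr c F) (coord_expr c G) (snd c p) =
    wronskian (coord_expr d F) (coord_expr d G) (snd d p) * deriv (coord_expr c (snd d)) (snd c p) ^ 3"
proof -
  have "wronskian (coord_expr c F) (coord_expr c G) (snd c p) =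
      wronskian (coord_expr d F \<circ> coord_expr c (snd d)) (coord_expr d G \<circ> coord_expr c (snd d)) (snd c p)"
    by (intro wronskian_cong_ev transition_coord_expr_ev c refl)
  also have "\<dots> = wronskian (coord_expr d F) (coord_expr d G) (coord_expr c (snd d) (snd c p)) * deriv (coord_expr c (snd d)) (snd c p) ^ 3"
    using c by (intro wronskian_comp[OF coord_expr_holomorphic[OF F(1)] coord_expr_holomorphic[OF F(2)]
          region_open transition_holomorphic overlap_open transition_image]) auto
  finally show ?thesis using c by (simp add: coord_expr_at)
qed

lemma chart_at_in:
  assumes "p \<in> topspace X"
  shows "chart_at \<A> p \<in> \<A>" "p \<in> fst (chart_at \<A> p)"
  using someI_ex[of "\<lambda>c. c \<in> \<A> \<and> p \<in> fst c"] ex_chart[OF assms] unfolding chart_at_def by blast+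

lemma lagrangian_gauss_map_in_chart:
  assumes F: "holomorphic_fun \<A> F" "holomorphic_fun \<A> G" and c: "c \<in> \<A>" "p \<in> fst c"
  shows "lagrangian_gauss_map \<A> F G p = (if deriv (coord_expr c G) (snd c p) = 0 then None
    else Some (deriv (coord_expr c F) (snd c p) / deriv (coord_expr c G) (snd c p)))"
proof -
  let ?d = "chart_at \<A> p"
  have "p \<in> topspace X" using c chart_topspace by blast
  then have d: "?d \<in> \<A>" "p \<in> fst ?d \<inter> fst c" using chart_at_in c by auto
  show ?thesis
    unfolding lagrangian_gauss_map_def Let_def
    using deriv_coord_expr_transition[OF F(1) d(1) c(1) d(2)] deriv_coord_expr_transition[OF F(2) d(1) c(1) d(2)]
      transition_deriv_nonzero[OF d(1) c(1) d(2)] by simp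
qed

lemma value_form_nonzero_iff_omits:
  assumes F: "holomorphic_fun \<A> F" "holomorphic_fun \<A> G" and c: "c \<in> \<A>" "p \<in> fst c"
    and pos: "energy c F G (snd c p) > 0"
  shows "value_form \<alpha> (deriv (coord_expr c F) (snd c p)) (deriv (coord_expr c G) (snd c p)) \<noteq> 0 \<longleftrightarrow>
    lagrangian_gauss_map \<A> F G p \<noteq> \<alpha>"
proof -
  have "\<not> (deriv (coord_expr c F) (snd c p) = 0 \<and> deriv (coord_expr c G) (snd c p) = 0)"
    using pos by (auto simp: energy_def)
  then show ?thesis
    unfolding lagrangian_gauss_map_in_chart[OF F c] value_form_def by (auto split: option.splits simp: field_simps)
qed

text \<open>Both sides are computed in the chart that the definition of curvature selects and then moved to the chart \<open>c\<close>, where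
  the weights 6 of \<open>|W|\<^sup>2\<close> and of \<open>N\<^sup>3\<close> cancel.\<close>

lemma abs_gaussian_curvature:
  assumes F: "holomorphic_fun \<A> F" "holomorphic_fun \<A> G" and c: "c \<in> \<A>" "p \<in> fst c"
    and pos: "\<And>c z. c \<in> \<A> \<Longrightarrow> z \<in> coord_region c \<Longrightarrow> energy c F G z > 0"
  shows "\<bar>gaussian_curvature \<A> F G p\<bar> =
    (cmod (wronskian (coord_expr c F) (coord_expr c G) (snd c p)))\<^sup>2 / energy c F G (snd c p) ^ 3"
proof -
  define d where "d = chart_at \<A> p"
  have "p \<in> topspace X" using c chart_topspace by blast
  then have d: "d \<in> \<A>" "p \<in> fst d \<inter> fst c" using chart_at_in c by (auto simp: d_def)
  define z where "z = snd d p"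
  have z: "z \<in> coord_region d" using d by (auto simp: z_def intro: chart_in)
  define n where "n = energy d F G z"
  have n: "n > 0" using pos[OF d(1) z] by (simp add: n_def)
  have hol: "deriv (coord_expr d F) holomorphic_on coord_region d" "deriv (coord_expr d G) holomorphic_on coord_region d"
    using F d region_open[OF d(1)] by (auto intro!: holomorphic_deriv coord_expr_holomorphic)
  have "laplacian (\<lambda>w. ln (metric_coeff d F G w)) z = 4 * (cmod (wronskian (coord_expr d F) (coord_expr d G) z))\<^sup>2 / n\<^sup>2"
    unfolding metric_coeff_energy n_def energy_def wronskian_def
    using laplacian_ln_energy[OF hol region_open[OF d(1)] z] pos[OF d(1)] by (simp add: energy_def)
  then have "gaussian_curvature \<A> F G p = - (4 * (cmod (wronskian (coord_expr d F) (coord_expr d G) z))\<^sup>2 / n\<^sup>2) / (2 * (2 * n))"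
    by (simp add: gaussian_curvature_def Let_def metric_coeff_energy n_def flip: d_def z_def)
  also have "\<dots> = - ((cmod (wronskian (coord_expr d F) (coord_expr d G) z))\<^sup>2 / n ^ 3)"
    using n by (simp add: field_simps power2_eq_square power3_eq_cube)
  finally have K: "\<bar>gaussian_curvature \<A> F G p\<bar> = (cmod (wronskian (coord_expr d F) (coord_expr d G) z))\<^sup>2 / n ^ 3"
    using n by simp
  define u where "u = deriv (coord_expr d (snd c)) (snd d p)"
  have u: "u \<noteq> 0" unfolding u_def by (rule transition_deriv_nonzero[OF d(1) c(1) d(2)])
  have "n = energy c F G (snd c p) * (cmod u)\<^sup>2"
    unfolding n_def energy_def z_def
    using deriv_coord_expr_transition[OF F(1) d(1) c(1) d(2)] deriv_coord_expr_transition[OF F(2) d(1) c(1) d(2)]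
    by (simp add: u_def norm_mult power_mult_distrib distrib_right)
  moreover have "wronskian (coord_expr d F) (coord_expr d G) z = wronskian (coord_expr c F) (coord_expr c G) (snd c p) * u ^ 3"
    unfolding u_def z_def by (rule wronskian_coord_expr_transition[OF F d(1) c(1) d(2)])
  ultimately show ?thesis unfolding K using u
    by (simp add: norm_mult norm_power power_mult_distrib flip: power_mult)
qed

lemma integral_map_pullback:
  assumes \<Phi>: "integral_map X \<A> v S \<Phi>" "open S" and F: "holomorphic_fun \<A> F" "holomorphic_fun \<A> G"
    and c: "c \<in> \<A>" "\<zeta> \<in> S" "\<Phi> \<zeta> \<in> fst c"
  shows "deriv (F \<circ> \<Phi>) \<zeta> = deriv (coord_expr c F) (snd c (\<Phi> \<zeta>)) * v c (snd c (\<Phi> \<zeta>))"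
    and "wronskian (F \<circ> \<Phi>) (G \<circ> \<Phi>) \<zeta> = wronskian (coord_expr c F) (coord_expr c G) (snd c (\<Phi> \<zeta>)) * v c (snd c (\<Phi> \<zeta>)) ^ 3"
    and "(F \<circ> \<Phi>) field_differentiable at \<zeta>"
proof -
  define T where "T = {w \<in> S. \<Phi> w \<in> fst c}"
  have T: "open T" unfolding T_def
    using \<Phi> c chart_openin by (intro preimage_chart_open) (auto simp: integral_map_def)
  define h where "h = snd c \<circ> \<Phi>"
  have dh: "(h has_field_derivative v c (snd c (\<Phi> w))) (at w)" if "w \<in> T" for w
    using \<Phi>(1) c(1) that by (auto simp: integral_map_def T_def h_def)
  have h: "h holomorphic_on T"
    using dh by (auto simp: holomorphic_on_def field_differentiable_def intro: has_field_derivative_at_within)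
  have im: "h ` T \<subseteq> coord_region c" by (auto simp: T_def h_def intro: chart_in)
  have z: "\<zeta> \<in> T" using c by (simp add: T_def)
  have ev: "eventually (\<lambda>w. (f \<circ> \<Phi>) w = (coord_expr c f \<circ> h) w) (nhds \<zeta>)" for f :: "'a \<Rightarrow> complex"
    using eventually_nhds_in_open[OF T z] by eventually_elim (use c in \<open>auto simp: T_def h_def coord_expr_def\<close>)
  have hv: "deriv h \<zeta> = v c (snd c (\<Phi> \<zeta>))" using dh[OF z] by (rule DERIV_imp_deriv)
  have "deriv (F \<circ> \<Phi>) \<zeta> = deriv (coord_expr c F \<circ> h) \<zeta>" using ev by (rule deriv_cong_ev) simp
  also have "\<dots> = deriv (coord_expr c F) (h \<zeta>) * deriv h \<zeta>"
    by (rule deriv_comp[OF coord_expr_holomorphic[OF F(1) c(1)] region_open[OF c(1)] h T im z])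
  finally show "deriv (F \<circ> \<Phi>) \<zeta> = deriv (coord_expr c F) (snd c (\<Phi> \<zeta>)) * v c (snd c (\<Phi> \<zeta>))"
    by (simp add: hv) (simp add: h_def)
  have "wronskian (F \<circ> \<Phi>) (G \<circ> \<Phi>) \<zeta> = wronskian (coord_expr c F \<circ> h) (coord_expr c G \<circ> h) \<zeta>"
    by (intro wronskian_cong_ev ev)
  also have "\<dots> = wronskian (coord_expr c F) (coord_expr c G) (h \<zeta>) * deriv h \<zeta> ^ 3"
    by (rule wronskian_comp[OF coord_expr_holomorphic[OF F(1) c(1)] coord_expr_holomorphic[OF F(2) c(1)] region_open[OF c(1)] h T im z])
  finally show "wronskian (F \<circ> \<Phi>) (G \<circ> \<Phi>) \<zeta> = wronskian (coord_expr c F) (coord_expr c G) (snd c (\<Phi> \<zeta>)) * v c (snd c (\<Phi> \<zeta>)) ^ 3"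
    by (simp add: hv) (simp add: h_def)
  have "(coord_expr c F \<circ> h) holomorphic_on T"
    using h coord_expr_holomorphic[OF F(1) c(1)] im by (rule holomorphic_on_compose_gen)
  then have "(coord_expr c F \<circ> h) field_differentiable at \<zeta>" using T z by (rule holomorphic_on_imp_differentiable_at)
  then obtain D where "((coord_expr c F \<circ> h) has_field_derivative D) (at \<zeta>)" by (auto simp: field_differentiable_def)
  then have "((F \<circ> \<Phi>) has_field_derivative D) (at \<zeta>)" using DERIV_cong_ev[OF refl ev[of F] refl] by blast
  then show "(F \<circ> \<Phi>) field_differentiable at \<zeta>" by (auto simp: field_differentiable_def)
qed

text \<open>At a zero of the field the constant map is a solution, so by uniqueness a solution that starts off the zeros never
  reaches one.\<close>

lemma integral_map_nonconstant:
  assumes v: "vector_field \<A> v" and S: "open S" "connected S" "a \<in> S" and \<Phi>: "integral_map X \<A> v S \<Phi>"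
    and c: "c \<in> \<A>" "\<Phi> a \<in> fst c" "v c (snd c (\<Phi> a)) \<noteq> 0"
    and d: "\<zeta> \<in> S" "d \<in> \<A>" "\<Phi> \<zeta> \<in> fst d"
  shows "v d (snd d (\<Phi> \<zeta>)) \<noteq> 0"
proof
  assume 0: "v d (snd d (\<Phi> \<zeta>)) = 0"
  have top: "\<Phi> \<zeta> \<in> topspace X" using d chart_topspace by blast
  have "integral_map X \<A> v S (\<lambda>_. \<Phi> \<zeta>)"
  proof (rule integral_mapI[OF v S(1)])
    show "continuous_map (top_of_set S) X (\<lambda>_. \<Phi> \<zeta>)" using top by simp
    show "\<exists>c\<in>\<A>. \<Phi> \<zeta> \<in> fst c \<and> ((snd c \<circ> (\<lambda>_. \<Phi> \<zeta>)) has_field_derivative v c (snd c (\<Phi> \<zeta>))) (at w)" for w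
      using d 0 by (intro bexI[of _ d]) (auto simp: comp_def)
  qed
  from integral_map_unique[OF v S(1,2) d(1) \<Phi> this] have const: "\<Phi> w = \<Phi> \<zeta>" if "w \<in> S" for w using that by simp
  have "((snd c \<circ> \<Phi>) has_field_derivative v c (snd c (\<Phi> a))) (at a)" using \<Phi> c S by (auto simp: integral_map_def)
  moreover have "eventually (\<lambda>w. (snd c \<circ> \<Phi>) w = snd c (\<Phi> \<zeta>)) (nhds a)"
    using eventually_nhds_in_open[OF S(1,3)] by eventually_elim (simp add: const)
  ultimately have "((\<lambda>_. snd c (\<Phi> \<zeta>)) has_field_derivative v c (snd c (\<Phi> a))) (at a)"
    by (subst (asm) DERIV_cong_ev[OF refl _ refl]) auto
  then have "v c (snd c (\<Phi> a)) = 0" using DERIV_unique[OF _ DERIV_const] by blast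
  then show False using c by simp
qed

end

text \<open>The data of an improper affine front: the metric and the Gauss map do not involve \<open>\<psi>\<close> itself.\<close>

locale front_surface = riemann_surface X \<A> for X :: "'a topology" and \<A> +
  fixes F G :: "'a \<Rightarrow> complex"
  assumes holF: "holomorphic_fun \<A> F" and holG: "holomorphic_fun \<A> G"
    and energy_pos: "\<And>c z. c \<in> \<A> \<Longrightarrow> z \<in> coord_region c \<Longrightarrow> energy c F G z > 0"

lemma front_surfaceI:
  assumes "riemann_surface X \<A>" "improper_affine_front X \<A> F G \<psi>"
  shows "front_surface X \<A> F G"
  using assms unfolding front_surface_def front_surface_axioms_def improper_affine_front_def
  by (auto simp: metric_coeff_energy)

text \<open>Since \<open>dF\<close> and \<open>dG\<close> have no common zero, one of the two functions is a local coordinate at any given point.\<close>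

lemma (in front_surface) locally_injective_coordinate:
  assumes q: "q \<in> topspace X"
  obtains c H r where "c \<in> \<A>" "q \<in> fst c" "H = F \<or> H = G" "(r::real) > 0"
    "cball (snd c q) r \<subseteq> coord_region c" "inj_on (coord_expr c H) (cball (snd c q) r)"
proof -
  obtain c where c: "c \<in> \<A>" "q \<in> fst c" using ex_chart[OF q] by blast
  let ?z = "snd c q"
  have z: "?z \<in> coord_region c" using c by (intro chart_in)
  have "deriv (coord_expr c F) ?z \<noteq> 0 \<or> deriv (coord_expr c G) ?z \<noteq> 0"
    using energy_pos[OF c(1) z] by (auto simp: energy_def)
  then obtain H where H: "H = F \<or> H = G" "deriv (coord_expr c H) ?z \<noteq> 0" by blast
  have hol: "coord_expr c H holomorphic_on coord_region c"
    using H(1) holF holG c by (auto intro: coord_expr_holomorphic)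
  obtain r1 where r1: "r1 > 0" "inj_on (coord_expr c H) (ball ?z r1)"
    using has_complex_derivative_locally_injective[OF hol z region_open[OF c(1)]] H(2) by metis
  obtain r2 where r2: "r2 > 0" "cball ?z r2 \<subseteq> coord_region c"
    using region_open[OF c(1)] z open_contains_cball by blast
  show thesis
  proof (rule that[OF c H(1)])
    show "min (r1 / 2) r2 > 0" using r1 r2 by simp
    show "cball ?z (min (r1 / 2) r2) \<subseteq> coord_region c" using r2 by auto
    show "inj_on (coord_expr c H) (cball ?z (min (r1 / 2) r2))"
      by (rule inj_on_subset[OF r1(2)]) (use r1 in auto)
  qed
qed

section \<open>The curvature estimate\<close>

text \<open>The weights of numerator and denominator are 15 and 16, see \<open>weight_cancel\<close>.\<close>

definition wronskian_field ::
    "complex option set \<Rightarrow> ('a \<Rightarrow> complex) \<Rightarrow> ('a \<Rightarrow> complex) \<Rightarrow> 'a chart \<Rightarrow> complex \<Rightarrow> complex" where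
  "wronskian_field B F G c z =
    wronskian (coord_expr c F) (coord_expr c G) z ^ 5 /
    form_prod B (deriv (coord_expr c F) z) (deriv (coord_expr c G) z) ^ 4"

lemma form_prod_scale: "form_prod B (a * c) (b * c) = form_prod B a b * c ^ card B"
  by (simp add: form_prod_def value_form_scale prod.distrib)

lemma form_prod_holomorphic [holomorphic_intros]:
  assumes "a holomorphic_on S" "b holomorphic_on S"
  shows "(\<lambda>z. form_prod B (a z) (b z)) holomorphic_on S"
  unfolding form_prod_def by (intro holomorphic_intros assms)

lemma weight_cancel:
  fixes u w p :: complex
  assumes "u \<noteq> 0"
  shows "u * ((w * u ^ 3) ^ 5 / (p * u ^ 4) ^ 4) = w ^ 5 / p ^ 4"
proof -
  have "u * (w * u ^ 3) ^ 5 = w ^ 5 * u ^ 16"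
    by (simp add: power_mult_distrib numeral_eq_Suc mult_ac)
  moreover have "(p * u ^ 4) ^ 4 = p ^ 4 * u ^ 16" by (simp add: power_mult_distrib flip: power_mult)
  ultimately have "u * ((w * u ^ 3) ^ 5 / (p * u ^ 4) ^ 4) = w ^ 5 * u ^ 16 / (p ^ 4 * u ^ 16)"
    by (simp only: times_divide_eq_right)
  also have "\<dots> = w ^ 5 / p ^ 4" by (rule mult_divide_mult_cancel_right) (use assms in simp)
  finally show ?thesis .
qed

locale omitting_front = front_surface X \<A> F G
  for X :: "'a topology" and \<A> and F G :: "'a \<Rightarrow> complex" +
  fixes B :: "complex option set"
  assumes card_B: "card B = 4"
    and omits: "\<And>p. p \<in> topspace X \<Longrightarrow> lagrangian_gauss_map \<A> F G p \<notin> B"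
begin

lemma finite_B: "finite B"
  using card_B by (intro card_ge_0_finite) simp

lemma forms_nonzero:
  assumes "c \<in> \<A>" "p \<in> fst c" "\<alpha> \<in> B"
  shows "value_form \<alpha> (deriv (coord_expr c F) (snd c p)) (deriv (coord_expr c G) (snd c p)) \<noteq> 0"
  using value_form_nonzero_iff_omits[OF holF holG assms(1,2)] energy_pos[OF assms(1) chart_in[OF assms(2)]]
    omits[of p] chart_topspace[OF assms(1)] assms(2,3) by blast

lemma form_prod_nonzero:
  assumes "c \<in> \<A>" "p \<in> fst c"
  shows "form_prod B (deriv (coord_expr c F) (snd c p)) (deriv (coord_expr c G) (snd c p)) \<noteq> 0"
  using forms_nonzero[OF assms] finite_B by (simp add: form_prod_def)

lemma wronskian_vector_field: "vector_field \<A> (wronskian_field B F G)"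
  unfolding vector_field_def
proof (intro conjI ballI)
  fix c assume c: "c \<in> \<A>"
  have "deriv (coord_expr c H) holomorphic_on coord_region c \<and> deriv (deriv (coord_expr c H)) holomorphic_on coord_region c"
    if "holomorphic_fun \<A> H" for H
    using coord_expr_holomorphic[OF that c] region_open[OF c] by (auto intro!: holomorphic_deriv)
  note hol = this[OF holF] this[OF holG]
  have "form_prod B (deriv (coord_expr c F) z) (deriv (coord_expr c G) z) ^ 4 \<noteq> 0" if "z \<in> coord_region c" for z
    using form_prod_nonzero[OF c inv_in_chart[OF that]] chart_inv[OF that] by simp
  then show "wronskian_field B F G c holomorphic_on coord_region c"
    unfolding wronskian_field_def[abs_def] wronskian_def using hol
    by (intro holomorphic_on_divide holomorphic_on_power holomorphic_on_diff holomorphic_on_mult form_prod_holomorphic) blast+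
next
  fix c d p assume c: "c \<in> \<A>" and d: "d \<in> \<A>" and p: "p \<in> fst c \<inter> fst d"
  let ?u = "deriv (coord_expr c (snd d)) (snd c p)"
  have u: "?u \<noteq> 0" using transition_deriv_nonzero[OF c d p] .
  let ?W = "wronskian (coord_expr d F) (coord_expr d G) (snd d p)"
  let ?P = "form_prod B (deriv (coord_expr d F) (snd d p)) (deriv (coord_expr d G) (snd d p))"
  have "wronskian_field B F G c (snd c p) = (?W * ?u ^ 3) ^ 5 / (?P * ?u ^ 4) ^ 4"
    unfolding wronskian_field_def wronskian_coord_expr_transition[OF holF holG c d p]
      deriv_coord_expr_transition[OF holF c d p] deriv_coord_expr_transition[OF holG c d p] form_prod_scale card_B ..
  from weight_cancel[OF u, of ?W ?P, folded this]
  show "wronskian_field B F G d (snd d p) = ?u * wronskian_field B F G c (snd c p)"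
    by (simp only: wronskian_field_def)
qed

text \<open>In the flow coordinate the relation \<open>W\<^sup>5 = P\<^sup>4\<close> holds because \<open>V = W\<^sup>5 / P\<^sup>4\<close> is the derivative of the
  coordinate change: if \<open>W\<^sub>c\<close>, \<open>P\<^sub>c\<close> belong to a chart, then the new quantities are \<open>W\<^sub>c V\<^sup>3\<close> and \<open>P\<^sub>c V\<^sup>4\<close>.\<close>

lemma flow_disc:
  assumes \<Phi>: "integral_map X \<A> (wronskian_field B F G) (ball 0 R) \<Phi>" "R > 0"
    and c: "c \<in> \<A>" "\<Phi> 0 \<in> fst c" "wronskian (coord_expr c F) (coord_expr c G) (snd c (\<Phi> 0)) \<noteq> 0"
  defines "a \<equiv> deriv (F \<circ> \<Phi>)" and "b \<equiv> deriv (G \<circ> \<Phi>)"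
  shows "(F \<circ> \<Phi>) holomorphic_on ball 0 R" "(G \<circ> \<Phi>) holomorphic_on ball 0 R"
    and "\<And>\<zeta> \<alpha>. \<zeta> \<in> ball 0 R \<Longrightarrow> \<alpha> \<in> B \<Longrightarrow> value_form \<alpha> (a \<zeta>) (b \<zeta>) \<noteq> 0"
    and "\<And>\<zeta>. \<zeta> \<in> ball 0 R \<Longrightarrow> (a \<zeta> * deriv b \<zeta> - deriv a \<zeta> * b \<zeta>) ^ 5 = form_prod B (a \<zeta>) (b \<zeta>) ^ 4"
    and "\<bar>gaussian_curvature \<A> F G (\<Phi> 0)\<bar> = (cmod (a 0 * deriv b 0 - deriv a 0 * b 0))\<^sup>2 / ((cmod (a 0))\<^sup>2 + (cmod (b 0))\<^sup>2) ^ 3"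
    and "(cmod (a 0))\<^sup>2 + (cmod (b 0))\<^sup>2 > 0"
proof -
  let ?v = "wronskian_field B F G"
  have chart_ex: "\<exists>d\<in>\<A>. \<Phi> \<zeta> \<in> fst d" if "\<zeta> \<in> ball 0 R" for \<zeta>
    using \<Phi> that by (intro ex_chart) (auto simp: integral_map_def continuous_map_def)
  note pbF = integral_map_pullback[OF \<Phi>(1) open_ball holF holG]
  note pbG = integral_map_pullback[OF \<Phi>(1) open_ball holG holF]
  show "(F \<circ> \<Phi>) holomorphic_on ball 0 R" "(G \<circ> \<Phi>) holomorphic_on ball 0 R"
    using chart_ex pbF(3) pbG(3) unfolding holomorphic_on_def by (meson field_differentiable_at_within)+
  have v0: "?v c (snd c (\<Phi> 0)) \<noteq> 0"
    using c form_prod_nonzero[OF c(1,2)] by (simp add: wronskian_field_def)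
  have vnz: "?v d (snd d (\<Phi> \<zeta>)) \<noteq> 0" if "\<zeta> \<in> ball 0 R" "d \<in> \<A>" "\<Phi> \<zeta> \<in> fst d" for \<zeta> d
    using integral_map_nonconstant[OF wronskian_vector_field open_ball connected_ball _ \<Phi>(1) c(1,2) v0 that] \<Phi>(2) by simp
  show nz: "value_form \<alpha> (a \<zeta>) (b \<zeta>) \<noteq> 0" if z: "\<zeta> \<in> ball 0 R" and al: "\<alpha> \<in> B" for \<zeta> \<alpha>
  proof -
    obtain d where d: "d \<in> \<A>" "\<Phi> \<zeta> \<in> fst d" using chart_ex[OF z] by blast
    show ?thesis
      unfolding a_def b_def pbF(1)[OF d(1) z d(2)] pbG(1)[OF d(1) z d(2)] value_form_scale
      using forms_nonzero[OF d al] vnz[OF z d] by simp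
  qed
  show "(a \<zeta> * deriv b \<zeta> - deriv a \<zeta> * b \<zeta>) ^ 5 = form_prod B (a \<zeta>) (b \<zeta>) ^ 4" if z: "\<zeta> \<in> ball 0 R" for \<zeta>
  proof -
    obtain d where d: "d \<in> \<A>" "\<Phi> \<zeta> \<in> fst d" using chart_ex[OF z] by blast
    let ?V = "?v d (snd d (\<Phi> \<zeta>))"
    let ?P = "form_prod B (deriv (coord_expr d F) (snd d (\<Phi> \<zeta>))) (deriv (coord_expr d G) (snd d (\<Phi> \<zeta>)))"
    let ?W = "wronskian (coord_expr d F) (coord_expr d G) (snd d (\<Phi> \<zeta>))"
    have "a \<zeta> * deriv b \<zeta> - deriv a \<zeta> * b \<zeta> = ?W * ?V ^ 3"
      using pbF(2)[OF d(1) z d(2)] by (simp add: wronskian_def a_def b_def)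
    then have "(a \<zeta> * deriv b \<zeta> - deriv a \<zeta> * b \<zeta>) ^ 5 = ?W ^ 5 * ?V ^ 15"
      by (simp add: power_mult_distrib flip: power_mult)
    also have "?W ^ 5 = ?P ^ 4 * ?V" using form_prod_nonzero[OF d] by (simp add: wronskian_field_def)
    also have "?P ^ 4 * ?V * ?V ^ 15 = (?P * ?V ^ 4) ^ 4"
      by (simp add: power_mult_distrib flip: power_mult power_Suc)
    also have "?P * ?V ^ 4 = form_prod B (a \<zeta>) (b \<zeta>)"
      unfolding a_def b_def pbF(1)[OF d(1) z d(2)] pbG(1)[OF d(1) z d(2)] form_prod_scale card_B ..
    finally show ?thesis .
  qed
  have z: "0 \<in> ball 0 R" using \<Phi>(2) by simp
  let ?V = "?v c (snd c (\<Phi> 0))"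
  have W: "a 0 * deriv b 0 - deriv a 0 * b 0 = wronskian (coord_expr c F) (coord_expr c G) (snd c (\<Phi> 0)) * ?V ^ 3"
    using pbF(2)[OF c(1) z c(2)] by (simp add: wronskian_def a_def b_def)
  have N: "(cmod (a 0))\<^sup>2 + (cmod (b 0))\<^sup>2 = energy c F G (snd c (\<Phi> 0)) * (cmod ?V)\<^sup>2"
    unfolding a_def b_def pbF(1)[OF c(1) z c(2)] pbG(1)[OF c(1) z c(2)] energy_def
    by (simp add: norm_mult power_mult_distrib distrib_right)
  have K: "\<bar>gaussian_curvature \<A> F G (\<Phi> 0)\<bar> =
      (cmod (wronskian (coord_expr c F) (coord_expr c G) (snd c (\<Phi> 0))))\<^sup>2 / energy c F G (snd c (\<Phi> 0)) ^ 3"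
    by (rule abs_gaussian_curvature[OF holF holG c(1,2)]) (rule energy_pos)
  show "\<bar>gaussian_curvature \<A> F G (\<Phi> 0)\<bar> = (cmod (a 0 * deriv b 0 - deriv a 0 * b 0))\<^sup>2 / ((cmod (a 0))\<^sup>2 + (cmod (b 0))\<^sup>2) ^ 3"
    unfolding K N W
    using v0 by (simp add: norm_mult norm_power power_mult_distrib flip: power_mult)
  show "(cmod (a 0))\<^sup>2 + (cmod (b 0))\<^sup>2 > 0"
    unfolding N using energy_pos[OF c(1) chart_in[OF c(2)]] v0 by simp
qed

end

context omitting_front
begin

lemma flow_energy_bound:
  assumes \<Phi>: "integral_map X \<A> (wronskian_field B F G) (ball 0 R) \<Phi>" "R > 0"
    and c: "c \<in> \<A>" "\<Phi> 0 \<in> fst c" "wronskian (coord_expr c F) (coord_expr c G) (snd c (\<Phi> 0)) \<noteq> 0"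
    and C: "energy_const B C" and z: "\<zeta> \<in> ball 0 R"
  shows "(R - cmod \<zeta>) ^ 5 * ((cmod (deriv (F \<circ> \<Phi>) \<zeta>))\<^sup>2 + (cmod (deriv (G \<circ> \<Phi>) \<zeta>))\<^sup>2) ^ 3 \<le> C"
proof -
  note disc = flow_disc[OF \<Phi> c]
  have sub: "ball \<zeta> (R - cmod \<zeta>) \<subseteq> ball 0 R"
  proof
    fix w assume "w \<in> ball \<zeta> (R - cmod \<zeta>)"
    then show "w \<in> ball 0 R" using norm_triangle_sub[of w \<zeta>] by (simp add: dist_norm norm_minus_commute)
  qed
  have "deriv (F \<circ> \<Phi>) holomorphic_on ball \<zeta> (R - cmod \<zeta>)" "deriv (G \<circ> \<Phi>) holomorphic_on ball \<zeta> (R - cmod \<zeta>)"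
    using disc(1,2) sub by (auto intro!: holomorphic_deriv intro: holomorphic_on_subset)
  moreover have "0 < R - cmod \<zeta>" using z by simp
  moreover have "value_form \<epsilon> (deriv (F \<circ> \<Phi>) w) (deriv (G \<circ> \<Phi>) w) \<noteq> 0"
    if "w \<in> ball \<zeta> (R - cmod \<zeta>)" "\<epsilon> \<in> B" for w \<epsilon>
    by (rule disc(3)) (use that sub in auto)
  ultimately show ?thesis
    using energy_constD[OF C, of "R - cmod \<zeta>" "deriv (F \<circ> \<Phi>)" \<zeta> "deriv (G \<circ> \<Phi>)"] disc(4)[OF z] by blast
qed

text \<open>From \<open>|W|\<^sup>5 = |P|\<^sup>4\<close> and \<open>|P|\<^sup>2 \<le> k N\<^sup>4\<close> one gets \<open>|K|\<^sup>5 = |W|\<^sup>1\<^sup>0 / N\<^sup>1\<^sup>5 \<le> k\<^sup>4 N\<close>; the energy bound at the centre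
  controls \<open>N\<^sup>3\<close>.\<close>

lemma flow_curvature_bound:
  assumes \<Phi>: "integral_map X \<A> (wronskian_field B F G) (ball 0 R) \<Phi>" "R > 0"
    and c: "c \<in> \<A>" "\<Phi> 0 \<in> fst c" "wronskian (coord_expr c F) (coord_expr c G) (snd c (\<Phi> 0)) \<noteq> 0"
    and C: "energy_const B C" and k: "product_const B k"
  shows "R ^ 5 * \<bar>gaussian_curvature \<A> F G (\<Phi> 0)\<bar> ^ 15 \<le> k ^ 12 * C"
proof -
  note disc = flow_disc[OF \<Phi> c]
  define a b where "a = deriv (F \<circ> \<Phi>) 0" and "b = deriv (G \<circ> \<Phi>) 0"
  define N where "N = (cmod a)\<^sup>2 + (cmod b)\<^sup>2"
  define w where "w = cmod (deriv (F \<circ> \<Phi>) 0 * deriv (deriv (G \<circ> \<Phi>)) 0 - deriv (deriv (F \<circ> \<Phi>)) 0 * deriv (G \<circ> \<Phi>) 0)"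
  have z: "0 \<in> ball 0 R" using \<Phi> by simp
  have N: "N > 0" using disc(6) by (simp add: N_def a_def b_def)
  have K: "\<bar>gaussian_curvature \<A> F G (\<Phi> 0)\<bar> = w\<^sup>2 / N ^ 3" using disc(5) by (simp add: N_def a_def b_def w_def)
  have "w ^ 5 = cmod (form_prod B a b) ^ 4"
    using arg_cong[OF disc(4)[OF z], of cmod] by (simp add: norm_power w_def a_def b_def)
  then have "(w ^ 5) ^ 2 = ((cmod (form_prod B a b))\<^sup>2) ^ 4" by (simp flip: power_mult)
  also have "\<dots> \<le> (k * N ^ 4) ^ 4" using k by (intro power_mono) (auto simp: product_const_def N_def)
  finally have w: "(w ^ 5) ^ 2 \<le> (k * N ^ 4) ^ 4" .
  have "(w\<^sup>2 / N ^ 3) ^ 5 = (w ^ 5) ^ 2 / N ^ 15" by (simp add: power_divide flip: power_mult)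
  also have "\<dots> \<le> (k * N ^ 4) ^ 4 / N ^ 15" using w N by (intro divide_right_mono) auto
  also have "\<dots> = k ^ 4 * (N * N ^ 15) / N ^ 15" by (simp add: power_mult_distrib flip: power_mult power_Suc)
  also have "\<dots> = k ^ 4 * N" using N by simp
  finally have "((w\<^sup>2 / N ^ 3) ^ 5) ^ 3 \<le> (k ^ 4 * N) ^ 3" using N by (intro power_mono) auto
  then have "(w\<^sup>2 / N ^ 3) ^ 15 \<le> k ^ 12 * N ^ 3" by (simp add: power_mult_distrib flip: power_mult)
  then have "R ^ 5 * (w\<^sup>2 / N ^ 3) ^ 15 \<le> R ^ 5 * (k ^ 12 * N ^ 3)" using \<Phi>(2) by (intro mult_left_mono) auto
  also have "\<dots> = k ^ 12 * (R ^ 5 * N ^ 3)" by simp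
  also have "\<dots> \<le> k ^ 12 * C"
    using flow_energy_bound[OF \<Phi> c C z] k by (intro mult_left_mono) (auto simp: N_def a_def b_def product_const_def)
  finally show ?thesis by (simp add: K)
qed

end

text \<open>The energy bound as a bound for the speed of a radius: its sixth power is at most \<open>8 C R / (1 - t)\<^sup>5\<close>, and the sixth
  root of \<open>(1 - t)\<^sup>-\<^sup>5\<close> is integrable.\<close>

lemma sixth_root_bound:
  fixes N R C t :: real
  assumes N: "N \<ge> 0" and R: "R > 0" and C: "C > 0" and t: "t < 1" and le: "(R - t * R) ^ 5 * N ^ 3 \<le> C"
  shows "sqrt (2 * N) * R \<le> (8 * C * R) powr (1 / 6) * (1 - t) powr (- 5 / 6)"
proof (rule power_le_imp_le_base[of _ 5])
  have s: "(1 - t) ^ 5 > 0" using t by simp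
  have "(sqrt (2 * N) * R) ^ Suc 5 = (sqrt (2 * N) ^ 2) ^ 3 * R ^ 6"
    by (simp only: power_mult_distrib flip: power_mult) simp
  also have "\<dots> = 8 * (R ^ 5 * N ^ 3) * R" using N by (simp add: power_mult_distrib mult_ac flip: power_Suc)
  also have "R ^ 5 * N ^ 3 = (R - t * R) ^ 5 * N ^ 3 / (1 - t) ^ 5"
  proof -
    have "R - t * R = R * (1 - t)" by (simp add: algebra_simps)
    then show ?thesis using s by (simp add: power_mult_distrib)
  qed
  also have "8 * ((R - t * R) ^ 5 * N ^ 3 / (1 - t) ^ 5) * R \<le> 8 * (C / (1 - t) ^ 5) * R"
    using le s R by (intro mult_right_mono mult_left_mono divide_right_mono) auto
  also have "\<dots> = ((8 * C * R) powr (1 / 6)) ^ 6 * ((1 - t) powr (- 5 / 6)) ^ 6"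
  proof -
    have "((8 * C * R) powr (1 / 6)) ^ 6 = 8 * C * R" using C R by (simp add: powr_power)
    moreover have "((1 - t) powr (- 5 / 6)) ^ 6 = (1 - t) powr (- 5)" using t by (simp add: powr_power)
    moreover have "\<dots> = 1 / (1 - t) ^ 5" using t by (simp add: powr_minus_divide)
    ultimately show ?thesis by simp
  qed
  also have "\<dots> = ((8 * C * R) powr (1 / 6) * (1 - t) powr (- 5 / 6)) ^ Suc 5" by (simp add: power_mult_distrib)
  finally show "(sqrt (2 * N) * R) ^ Suc 5 \<le> ((8 * C * R) powr (1 / 6) * (1 - t) powr (- 5 / 6)) ^ Suc 5" .
qed simp

context omitting_front
begin

text \<open>The integral of \<open>(1 - t)\<^sup>-\<^sup>5\<^sup>/\<^sup>6\<close> over the unit interval is 6.\<close>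

lemma flow_ray:
  assumes \<Phi>: "integral_map X \<A> (wronskian_field B F G) (ball 0 R) \<Phi>" "R > 0"
    and c: "c \<in> \<A>" "\<Phi> 0 \<in> fst c" "wronskian (coord_expr c F) (coord_expr c G) (snd c (\<Phi> 0)) \<noteq> 0"
    and C: "energy_const B C" and b: "cmod b = R"
  defines "\<gamma> \<equiv> \<lambda>t. \<Phi> (of_real t * b)"
  shows "piecewise_C1_curve X \<A> {0..<1} \<gamma>"
    and "curve_length F G {0..<1} \<gamma> \<le> ennreal (6 * (8 * C * R) powr (1 / 6))"
proof -
  note disc = flow_disc[OF \<Phi> c]
  let ?P = "\<lambda>t. of_real t * b"
  have P: "(?P has_vector_derivative b) (at t)" for t
    by (auto intro!: derivative_eq_intros has_vector_derivative_real_field)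
  have Pin: "?P t \<in> ball 0 R" if "t \<in> {0..<1}" for t
    using that b \<Phi>(2) by (simp add: norm_mult)
  show "piecewise_C1_curve X \<A> {0..<1} \<gamma>"
    unfolding piecewise_C1_curve_def
  proof (intro conjI allI ballI, goal_cases)
    case 1
    have "continuous_map (top_of_set {0..<1}) (top_of_set (ball 0 R)) ?P"
      using Pin by (auto intro!: continuous_intros)
    then have "continuous_map (top_of_set {0..<1}) X (\<Phi> \<circ> ?P)"
      using \<Phi> by (intro continuous_map_compose) (auto simp: integral_map_def)
    then show ?case by (simp add: \<gamma>_def comp_def)
  next
    case (2 s e d)
    show ?case
    proof (clarify, goal_cases)
      case (1 U \<phi>)
      then have dA: "(U, \<phi>) \<in> \<A>" using 2 by simp
      define D where "D = (\<lambda>t. b * wronskian_field B F G (U, \<phi>) (\<phi> (\<gamma> t)))"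
      have der: "((\<phi> \<circ> \<gamma>) has_vector_derivative D t) (at t)" if t: "t \<in> {s..e}" for t
      proof -
        have "?P t \<in> ball 0 R" "\<Phi> (?P t) \<in> U" using 1 t Pin by (auto simp: \<gamma>_def)
        then have "((\<phi> \<circ> \<Phi>) has_field_derivative wronskian_field B F G (U, \<phi>) (\<phi> (\<Phi> (?P t)))) (at (?P t))"
          using \<Phi>(1) dA unfolding integral_map_def by fastforce
        from field_vector_diff_chain_at[OF P this] show ?thesis by (simp add: \<gamma>_def D_def comp_def)
      qed
      then have "continuous_on {s..e} (\<phi> \<circ> \<gamma>)"
        by (meson continuous_at_imp_continuous_on has_vector_derivative_continuous)
      moreover have "continuous_on (coord_region (U, \<phi>)) (wronskian_field B F G (U, \<phi>))"
        using wronskian_vector_field dA by (auto simp: vector_field_def intro: holomorphic_on_imp_continuous_on)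
      moreover have "(\<phi> \<circ> \<gamma>) ` {s..e} \<subseteq> coord_region (U, \<phi>)" using 1 by (auto simp: coord_region_def)
      ultimately have "continuous_on {s..e} D"
        unfolding D_def using continuous_on_compose2[of "coord_region (U, \<phi>)" "wronskian_field B F G (U, \<phi>)" "{s..e}" "\<phi> \<circ> \<gamma>"]
        by (auto intro!: continuous_intros)
      with der have "(\<phi> \<circ> \<gamma>) C1_differentiable_on {s..e}" unfolding C1_differentiable_on_def by blast
      then show ?case by (rule C1_differentiable_imp_piecewise)
    qed
  qed
  let ?M = "(8 * C * R) powr (1 / 6)"
  have vd: "vector_derivative (H \<circ> \<gamma>) (at t) = b * deriv (H \<circ> \<Phi>) (?P t)"
    if "(H \<circ> \<Phi>) holomorphic_on ball 0 R" "t \<in> {0..<1}" for H :: "'a \<Rightarrow> complex" and t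
    using field_vector_diff_chain_at[OF P holomorphic_derivI[OF that(1) open_ball Pin[OF that(2)]]]
    by (intro vector_derivative_at) (simp add: \<gamma>_def comp_def)
  have le: "speed F G \<gamma> t
     \<le> ?M * (1 - t) powr (- 5 / 6)" if t: "t \<in> {0..<1}" for t
  proof -
    let ?N = "(cmod (deriv (F \<circ> \<Phi>) (?P t)))\<^sup>2 + (cmod (deriv (G \<circ> \<Phi>) (?P t)))\<^sup>2"
    have "speed F G \<gamma> t =
      sqrt (2 * ?N * R\<^sup>2)"
      unfolding vd[OF disc(1) t] vd[OF disc(2) t] using b by (simp add: norm_mult power_mult_distrib algebra_simps)
    also have "\<dots> = sqrt (2 * ?N) * R" using \<Phi>(2) by (simp add: real_sqrt_mult)
    also have "\<dots> \<le> ?M * (1 - t) powr (- 5 / 6)"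
    proof (rule sixth_root_bound)
      show "(R - t * R) ^ 5 * ?N ^ 3 \<le> C"
        using flow_energy_bound[OF \<Phi> c C Pin[OF t]] b t by (simp add: norm_mult)
    qed (use C \<Phi>(2) t in \<open>auto simp: energy_const_def\<close>)
    finally show ?thesis .
  qed
  have "curve_length F G {0..<1} \<gamma> \<le> (\<integral>\<^sup>+t. ennreal ?M * (ennreal ((1 - t) powr (- 5 / 6)) * indicator {0..<1} t) \<partial>lborel)"
    unfolding curve_length_def
  proof (rule nn_integral_mono)
    fix t :: real
    show "ennreal (speed F G \<gamma> t) * indicator {0..<1} t
      \<le> ennreal ?M * (ennreal ((1 - t) powr (- 5 / 6)) * indicator {0..<1} t)"
    proof (cases "t \<in> {0..<1}")
      case True
      then show ?thesis using ennreal_leI[OF le[OF True]] by (simp add: ennreal_mult)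
    qed simp
  qed
  also have "\<dots> = ennreal ?M * (\<integral>\<^sup>+t\<in>{0..<1}. ennreal ((1 - t) powr (- 5 / 6)) \<partial>lborel)"
    by (intro nn_integral_cmult) auto
  also have "\<dots> \<le> ennreal ?M * ennreal 6" by (intro mult_left_mono ray_integral) auto
  also have "\<dots> = ennreal (?M * 6)" by (rule ennreal_mult[symmetric]) auto
  also have "?M * 6 = 6 * ?M" by (rule mult.commute)
  finally show "curve_length F G {0..<1} \<gamma> \<le> ennreal (6 * ?M)" .
qed

end

lemma ennreal_divide_antimono:
  fixes a b c :: ennreal
  assumes "b \<le> c"
  shows "a / c \<le> a / b"
proof -
  have "inverse c \<le> inverse b"
  proof (cases c)
    case (real y)
    then obtain x where x: "b = ennreal x" "0 \<le> x" "x \<le> y" using assms by (cases b) (auto simp: top_unique)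
    then show ?thesis using real by (cases "x = 0") (simp_all add: inverse_ennreal le_imp_inverse_le ennreal_leI)
  qed simp
  then show ?thesis unfolding divide_ennreal_def by (intro mult_left_mono) auto
qed

lemma ennreal_le_divideI:
  assumes "s \<ge> 0" "L > 0" "s * L \<le> C" "d \<le> ennreal L"
  shows "ennreal s \<le> ennreal C / d"
proof -
  have "s \<le> C / L" using assms by (simp add: field_simps)
  then have "ennreal s \<le> ennreal (C / L)" by (rule ennreal_leI)
  also have "\<dots> = ennreal C / ennreal L"
    using assms mult_nonneg_nonneg[of s L] by (intro divide_ennreal[symmetric]) linarith+
  also have "\<dots> \<le> ennreal C / d"
    using assms(4) by (rule ennreal_divide_antimono)
  finally show ?thesis .
qed

lemma thirtieth_root_bound:
  fixes K R M :: real
  assumes K: "K \<ge> 0" and R: "R > 0" and M: "M > 0" and le: "R ^ 5 * K ^ 15 \<le> M"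
  shows "sqrt K \<le> (M / R ^ 5) powr (1 / 30)"
proof (rule power_le_imp_le_base[of _ 29])
  have "sqrt K ^ Suc 29 = (sqrt K ^ 2) ^ 15" by (simp only: flip: power_mult) simp
  also have "\<dots> = K ^ 15" using K by simp
  also have "\<dots> \<le> M / R ^ 5" using le R by (simp add: field_simps)
  also have "\<dots> = ((M / R ^ 5) powr (1 / 30)) ^ Suc 29" using R M by (simp add: powr_power del: power_Suc)
  finally show "sqrt K ^ Suc 29 \<le> ((M / R ^ 5) powr (1 / 30)) ^ Suc 29" .
qed simp

context omitting_front
begin

text \<open>The bounds for the curvature and for the length of the divergent radius carry the factors \<open>R\<^sup>-\<^sup>1\<^sup>/\<^sup>6\<close> and \<open>R\<^sup>1\<^sup>/\<^sup>6\<close>,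
  which cancel in the product. Where the Wronskian vanishes, and where flow discs of all radii exist, the curvature is 0.\<close>

lemma curvature_le_const_over_distance:
  assumes C: "energy_const B C" and k: "product_const B k" and p: "p \<in> topspace X"
  shows "ennreal (sqrt \<bar>gaussian_curvature \<A> F G p\<bar>) \<le>
    ennreal (6 * (8 * C) powr (1 / 6) * (k ^ 12 * C) powr (1 / 30)) / boundary_dist X \<A> F G p"
proof -
  obtain c where c: "c \<in> \<A>" "p \<in> fst c" using ex_chart[OF p] by blast
  have pos: "C > 0" "k > 0" "k ^ 12 * C > 0" using C k by (auto simp: energy_const_def product_const_def)
  let ?K = "\<bar>gaussian_curvature \<A> F G p\<bar>"
  consider (flat) "?K = 0" | (curved) "wronskian (coord_expr c F) (coord_expr c G) (snd c p) \<noteq> 0"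
    using abs_gaussian_curvature[OF holF holG c energy_pos] by fastforce
  then show ?thesis
  proof cases
    case flat
    then show ?thesis by simp
  next
    case curved
    have Kb: "R ^ 5 * ?K ^ 15 \<le> k ^ 12 * C"
      if "R > 0" "integral_map X \<A> (wronskian_field B F G) (ball 0 R) \<Phi>" "\<Phi> 0 = p" for R \<Phi>
      using flow_curvature_bound[OF that(2,1) c(1) _ _ C k] that c curved by simp
    show ?thesis
    proof (rule integral_map_maximal[OF wronskian_vector_field p])
      assume ex: "\<And>r::real. r > 0 \<Longrightarrow> \<exists>\<Phi>. integral_map X \<A> (wronskian_field B F G) (ball 0 r) \<Phi> \<and> \<Phi> 0 = p"
      have "?K = 0"
      proof (rule ccontr)
        assume "?K \<noteq> 0"
        then have K: "?K ^ 15 > 0" by simp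
        \<comment> \<open>So large that \<open>R\<^sup>5 |K|\<^sup>1\<^sup>5 \<ge> R |K|\<^sup>1\<^sup>5\<close> exceeds the bound on flow discs.\<close>
        define R where "R = max 1 ((k ^ 12 * C + 1) / ?K ^ 15)"
        have R: "R \<ge> 1" "(k ^ 12 * C + 1) / ?K ^ 15 \<le> R" by (auto simp: R_def)
        have "k ^ 12 * C + 1 \<le> R * ?K ^ 15" using R(2) K by (simp add: pos_divide_le_eq)
        also have "\<dots> \<le> R ^ 5 * ?K ^ 15"
          using R K power_increasing[of 1 5 R] by (intro mult_right_mono) auto
        also have "\<dots> \<le> k ^ 12 * C" using ex[of R] R Kb[of R] by auto
        finally show False by simp
      qed
      then show ?thesis by simp
    next
      fix R \<Phi> b
      assume R: "(R::real) > 0" and \<Phi>: "integral_map X \<A> (wronskian_field B F G) (ball 0 R) \<Phi>" "\<Phi> 0 = p"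
        and b: "cmod b = R" and dv: "divergent_curve X (\<lambda>t. \<Phi> (of_real t * b))"
      let ?\<gamma> = "\<lambda>t. \<Phi> (of_real t * b)"
      have c': "\<Phi> 0 \<in> fst c" "wronskian (coord_expr c F) (coord_expr c G) (snd c (\<Phi> 0)) \<noteq> 0"
        using \<Phi>(2) c(2) curved by auto
      note ray = flow_ray[OF \<Phi>(1) R c(1) c' C b]
      have "boundary_dist X \<A> F G p \<le> curve_length F G {0..<1} ?\<gamma>"
        unfolding boundary_dist_def using ray(1) dv \<Phi>(2) by (intro Inf_lower) auto
      also note ray(2)
      finally have d: "boundary_dist X \<A> F G p \<le> ennreal (6 * (8 * C * R) powr (1 / 6))" .
      have s: "sqrt ?K \<le> (k ^ 12 * C / R ^ 5) powr (1 / 30)"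
        using Kb[OF R \<Phi>] pos R by (intro thirtieth_root_bound) auto
      have "R ^ 5 = R powr 5" using R by simp
      then have "(R ^ 5) powr (1 / 30) = R powr (1 / 6)" by (simp add: powr_powr)
      then have e: "(k ^ 12 * C / R ^ 5) powr (1 / 30) = (k ^ 12 * C) powr (1 / 30) / R powr (1 / 6)"
        using pos R by (simp add: powr_divide)
      have e2: "(8 * C * R) powr (1 / 6) = (8 * C) powr (1 / 6) * R powr (1 / 6)"
        using pos R by (intro powr_mult)
      have "sqrt ?K * (6 * (8 * C * R) powr (1 / 6)) \<le>
          (k ^ 12 * C) powr (1 / 30) / R powr (1 / 6) * (6 * ((8 * C) powr (1 / 6) * R powr (1 / 6)))"
        using s unfolding e e2 by (intro mult_right_mono) auto
      also have "\<dots> = 6 * (8 * C) powr (1 / 6) * (k ^ 12 * C) powr (1 / 30)"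
        using R by simp
      finally have bound: "sqrt ?K * (6 * (8 * C * R) powr (1 / 6)) \<le> 6 * (8 * C) powr (1 / 6) * (k ^ 12 * C) powr (1 / 30)" .
      show ?thesis
        by (rule ennreal_le_divideI[OF _ _ bound d]) (use R pos in auto)
    qed
  qed
qed

end

text \<open>Four of the omitted values determine the constant; the type of points is arbitrary.\<close>

theorem curvature_estimate_exists:
  fixes A :: "complex option set"
  assumes "finite A" "card A > 3"
  shows "\<exists>C>0. curvature_estimate TYPE('a) A C"
proof -
  obtain B where B: "B \<subseteq> A" "card B = 4" using obtain_subset_with_card_n[of 4 A] assms by auto
  obtain C where C: "energy_const B C" by (rule energy_bound[OF B(2)])
  obtain k where k: "product_const B k" by (rule form_prod_bound[OF B(2)])
  let ?C = "6 * (8 * C) powr (1 / 6) * (k ^ 12 * C) powr (1 / 30)"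
  have "curvature_estimate TYPE('a) A ?C"
    unfolding curvature_estimate_def
  proof (intro allI impI ballI)
    fix X :: "'a topology" and \<A> F G \<psi> p
    assume X: "riemann_surface X \<A>" and \<psi>: "improper_affine_front X \<A> F G \<psi>"
      and om: "lagrangian_gauss_map \<A> F G ` topspace X \<inter> A = {}" and p: "p \<in> topspace X"
    interpret front_surface X \<A> F G by (rule front_surfaceI[OF X \<psi>])
    interpret omitting_front X \<A> F G B by unfold_locales (use om B in auto)
    show "ennreal (sqrt \<bar>gaussian_curvature \<A> F G p\<bar>) \<le> ennreal ?C / boundary_dist X \<A> F G p"
      by (rule curvature_le_const_over_distance[OF C k p])
  qed
  moreover have "?C > 0" using C k by (auto simp: energy_const_def product_const_def)
  ultimately show ?thesis by blast
qed

section \<open>Complete fronts\<close>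

text \<open>Where the curve is not differentiable, both sides are the norm of the same unspecified value.\<close>

lemma norm_vector_derivative_reflect:
  fixes f :: "real \<Rightarrow> 'b::real_normed_vector"
  shows "norm (vector_derivative (\<lambda>t. f (- t)) (at t)) = norm (vector_derivative f (at (- t)))"
proof (cases "\<exists>D. (f has_vector_derivative D) (at (- t))")
  case True
  then obtain D where D: "(f has_vector_derivative D) (at (- t))" ..
  have "(uminus has_vector_derivative (- 1)) (at t)"
    by (auto intro!: derivative_eq_intros)
  from vector_diff_chain_at[OF this, of f D] D
  have "((\<lambda>t. f (- t)) has_vector_derivative - D) (at t)" by (simp add: comp_def)
  then show ?thesis using D by (simp add: vector_derivative_at)
next
  case False
  have "\<nexists>D. ((\<lambda>t. f (- t)) has_vector_derivative D) (at t)"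
  proof
    assume "\<exists>D. ((\<lambda>t. f (- t)) has_vector_derivative D) (at t)"
    then obtain D where D: "((\<lambda>t. f (- t)) has_vector_derivative D) (at t)" ..
    have "(uminus has_vector_derivative (- 1)) (at (- t))"
      by (auto intro!: derivative_eq_intros)
    from vector_diff_chain_at[OF this, of "\<lambda>t. f (- t)" D] D
    have "(f has_vector_derivative - D) (at (- t))" by (simp add: comp_def)
    then show False using False by blast
  qed
  then show ?thesis using False by (simp add: vector_derivative_def)
qed

lemma piecewise_C1_curve_subset:
  assumes "piecewise_C1_curve X \<A> I \<gamma>" "J \<subseteq> I"
  shows "piecewise_C1_curve X \<A> J \<gamma>"
  unfolding piecewise_C1_curve_def
proof (intro conjI allI ballI, goal_cases)
  case 1
  show ?case using assms continuous_map_from_subtopology_mono unfolding piecewise_C1_curve_def by blast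
next
  case (2 a b c)
  then show ?case using assms unfolding piecewise_C1_curve_def by blast
qed

lemma piecewise_C1_curve_reverse:
  assumes \<gamma>: "piecewise_C1_curve X \<A> {a..b} \<gamma>"
  shows "piecewise_C1_curve X \<A> {- b..- a} (\<lambda>t. \<gamma> (- t))"
  unfolding piecewise_C1_curve_def
proof (intro conjI allI ballI, goal_cases)
  case 1
  have "continuous_map (top_of_set {- b..- a}) (top_of_set {a..b}) uminus"
    by (auto intro!: continuous_intros)
  then have "continuous_map (top_of_set {- b..- a}) X (\<gamma> \<circ> uminus)"
    using \<gamma> by (intro continuous_map_compose) (auto simp: piecewise_C1_curve_def)
  then show ?case by (simp add: comp_def)
next
  case (2 s e d)
  show ?case
  proof (clarify, goal_cases)
    case (1 U \<phi>)
    have im: "uminus ` {s..e} = {- e..- s}" by simp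
    have "\<gamma> ` {- e..- s} \<subseteq> U"
    proof (rule image_subsetI)
      fix x assume "x \<in> {- e..- s}"
      then have "- x \<in> {s..e}" by auto
      then have "\<gamma> (- (- x)) \<in> U" using 1 by blast
      then show "\<gamma> x \<in> U" by simp
    qed
    moreover have "{- e..- s} \<subseteq> {a..b}"
    proof
      fix x assume "x \<in> {- e..- s}"
      then have "- x \<in> {s..e}" by auto
      then have "- x \<in> {- b..- a}" using 1 by blast
      then show "x \<in> {a..b}" by auto
    qed
    ultimately have "(\<phi> \<circ> \<gamma>) piecewise_C1_differentiable_on {- e..- s}"
      using \<gamma> 1 2 unfolding piecewise_C1_curve_def by blast
    moreover have "uminus C1_differentiable_on {s..e}"
      unfolding C1_differentiable_on_def by (intro exI[of _ "\<lambda>_. -1"]) (auto intro!: derivative_eq_intros)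
    then have "uminus piecewise_C1_differentiable_on {s..e}" by (rule C1_differentiable_imp_piecewise)
    moreover have "finite ({s..e} \<inter> uminus -` {x})" for x :: real
      by (rule finite_subset[of _ "{- x}"]) auto
    ultimately have "((\<phi> \<circ> \<gamma>) \<circ> uminus) piecewise_C1_differentiable_on {s..e}"
      by (intro piecewise_C1_differentiable_compose) (simp_all only: im)
    then show ?case by (simp add: comp_def)
  qed
qed

lemma curve_length_reverse:
  "curve_length F G {- b..- a} (\<lambda>t. \<gamma> (- t)) = curve_length F G {a..b} \<gamma>"
proof -
  let ?g = "\<lambda>t. ennreal (speed F G \<gamma> t) * indicator {a..b} t"
  have *: "H \<circ> (\<lambda>t. \<gamma> (- t)) = (\<lambda>t. (H \<circ> \<gamma>) (- t))" for H :: "'a \<Rightarrow> complex" by auto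
  have "curve_length F G {- b..- a} (\<lambda>t. \<gamma> (- t)) = nn_integral lborel (\<lambda>t. ?g (- t))"
    unfolding curve_length_def * norm_vector_derivative_reflect
    by (intro nn_integral_cong) (auto simp: indicator_def)
  also have "\<dots> = nn_integral lborel ?g" by (rule nn_integral_reflect)
  finally show ?thesis by (simp add: curve_length_def)
qed

lemma geodesic_dist_le_length:
  assumes "piecewise_C1_curve X \<A> I \<gamma>" "{a..b} \<subseteq> I" "a \<le> b"
  shows "geodesic_dist X \<A> F G (\<gamma> a) (\<gamma> b) \<le> curve_length F G {a..b} \<gamma>"
    and "geodesic_dist X \<A> F G (\<gamma> b) (\<gamma> a) \<le> curve_length F G {a..b} \<gamma>"
proof -
  have sub: "piecewise_C1_curve X \<A> {a..b} \<gamma>" using assms piecewise_C1_curve_subset by blast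
  then show "geodesic_dist X \<A> F G (\<gamma> a) (\<gamma> b) \<le> curve_length F G {a..b} \<gamma>"
    unfolding geodesic_dist_def using assms(3) by (intro Inf_lower) blast
  have "geodesic_dist X \<A> F G (\<gamma> b) (\<gamma> a) \<le> curve_length F G {- b..- a} (\<lambda>t. \<gamma> (- t))"
    unfolding geodesic_dist_def using assms(3) piecewise_C1_curve_reverse[OF sub]
    by (intro Inf_lower CollectI exI[of _ "- b"] exI[of _ "- a"] exI[of _ "\<lambda>t. \<gamma> (- t)"]) auto
  then show "geodesic_dist X \<A> F G (\<gamma> b) (\<gamma> a) \<le> curve_length F G {a..b} \<gamma>"
    by (simp add: curve_length_reverse)
qed

lemma le_sqrt_twice_sum_squares:
  fixes a b :: real
  shows "a \<le> sqrt (2 * (a\<^sup>2 + b\<^sup>2))" "b \<le> sqrt (2 * (a\<^sup>2 + b\<^sup>2))"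
proof -
  have "a\<^sup>2 \<le> 2 * (a\<^sup>2 + b\<^sup>2)" "b\<^sup>2 \<le> 2 * (a\<^sup>2 + b\<^sup>2)"
    using zero_le_power2[of a] zero_le_power2[of b] unfolding distrib_left by linarith+
  then show "a \<le> sqrt (2 * (a\<^sup>2 + b\<^sup>2))" "b \<le> sqrt (2 * (a\<^sup>2 + b\<^sup>2))"
    by (simp_all only: real_le_rsqrt)
qed

context front_surface
begin

lemma piecewise_C1_holomorphic_comp:
  assumes c: "c \<in> \<A>" and H: "holomorphic_fun \<A> H"
    and \<gamma>: "\<gamma> ` {s..e} \<subseteq> fst c" "(snd c \<circ> \<gamma>) piecewise_C1_differentiable_on {s..e}"
  shows "(H \<circ> \<gamma>) piecewise_C1_differentiable_on {s..e}"
proof -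
  let ?h = "snd c \<circ> \<gamma>"
  have eq: "(H \<circ> \<gamma>) t = (coord_expr c H \<circ> ?h) t" if "t \<in> {s..e}" for t
  proof -
    have "\<gamma> t \<in> fst c" using \<gamma>(1) that by blast
    then show ?thesis using c by (simp add: coord_expr_at)
  qed
  have im: "?h ` {s..e} \<subseteq> coord_region c" using \<gamma>(1) by (auto simp: coord_region_def)
  have hol: "coord_expr c H holomorphic_on coord_region c" by (rule coord_expr_holomorphic[OF H c])
  obtain S where cont: "continuous_on {s..e} ?h" and S: "finite S" "?h C1_differentiable_on ({s..e} - S)"
    using \<gamma>(2) by (auto simp: piecewise_C1_differentiable_on_def)
  then obtain D where D: "\<And>t. t \<in> {s..e} - S \<Longrightarrow> (?h has_vector_derivative D t) (at t)" "continuous_on ({s..e} - S) D"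
    unfolding C1_differentiable_on_def by blast
  have "continuous_on {s..e} (coord_expr c H \<circ> ?h)"
    using im by (intro continuous_on_compose cont continuous_on_subset[OF holomorphic_on_imp_continuous_on[OF hol]])
  then have 1: "continuous_on {s..e} (H \<circ> \<gamma>)" using eq by (metis (no_types, lifting) continuous_on_cong)
  let ?S = "S \<union> {s, e}"
  define D' where "D' = (\<lambda>t. D t * deriv (coord_expr c H) (?h t))"
  have "((H \<circ> \<gamma>) has_vector_derivative D' t) (at t)" if t: "t \<in> {s..e} - ?S" for t
  proof -
    have "?h t \<in> coord_region c" using im t by blast
    then have "(coord_expr c H has_field_derivative deriv (coord_expr c H) (?h t)) (at (?h t))"
      using holomorphic_derivI[OF hol region_open[OF c]] by blast
    moreover have "(?h has_vector_derivative D t) (at t)" using D(1) t by blast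
    ultimately have "((coord_expr c H \<circ> ?h) has_vector_derivative D' t) (at t)"
      unfolding D'_def by (intro field_vector_diff_chain_at)
    then show ?thesis
      by (rule has_vector_derivative_transform_within_open[where S = "{s<..<e}"]) (use t eq in auto)
  qed
  moreover have "continuous_on ({s..e} - ?S) D'"
  proof -
    have "continuous_on ({s..e} - ?S) (\<lambda>t. deriv (coord_expr c H) (?h t))"
      using im by (intro continuous_on_compose2[OF holomorphic_on_imp_continuous_on[OF holomorphic_deriv[OF hol region_open[OF c]]]]
          continuous_on_subset[OF cont]) auto
    then show ?thesis unfolding D'_def by (intro continuous_intros continuous_on_subset[OF D(2)]) auto
  qed
  ultimately have "(H \<circ> \<gamma>) C1_differentiable_on ({s..e} - ?S)" unfolding C1_differentiable_on_def by blast
  moreover have "finite ?S" using S(1) by simp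
  ultimately show ?thesis unfolding piecewise_C1_differentiable_on_def by (intro conjI 1 exI[of _ ?S])
qed

text \<open>A curve that ends in \<open>q\<close> and starts outside a coordinate disc crosses the boundary circle for a last time. After that it
  stays in the disc, where \<open>F\<close> or \<open>G\<close> is injective, and the length is at least the increment of that function.\<close>

lemma length_of_escape:
  assumes q: "q \<in> topspace X"
  obtains K and \<mu> :: real where "compactin X K" "\<mu> > 0"
    "\<And>p. p \<in> topspace X - K \<Longrightarrow> ennreal \<mu> \<le> geodesic_dist X \<A> F G p q"
proof -
  obtain c H r where c: "c \<in> \<A>" "q \<in> fst c" and H: "H = F \<or> H = G" and r: "(r::real) > 0"
    "cball (snd c q) r \<subseteq> coord_region c" "inj_on (coord_expr c H) (cball (snd c q) r)"
    using locally_injective_coordinate[OF q] by blast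
  let ?i = "inv_into (fst c) (snd c)" and ?z = "snd c q"
  define K where "K = ?i ` cball ?z r"
  define U where "U = ?i ` ball ?z r"
  have holH: "holomorphic_fun \<A> H" using H holF holG by auto
  have "compactin (top_of_set (coord_region c)) (cball ?z r)" using r by (simp add: compactin_subtopology)
  then have K: "compactin X K" unfolding K_def using inv_chart_cont[OF c(1)] by (rule image_compactin)
  have U: "openin X U" unfolding U_def using r by (intro inv_image_openin c) auto
  have UK: "U \<subseteq> K" by (auto simp: U_def K_def)
  have qU: "q \<in> U" unfolding U_def using c r by (intro image_eqI[of _ _ ?z]) auto
  have Kc: "K \<subseteq> fst c" unfolding K_def using r(2) inv_in_chart by blast
  have KU: "dist ?z (snd c p) = r" if pK: "p \<in> K" and pU: "p \<notin> U" for p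
  proof -
    obtain w where w: "w \<in> cball ?z r" "p = ?i w" using pK unfolding K_def by blast
    then have "w \<notin> ball ?z r" using pU by (auto simp: U_def)
    moreover have "snd c p = w" using w r(2) by auto
    ultimately show ?thesis using w by simp
  qed
  let ?d = "\<lambda>z. cmod (coord_expr c H ?z - coord_expr c H z)"
  have "continuous_on (sphere ?z r) (coord_expr c H)"
    using r by (intro continuous_on_subset[OF holomorphic_on_imp_continuous_on[OF coord_expr_holomorphic[OF holH c(1)]]]) auto
  then have "continuous_on (sphere ?z r) ?d" by (intro continuous_intros)
  moreover have "sphere ?z r \<noteq> {}" using r by simp
  ultimately obtain w where w: "w \<in> sphere ?z r" "\<And>z. z \<in> sphere ?z r \<Longrightarrow> ?d w \<le> ?d z"
    using continuous_attains_inf[OF compact_sphere] by metis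
  have "coord_expr c H ?z \<noteq> coord_expr c H w"
    using inj_onD[OF r(3), of ?z w] w(1) r(1) by auto
  then have \<mu>: "?d w > 0" by simp
  have len: "ennreal (?d w) \<le> curve_length F G {a..b} \<gamma>"
    if ab: "a \<le> b" and \<gamma>: "piecewise_C1_curve X \<A> {a..b} \<gamma>" "\<gamma> a \<notin> K" "\<gamma> b = q" for a b \<gamma>
  proof -
    have cont: "continuous_map (top_of_set {a..b}) X \<gamma>" using \<gamma> by (simp add: piecewise_C1_curve_def)
    have "closedin (top_of_set {a..b}) {t \<in> topspace (top_of_set {a..b}). \<gamma> t \<in> topspace X - U}"
      using U by (intro closedin_continuous_map_preimage[OF cont] closedin_diff closedin_topspace)
    from closedin_closed_trans[OF this closed_atLeastAtMost]
    have "closed {t \<in> {a..b}. \<gamma> t \<in> topspace X - U}" by simp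
    also have "{t \<in> {a..b}. \<gamma> t \<in> topspace X - U} = {t \<in> {a..b}. \<gamma> t \<notin> U}"
      using cont by (auto simp: continuous_map_def)
    finally have clT: "closed {t \<in> {a..b}. \<gamma> t \<notin> U}" .
    \<comment> \<open>Its supremum is the last time on the boundary circle.\<close>
    define T where "T = {t \<in> {a..b}. \<gamma> t \<notin> U}"
    have T: "closed T" "T \<noteq> {}" "bdd_above T" using clT \<gamma>(2) UK ab by (auto simp: T_def intro!: exI[of _ a])
    define s where "s = Sup T"
    have sT: "s \<in> T" unfolding s_def using T by (intro closed_contains_Sup)
    have after: "\<gamma> t \<in> U" if "s < t" "t \<le> b" for t
    proof (rule ccontr)
      assume "\<gamma> t \<notin> U"
      then have "t \<in> T" using that sT by (auto simp: T_def)
      then have "t \<le> s" unfolding s_def using T by (intro cSup_upper)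
      then show False using that by simp
    qed
    have s: "a \<le> s" "s < b" using sT \<gamma>(3) qU by (auto simp: T_def less_le)
    have "closedin X K" using K Hausdorff by (simp add: compactin_imp_closedin)
    then have "closedin (top_of_set {a..b}) {t \<in> topspace (top_of_set {a..b}). \<gamma> t \<in> K}"
      by (rule closedin_continuous_map_preimage[OF cont])
    from closedin_closed_trans[OF this closed_atLeastAtMost]
    have clK: "closed {t \<in> {a..b}. \<gamma> t \<in> K}" by simp
    have "{s<..<b} \<subseteq> {t \<in> {a..b}. \<gamma> t \<in> K}" using after UK s by auto
    then have "closure {s<..<b} \<subseteq> {t \<in> {a..b}. \<gamma> t \<in> K}" using clK by (rule closure_minimal)
    then have im: "\<gamma> ` {s..b} \<subseteq> K" using s by auto
    have "(snd c \<circ> \<gamma>) piecewise_C1_differentiable_on {s..b}"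
    proof -
      have "(fst c, snd c) \<in> \<A>" "{s..b} \<subseteq> {a..b}" "\<gamma> ` {s..b} \<subseteq> fst c" using c s im Kc by auto
      then show ?thesis using \<gamma>(1) unfolding piecewise_C1_curve_def by blast
    qed
    then have "(H \<circ> \<gamma>) piecewise_C1_differentiable_on {s..b}"
      using im Kc by (intro piecewise_C1_holomorphic_comp[OF c(1) holH]) auto
    from piecewise_C1_increment_le_length[OF less_imp_le[OF s(2)] this]
    have 1: "ennreal (cmod (H (\<gamma> b) - H (\<gamma> s))) \<le> (\<integral>\<^sup>+t\<in>{s..b}. ennreal (norm (vector_derivative (H \<circ> \<gamma>) (at t))) \<partial>lborel)"
      by simp
    have "\<gamma> s \<in> K" "\<gamma> s \<notin> U" using im s sT by (auto simp: T_def)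
    then have "snd c (\<gamma> s) \<in> sphere ?z r" "\<gamma> s \<in> fst c" using KU Kc by auto
    then have "?d w \<le> cmod (H (\<gamma> b) - H (\<gamma> s))"
      using w(2)[of "snd c (\<gamma> s)"] c \<gamma>(3) by (simp add: coord_expr_at)
    then have "ennreal (?d w) \<le> ennreal (cmod (H (\<gamma> b) - H (\<gamma> s)))" by (rule ennreal_leI)
    also note 1
    also have "(\<integral>\<^sup>+t\<in>{s..b}. ennreal (norm (vector_derivative (H \<circ> \<gamma>) (at t))) \<partial>lborel) \<le> curve_length F G {a..b} \<gamma>"
      unfolding curve_length_def
    proof (rule nn_integral_mono)
      fix t :: real
      have "norm (vector_derivative (H \<circ> \<gamma>) (at t)) \<le> speed F G \<gamma> t"
        using H le_sqrt_twice_sum_squares by (elim disjE) simp_all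
      moreover have "indicator {s..b} t \<le> (indicator {a..b} t :: ennreal)" using s by (simp add: indicator_def)
      ultimately show "ennreal (norm (vector_derivative (H \<circ> \<gamma>) (at t))) * indicator {s..b} t
        \<le> ennreal (speed F G \<gamma> t) * indicator {a..b} t"
        by (intro mult_mono ennreal_leI zero_le)
    qed
    finally show ?thesis .
  qed
  show thesis
  proof (rule that[OF K \<mu>])
    fix p assume "p \<in> topspace X - K"
    then show "ennreal (?d w) \<le> geodesic_dist X \<A> F G p q"
      unfolding geodesic_dist_def by (intro Inf_greatest) (use len in blast)
  qed
qed

text \<open>Along a divergent curve of finite length the points at the times \<open>1 - 1/(n+1)\<close> form a Cauchy sequence: the lengths of the
  tails decrease to a finite limit, and the length of an arc is at most the difference of two tails. The limit point would
  contradict \<open>length_of_escape\<close>, because the curve leaves every compact set.\<close>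

lemma complete_imp_boundary_dist_infinite:
  assumes wc: "weakly_complete X \<A> F G"
  shows "boundary_dist X \<A> F G p = \<infinity>"
proof -
  have "curve_length F G {0..<1} \<gamma> = \<infinity>"
    if \<gamma>: "piecewise_C1_curve X \<A> {0..<1} \<gamma>" and dv: "divergent_curve X \<gamma>" for \<gamma>
  proof (rule ccontr)
    assume fin: "curve_length F G {0..<1} \<gamma> \<noteq> \<infinity>"
    define \<tau> where "\<tau> = (\<lambda>n::nat. 1 - 1 / real (Suc n))"
    have \<tau>: "0 \<le> \<tau> n" "\<tau> n < 1" for n by (auto simp: \<tau>_def)
    have \<tau>_mono: "\<tau> m \<le> \<tau> n" if "m \<le> n" for m n using that by (auto simp: \<tau>_def intro!: divide_left_mono)
    have \<tau>_sub: "{\<tau> m..\<tau> n} \<subseteq> {0..<1}" for m n using \<tau>(1)[of m] \<tau>(2)[of n] by auto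
    define \<sigma> where "\<sigma> = (\<lambda>n. \<gamma> (\<tau> n))"
    let ?g = "\<lambda>t. ennreal (speed F G \<gamma> t)"
    \<comment> \<open>The left end point is excluded so that an arc and the tail after it are disjoint.\<close>
    define tail where "tail = (\<lambda>n. \<integral>\<^sup>+t\<in>{\<tau> n<..<1}. ?g t \<partial>lborel)"
    have tail_fin: "tail n \<noteq> \<infinity>" for n
    proof -
      have "tail n \<le> curve_length F G {0..<1} \<gamma>"
        unfolding tail_def curve_length_def using \<tau>[of n] by (intro nn_integral_mono) (auto simp: indicator_def)
      then show ?thesis using fin by (auto simp: top_unique)
    qed
    have add: "curve_length F G {\<tau> m..\<tau> n} \<gamma> + tail n \<le> tail m" if "m \<le> n" for m n
    proof -
      have "curve_length F G {\<tau> m..\<tau> n} \<gamma> = (\<integral>\<^sup>+t\<in>{\<tau> m<..\<tau> n}. ?g t \<partial>lborel)"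
        unfolding curve_length_def
      proof (rule nn_integral_cong_AE)
        have "AE t in lborel. t \<noteq> \<tau> m" by (rule AE_lborel_singleton)
        then show "AE t in lborel. ?g t * indicator {\<tau> m..\<tau> n} t = ?g t * indicator {\<tau> m<..\<tau> n} t"
          by eventually_elim (auto simp: indicator_def)
      qed
      then show ?thesis
        unfolding tail_def using \<tau>_mono[OF that] \<tau>[of n]
        by (simp only:) (intro nn_integral_superadditive, auto simp: indicator_def)
    qed
    have "\<exists>N. \<forall>m\<ge>N. \<forall>n\<ge>N. geodesic_dist X \<A> F G (\<sigma> m) (\<sigma> n) < \<epsilon>" if \<epsilon>: "\<epsilon> > 0" for \<epsilon> :: ennreal
    proof -
      define i where "i = (INF n. tail n)"
      have "i \<le> tail 0" unfolding i_def by (rule INF_lower) simp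
      then have i: "i < \<infinity>" using tail_fin[of 0] by (auto simp: top.not_eq_extremum)
      have "i < i + \<epsilon>" using i \<epsilon> by (cases i; cases \<epsilon>) (auto simp: ennreal_less_iff simp flip: ennreal_plus)
      then obtain N where N: "tail N < i + \<epsilon>" unfolding i_def INF_less_iff by blast
      have main: "curve_length F G {\<tau> m..\<tau> n} \<gamma> < \<epsilon>" if mn: "N \<le> m" "m \<le> n" for m n
      proof (rule ccontr)
        assume "\<not> ?thesis"
        then have "tail n + \<epsilon> \<le> curve_length F G {\<tau> m..\<tau> n} \<gamma> + tail n" by (simp add: add.commute add_left_mono not_less)
        also have "\<dots> \<le> tail m" by (rule add[OF mn(2)])
        also have "\<dots> \<le> tail N" using add[OF mn(1)] by (meson add_increasing order_refl order_trans zero_le)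
        also have "\<dots> < i + \<epsilon>" by (rule N)
        also have "\<dots> \<le> tail n + \<epsilon>" unfolding i_def by (intro add_right_mono INF_lower) simp
        finally show False by simp
      qed
      have "geodesic_dist X \<A> F G (\<sigma> m) (\<sigma> n) < \<epsilon>" if "N \<le> m" "N \<le> n" for m n
      proof (cases "m \<le> n")
        case True
        have "geodesic_dist X \<A> F G (\<sigma> m) (\<sigma> n) \<le> curve_length F G {\<tau> m..\<tau> n} \<gamma>"
          unfolding \<sigma>_def by (intro geodesic_dist_le_length(1)[OF \<gamma> \<tau>_sub] \<tau>_mono True)
        with main[OF that(1) True] show ?thesis by (rule order.strict_trans1[rotated])
      next
        case False
        then have nm: "n \<le> m" by simp
        have "geodesic_dist X \<A> F G (\<sigma> m) (\<sigma> n) \<le> curve_length F G {\<tau> n..\<tau> m} \<gamma>"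
          unfolding \<sigma>_def by (intro geodesic_dist_le_length(2)[OF \<gamma> \<tau>_sub] \<tau>_mono nm)
        with main[OF that(2) nm] show ?thesis by (rule order.strict_trans1[rotated])
      qed
      then show ?thesis by blast
    qed
    moreover have \<gamma>top: "\<gamma> t \<in> topspace X" if "t \<in> {0..<1}" for t
      using \<gamma> that unfolding piecewise_C1_curve_def continuous_map_def by auto
    then have "range \<sigma> \<subseteq> topspace X" using \<tau> by (auto simp: \<sigma>_def)
    ultimately obtain q where q: "q \<in> topspace X" "(\<lambda>n. geodesic_dist X \<A> F G (\<sigma> n) q) \<longlonglongrightarrow> 0"
      using wc unfolding weakly_complete_def by blast
    obtain K and \<mu> :: real where K: "compactin X K" "\<mu> > 0"
      "\<And>p. p \<in> topspace X - K \<Longrightarrow> ennreal \<mu> \<le> geodesic_dist X \<A> F G p q"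
      using length_of_escape[OF q(1)] by blast
    obtain t0 where t0: "t0 \<in> {0..<1}" "\<forall>t\<in>{t0..<1}. \<gamma> t \<notin> K" using dv K(1) unfolding divergent_curve_def by blast
    have "eventually (\<lambda>n. geodesic_dist X \<A> F G (\<sigma> n) q < ennreal \<mu>) sequentially"
      using q(2) K(2) by (intro order_tendstoD(2)) auto
    moreover have "\<tau> \<longlonglongrightarrow> 1 - 0" unfolding \<tau>_def by (intro tendsto_intros LIMSEQ_Suc lim_inverse_n')
    then have "eventually (\<lambda>n. \<tau> n > t0) sequentially" using t0(1) by (intro order_tendstoD(1)) auto
    ultimately have "eventually (\<lambda>n. False) sequentially"
    proof eventually_elim
      case (elim n)
      then have "\<sigma> n \<in> topspace X - K" using t0 \<tau>[of n] \<gamma>top unfolding \<sigma>_def by auto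
      then show ?case using K(3) elim(1) by (meson not_less)
    qed
    then show False by simp
  qed
  then show ?thesis unfolding boundary_dist_def
    by (intro antisym) (auto intro!: Inf_greatest)
qed

lemma zero_quotient_derivative_constant:
  assumes "f holomorphic_on ball z r" "g holomorphic_on ball z r" "r > 0"
    and "\<And>w. w \<in> ball z r \<Longrightarrow> g w \<noteq> 0" "\<And>w. w \<in> ball z r \<Longrightarrow> f w * deriv g w = deriv f w * g w"
    and "w \<in> ball z r"
  shows "f w / g w = f z / g z"
proof -
  have "((\<lambda>w. f w / g w) has_field_derivative 0) (at w)" if "w \<in> ball z r" for w
  proof -
    have "((\<lambda>w. f w / g w) has_field_derivative (deriv f w * g w - f w * deriv g w) / (g w * g w)) (at w)"
      using assms(4)[OF that] by (intro DERIV_divide holomorphic_derivI[OF assms(1) open_ball that] holomorphic_derivI[OF assms(2) open_ball that])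
    then show ?thesis using assms(5)[OF that] by simp
  qed
  then obtain k where "\<And>w. w \<in> ball z r \<Longrightarrow> f w / g w = k"
    using has_field_derivative_zero_constant[OF convex_ball, of z r "\<lambda>w. f w / g w"]
    by (metis has_field_derivative_at_within)
  then show ?thesis using assms(3,6) by simp
qed

text \<open>Without curvature the Wronskian vanishes, so \<open>dF/dG\<close>, or its inverse near a pole, has derivative 0. The Gauss map is
  therefore locally constant, and the surface is connected.\<close>

lemma flat_imp_gauss_constant:
  assumes flat: "\<And>p. p \<in> topspace X \<Longrightarrow> gaussian_curvature \<A> F G p = 0"
  shows "lagrangian_gauss_map \<A> F G constant_on topspace X"
proof -
  let ?\<nu> = "lagrangian_gauss_map \<A> F G"
  have loc: "\<exists>U. openin X U \<and> p \<in> U \<and> (\<forall>q\<in>U. ?\<nu> q = ?\<nu> p)" if p: "p \<in> topspace X" for p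
  proof -
    obtain c where c: "c \<in> \<A>" "p \<in> fst c" using ex_chart[OF p] by blast
    let ?i = "inv_into (fst c) (snd c)" and ?z = "snd c p"
    define f where "f = deriv (coord_expr c F)"
    define g where "g = deriv (coord_expr c G)"
    have z: "?z \<in> coord_region c" using c by (intro chart_in)
    have hol: "f holomorphic_on coord_region c" "g holomorphic_on coord_region c"
      unfolding f_def g_def by (intro holomorphic_deriv coord_expr_holomorphic region_open holF holG c(1))+
    have W: "f w * deriv g w = deriv f w * g w" if w: "w \<in> coord_region c" for w
    proof -
      have iw: "?i w \<in> fst c" using w by (rule inv_in_chart)
      then have "?i w \<in> topspace X" using chart_topspace c by blast
      from flat[OF this] have "wronskian (coord_expr c F) (coord_expr c G) w = 0"
        using abs_gaussian_curvature[OF holF holG c(1) iw energy_pos] energy_pos[OF c(1) w] chart_inv[OF w] by simp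
      then show ?thesis by (simp add: wronskian_def f_def g_def)
    qed
    have nu: "?\<nu> (?i w) = (if g w = 0 then None else Some (f w / g w))" if w: "w \<in> coord_region c" for w
      using lagrangian_gauss_map_in_chart[OF holF holG c(1) inv_in_chart[OF w]] chart_inv[OF w] by (simp add: f_def g_def)
    have "f ?z \<noteq> 0 \<or> g ?z \<noteq> 0" using energy_pos[OF c(1) z] by (auto simp: energy_def f_def g_def)
    then obtain h where h: "h = f \<or> h = g" "h ?z \<noteq> 0" by blast
    have "continuous_on (coord_region c) h" using h hol holomorphic_on_imp_continuous_on by blast
    then have "open (coord_region c \<inter> h -` (- {0}))"
      by (rule continuous_open_preimage[OF _ region_open[OF c(1)]]) auto
    moreover have "?z \<in> coord_region c \<inter> h -` (- {0})" using z h(2) by simp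
    ultimately obtain r where r: "r > 0" "ball ?z r \<subseteq> coord_region c \<inter> h -` (- {0})"
      by (rule openE)
    then have sub: "ball ?z r \<subseteq> coord_region c" and hnz: "\<And>w. w \<in> ball ?z r \<Longrightarrow> h w \<noteq> 0" by auto
    have hb: "f holomorphic_on ball ?z r" "g holomorphic_on ball ?z r" using hol sub holomorphic_on_subset by blast+
    have const: "?\<nu> (?i w) = ?\<nu> (?i ?z)" if w: "w \<in> ball ?z r" for w
    proof (cases "h = g")
      case True
      have "f w / g w = f ?z / g ?z"
        using hnz True W sub by (intro zero_quotient_derivative_constant[OF hb r(1) _ _ w]) auto
      then show ?thesis using nu[of w] nu[OF z] hnz[OF w] h(2) True w sub by auto
    next
      case False
      then have hf: "h = f" using h by simp
      have "g w / f w = g ?z / f ?z"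
        using hnz hf W sub by (intro zero_quotient_derivative_constant[OF hb(2,1) r(1) _ _ w]) (auto simp: mult.commute)
      then have "f w / g w = f ?z / g ?z" "g w = 0 \<longleftrightarrow> g ?z = 0"
        using hnz[OF w] h(2) hf by (metis inverse_divide, auto)
      then show ?thesis using nu[of w] nu[OF z] w sub by auto
    qed
    show ?thesis
    proof (intro exI[of _ "?i ` ball ?z r"] conjI ballI)
      show "openin X (?i ` ball ?z r)" using sub by (intro inv_image_openin c) auto
      show "p \<in> ?i ` ball ?z r" using c r by (intro image_eqI[of _ _ ?z]) auto
      fix q assume "q \<in> ?i ` ball ?z r"
      then show "?\<nu> q = ?\<nu> p" using const c by auto
    qed
  qed
  obtain p0 where p0: "p0 \<in> topspace X" using nonempty by blast
  let ?E = "{p \<in> topspace X. ?\<nu> p = ?\<nu> p0}"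
  have op: "openin X {p \<in> topspace X. P (?\<nu> p)}" for P
  proof (subst openin_subopen, intro ballI)
    fix p assume p: "p \<in> {p \<in> topspace X. P (?\<nu> p)}"
    then obtain U where U: "openin X U" "p \<in> U" "\<forall>q\<in>U. ?\<nu> q = ?\<nu> p" using loc[of p] by blast
    have "U \<subseteq> {p \<in> topspace X. P (?\<nu> p)}"
    proof
      fix q assume q: "q \<in> U"
      then have "?\<nu> q = ?\<nu> p" using U(3) by blast
      then show "q \<in> {p \<in> topspace X. P (?\<nu> p)}" using p q openin_subset[OF U(1)] by auto
    qed
    with U show "\<exists>T. openin X T \<and> p \<in> T \<and> T \<subseteq> {p \<in> topspace X. P (?\<nu> p)}" by blast
  qed
  have "topspace X - ?E = {p \<in> topspace X. ?\<nu> p \<noteq> ?\<nu> p0}" by auto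
  then have "closedin X ?E" using op[of "\<lambda>y. y \<noteq> ?\<nu> p0"] by (simp add: closedin_def)
  moreover have "openin X ?E" using op[of "\<lambda>y. y = ?\<nu> p0"] .
  ultimately have "?E = {} \<or> ?E = topspace X" using connected unfolding connected_space_clopen_in by blast
  then have "?E = topspace X" using p0 by blast
  then show ?thesis unfolding constant_on_def by blast
qed

end

section \<open>A front has at most continuum many points\<close>

context front_surface
begin

lemma locally_path_connected: "locally_path_connected_space X"
  unfolding locally_path_connected_space
proof (intro allI impI)
  fix V x assume V: "openin X V \<and> x \<in> V"
  then have "x \<in> topspace X" using openin_subset by blast
  then obtain c where c: "c \<in> \<A>" "x \<in> fst c" using ex_chart by blast
  let ?i = "inv_into (fst c) (snd c)"
  have "open (snd c ` (V \<inter> fst c))"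
    using V c chart_openin[OF c(1)] by (intro chart_image_open) auto
  moreover have "snd c x \<in> snd c ` (V \<inter> fst c)" using V c by blast
  ultimately obtain r where r: "r > 0" "ball (snd c x) r \<subseteq> snd c ` (V \<inter> fst c)" by (rule openE)
  have sub: "ball (snd c x) r \<subseteq> coord_region c" using r by (auto simp: coord_region_def)
  show "\<exists>U. openin X U \<and> path_connectedin X U \<and> x \<in> U \<and> U \<subseteq> V"
  proof (intro exI[of _ "?i ` ball (snd c x) r"] conjI)
    show "openin X (?i ` ball (snd c x) r)" using sub by (intro inv_image_openin c) auto
    have "path_connectedin (top_of_set (coord_region c)) (ball (snd c x) r)"
      using sub by (simp add: path_connectedin_subtopology convex_imp_path_connected)
    then show "path_connectedin X (?i ` ball (snd c x) r)"
      using inv_chart_cont[OF c(1)] by (rule path_connectedin_continuous_map_image[rotated])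
    show "x \<in> ?i ` ball (snd c x) r" using c r by (intro image_eqI[of _ _ "snd c x"]) auto
    show "?i ` ball (snd c x) r \<subseteq> V"
    proof
      fix y assume "y \<in> ?i ` ball (snd c x) r"
      then obtain v where "v \<in> V" "v \<in> fst c" "y = ?i (snd c v)" using r(2) by blast
      then show "y \<in> V" using c by simp
    qed
  qed
qed

text \<open>The set of agreement is closed because the surface is Hausdorff, and open because \<open>(F, G)\<close> is locally injective.\<close>

lemma unique_lift:
  assumes \<gamma>: "pathin X \<gamma>" and \<delta>: "pathin X \<delta>" and start: "\<gamma> 0 = \<delta> 0"
    and FG: "\<And>t. t \<in> {0..1} \<Longrightarrow> F (\<gamma> t) = F (\<delta> t)" "\<And>t. t \<in> {0..1} \<Longrightarrow> G (\<gamma> t) = G (\<delta> t)"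
    and t: "t \<in> {0..1}"
  shows "\<gamma> t = \<delta> t"
proof -
  let ?I = "top_of_set {0..1::real}"
  let ?E = "{t \<in> {0..1}. \<gamma> t = \<delta> t}"
  have cont: "continuous_map ?I X \<gamma>" "continuous_map ?I X \<delta>" using \<gamma> \<delta> by (simp_all add: pathin_def)
  have cl: "closedin ?I ?E" using closedin_continuous_maps_eq[OF Hausdorff cont] by simp
  have "openin ?I ?E"
  proof (subst openin_subopen, intro ballI)
    fix s assume s: "s \<in> ?E"
    moreover have "\<gamma> ` {0..1} \<subseteq> topspace X" using continuous_map_image_subset_topspace[OF cont(1)] by simp
    ultimately have "\<gamma> s \<in> topspace X" by blast
    then obtain c H r where c: "c \<in> \<A>" "\<gamma> s \<in> fst c" and H: "H = F \<or> H = G" and r: "(r::real) > 0"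
      "cball (snd c (\<gamma> s)) r \<subseteq> coord_region c" "inj_on (coord_expr c H) (cball (snd c (\<gamma> s)) r)"
      using locally_injective_coordinate by metis
    let ?i = "inv_into (fst c) (snd c)"
    define U where "U = ?i ` ball (snd c (\<gamma> s)) r"
    have U: "openin X U" unfolding U_def using r by (intro inv_image_openin c) auto
    have sU: "\<gamma> s \<in> U" unfolding U_def using c r by (intro image_eqI[of _ _ "snd c (\<gamma> s)"]) auto
    have injU: "p = q" if p: "p \<in> U" and q: "q \<in> U" and eq: "H p = H q" for p q
    proof -
      obtain v w where vw: "v \<in> ball (snd c (\<gamma> s)) r" "p = ?i v" "w \<in> ball (snd c (\<gamma> s)) r" "q = ?i w"
        using p q by (auto simp: U_def)
      then have "coord_expr c H v = coord_expr c H w" using eq by (simp add: coord_expr_def)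
      then have "v = w" by (rule inj_onD[OF r(3)]) (use vw in auto)
      then show ?thesis using vw by simp
    qed
    have HI: "H (\<gamma> t) = H (\<delta> t)" if "t \<in> {0..1}" for t using H FG[OF that] by (elim disjE) simp_all
    define W where "W = {t \<in> topspace ?I. \<gamma> t \<in> U} \<inter> {t \<in> topspace ?I. \<delta> t \<in> U}"
    have "openin ?I W" unfolding W_def
      by (intro openin_Int openin_continuous_map_preimage[OF cont(1) U] openin_continuous_map_preimage[OF cont(2) U])
    moreover have "s \<in> W" using s sU by (simp add: W_def)
    moreover have "W \<subseteq> ?E" using injU HI by (auto simp: W_def)
    ultimately show "\<exists>T. openin ?I T \<and> s \<in> T \<and> T \<subseteq> ?E" by blast
  qed
  moreover have "?E \<noteq> {}" using start by force
  moreover have "connected {0..1::real}" by simp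
  ultimately have "?E = {0..1}" using cl unfolding connected_clopen by metis
  then show ?thesis using t by blast
qed

lemma continuous_on_along_path:
  assumes \<gamma>: "pathin X \<gamma>" and H: "holomorphic_fun \<A> H"
  shows "continuous_on {0..1} (H \<circ> \<gamma>)"
proof -
  have "continuous_map X euclidean H"
    unfolding continuous_map_def
  proof (intro conjI allI impI)
    fix U :: "complex set" assume U: "openin euclidean U"
    show "openin X {x \<in> topspace X. H x \<in> U}"
    proof (subst openin_subopen, intro ballI)
      fix x assume x: "x \<in> {x \<in> topspace X. H x \<in> U}"
      then obtain c where c: "c \<in> \<A>" "x \<in> fst c" using ex_chart by blast
      let ?i = "inv_into (fst c) (snd c)"
      have "continuous_on (coord_region c) (coord_expr c H)"
        by (intro holomorphic_on_imp_continuous_on coord_expr_holomorphic H c)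
      then have "open (coord_region c \<inter> coord_expr c H -` U)"
        by (rule continuous_open_preimage[OF _ region_open[OF c(1)]]) (use U in simp)
      then have "openin X (?i ` (coord_region c \<inter> coord_expr c H -` U))"
        by (intro inv_image_openin c) auto
      moreover have "x \<in> ?i ` (coord_region c \<inter> coord_expr c H -` U)"
        using x c by (intro image_eqI[of _ _ "snd c x"]) (auto simp: coord_expr_at intro: chart_in)
      moreover have "?i ` (coord_region c \<inter> coord_expr c H -` U) \<subseteq> {x \<in> topspace X. H x \<in> U}"
        using inv_in_chart[of _ c] chart_topspace[OF c(1)] by (auto simp: coord_expr_def)
      ultimately show "\<exists>T. openin X T \<and> x \<in> T \<and> T \<subseteq> {x \<in> topspace X. H x \<in> U}" by blast
    qed
  qed simp
  then have "continuous_map (top_of_set {0..1}) euclidean (H \<circ> \<gamma>)"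
    using \<gamma> continuous_map_compose unfolding pathin_def by blast
  then show ?thesis by simp
qed

end

lemma continuous_eq_of_rational_cuts:
  fixes f g :: "real \<Rightarrow> real"
  assumes "continuous_on {0..1} f" "continuous_on {0..1} g"
    and cuts: "\<And>a b :: rat. of_rat a \<in> {0<..<1::real} \<Longrightarrow> f (of_rat a) < of_rat b \<longleftrightarrow> g (of_rat a) < of_rat b"
    and t: "t \<in> {0..1}"
  shows "f t = g t"
proof -
  have dense: "closure ({0<..<1} \<inter> \<rat>) = {0..1::real}"
    by (subst closure_open_Int_superset) (auto simp: Rats_closure_real)
  have eq: "f x - g x = 0" if x: "x \<in> {0<..<1} \<inter> \<rat>" for x
  proof (rule ccontr)
    assume ne: "f x - g x \<noteq> 0"
    obtain a where a: "x = of_rat a" using x by (blast elim: Rats_cases)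
    consider "f x < g x" | "g x < f x" using ne by linarith
    then show False
    proof cases
      case 1
      then obtain b where "f x < of_rat b" "of_rat b < g x" using of_rat_dense by blast
      then show False using cuts[of a b] a x by auto
    next
      case 2
      then obtain b where "g x < of_rat b" "of_rat b < f x" using of_rat_dense by blast
      then show False using cuts[of a b] a x by auto
    qed
  qed
  have "continuous_on (closure ({0<..<1} \<inter> \<rat>)) (\<lambda>x. f x - g x)"
    unfolding dense using assms(1,2) by (intro continuous_intros)
  from continuous_constant_on_closure[OF this eq, of t] show ?thesis using t dense by simp
qed

lemma ex_inj_into_complex:
  fixes code :: "'a \<Rightarrow> (nat \<times> rat \<times> rat) set"
  assumes "inj_on code S"
  shows "\<exists>j :: 'a \<Rightarrow> complex. inj_on j S"
proof -
  obtain h :: "nat set \<Rightarrow> real" where h: "inj h"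
    using nat_sets_eqpoll_reals by (auto simp: eqpoll_def bij_betw_def)
  have "inj_on ((of_real :: real \<Rightarrow> complex) \<circ> h \<circ> (\<lambda>A. to_nat ` A) \<circ> code) S"
  proof (intro comp_inj_on assms)
    have "inj (\<lambda>A. to_nat ` (A :: (nat \<times> rat \<times> rat) set))"
      by (auto intro!: injI dest: inj_image_eq_iff[OF inj_to_nat, THEN iffD1])
    then show "inj_on (\<lambda>A. to_nat ` A) (code ` S)" by (rule inj_on_subset) simp
    show "inj_on h ((\<lambda>A. to_nat ` A) ` code ` S)" by (rule inj_on_subset[OF h]) simp
    show "inj_on (of_real :: real \<Rightarrow> complex) (h ` (\<lambda>A. to_nat ` A) ` code ` S)" by (auto intro: inj_onI)
  qed
  then show ?thesis by blast
qed

text \<open>Each point is encoded by the rational cuts of the four real coordinates of \<open>(F, G)\<close> along a chosen path from a base point.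
  The code determines the coordinates along the path by continuity, and the end point by unique lifting.\<close>

lemma (in front_surface) ex_inj_points:
  "\<exists>j :: 'a \<Rightarrow> complex. inj_on j (topspace X)"
proof -
  obtain p0 where p0: "p0 \<in> topspace X" using nonempty by blast
  have "path_connected_space X"
    using connected path_connected_eq_connected_space[OF locally_path_connected] by simp
  then have "\<forall>q\<in>topspace X. \<exists>\<gamma>. pathin X \<gamma> \<and> \<gamma> 0 = p0 \<and> \<gamma> 1 = q"
    using p0 unfolding path_connected_space_def by blast
  then obtain \<gamma> where \<gamma>: "\<And>q. q \<in> topspace X \<Longrightarrow> pathin X (\<gamma> q) \<and> \<gamma> q 0 = p0 \<and> \<gamma> q 1 = q" by metis
  define coord where "coord = (\<lambda>i::nat. if i = 0 then (\<lambda>p. Re (F p)) else if i = 1 then (\<lambda>p. Im (F p))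
      else if i = 2 then (\<lambda>p. Re (G p)) else (\<lambda>p. Im (G p)))"
  define code where "code = (\<lambda>q. {(i :: nat, a :: rat, b :: rat). of_rat a \<in> {0<..<1::real} \<and> coord i (\<gamma> q (of_rat a)) < of_rat b})"
  have "inj_on code (topspace X)"
  proof (rule inj_onI)
    fix p q assume p: "p \<in> topspace X" and q: "q \<in> topspace X" and eq: "code p = code q"
    have cont: "continuous_on {0..1} (\<lambda>t. coord i (\<gamma> r t))" if "r \<in> topspace X" for i r
    proof -
      have "continuous_on {0..1} (\<lambda>t. F (\<gamma> r t))" "continuous_on {0..1} (\<lambda>t. G (\<gamma> r t))"
        using continuous_on_along_path[OF _ holF, of "\<gamma> r"] continuous_on_along_path[OF _ holG, of "\<gamma> r"] \<gamma>[OF that]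
        by (simp_all add: comp_def)
      then have re_im: "continuous_on {0..1} (\<lambda>t. Re (F (\<gamma> r t)))" "continuous_on {0..1} (\<lambda>t. Im (F (\<gamma> r t)))"
        "continuous_on {0..1} (\<lambda>t. Re (G (\<gamma> r t)))" "continuous_on {0..1} (\<lambda>t. Im (G (\<gamma> r t)))"
        by (simp_all only: continuous_on_Re continuous_on_Im)
      define P where "P = (\<lambda>h :: 'a \<Rightarrow> real. continuous_on {0..1} (\<lambda>t. h (\<gamma> r t)))"
      have "P (\<lambda>p. Re (F p))" "P (\<lambda>p. Im (F p))" "P (\<lambda>p. Re (G p))" "P (\<lambda>p. Im (G p))"
        unfolding P_def by (fact re_im)+
      then have "P (coord i)" by (simp add: coord_def)
      then show ?thesis by (simp only: P_def)
    qed
    have agree: "coord i (\<gamma> p t) = coord i (\<gamma> q t)" if "t \<in> {0..1}" for i t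
    proof (rule continuous_eq_of_rational_cuts[OF cont[OF p] cont[OF q] _ that])
      fix a b :: rat assume a: "of_rat a \<in> {0<..<1::real}"
      have "(i, a, b) \<in> code p \<longleftrightarrow> (i, a, b) \<in> code q" using eq by simp
      then show "coord i (\<gamma> p (of_rat a)) < of_rat b \<longleftrightarrow> coord i (\<gamma> q (of_rat a)) < of_rat b"
        using a by (simp add: code_def)
    qed
    have "\<gamma> p 1 = \<gamma> q 1"
    proof (rule unique_lift)
      show "pathin X (\<gamma> p)" "pathin X (\<gamma> q)" "\<gamma> p 0 = \<gamma> q 0" using \<gamma> p q by auto
      fix t :: real assume t: "t \<in> {0..1}"
      show "F (\<gamma> p t) = F (\<gamma> q t)" "G (\<gamma> p t) = G (\<gamma> q t)"
        using agree[OF t, of 0] agree[OF t, of 1] agree[OF t, of 2] agree[OF t, of 3]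
        by (simp_all add: coord_def complex_eq_iff)
    qed simp
    then show "p = q" using \<gamma> p q by simp
  qed
  then show ?thesis by (rule ex_inj_into_complex)
qed

section \<open>Relabelling the points of a front\<close>

text \<open>The topology on the image of \<open>j\<close> that makes \<open>j\<close> a homeomorphism: the pullback along the inverse of \<open>j\<close>.\<close>

definition push_topology :: "'a topology \<Rightarrow> ('a \<Rightarrow> 'b) \<Rightarrow> 'b topology" where
  "push_topology X j = pullback_topology (j ` topspace X) (inv_into (topspace X) j) X"

definition push_chart :: "'a topology \<Rightarrow> ('a \<Rightarrow> 'b) \<Rightarrow> 'a chart \<Rightarrow> 'b chart" where
  "push_chart X j c = (j ` fst c, snd c \<circ> inv_into (topspace X) j)"

locale relabelling = front_surface X \<A> F G
  for X :: "'a topology" and \<A> and F G :: "'a \<Rightarrow> complex" +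
  fixes j :: "'a \<Rightarrow> 'b"
  assumes inj: "inj_on j (topspace X)"
begin

abbreviation "k \<equiv> inv_into (topspace X) j"
abbreviation "X' \<equiv> push_topology X j"
abbreviation "\<A>' \<equiv> push_chart X j ` \<A>"

lemma kj [simp]: "p \<in> topspace X \<Longrightarrow> k (j p) = p"
  using inj by (rule inv_into_f_f)

lemma jk: "p \<in> j ` topspace X \<Longrightarrow> j (k p) = p" and k_in: "p \<in> j ` topspace X \<Longrightarrow> k p \<in> topspace X"
  by (auto simp: f_inv_into_f inv_into_into)

lemma topspace_X' [simp]: "topspace X' = j ` topspace X"
  by (auto simp: push_topology_def topspace_pullback_topology inv_into_into)

lemma homeo: "homeomorphic_maps X X' j k"
  unfolding homeomorphic_maps_def
proof (intro conjI ballI)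
  have "continuous_map X X (k \<circ> j)" by (rule continuous_map_eq[OF continuous_map_id]) simp
  then show "continuous_map X X' j"
    unfolding push_topology_def by (rule continuous_map_pullback') auto
  have "continuous_map X' X (id \<circ> k)" unfolding push_topology_def by (rule continuous_map_pullback) (rule continuous_map_id)
  then show "continuous_map X' X k" by simp
qed (auto simp: jk)

lemma cont_j: "continuous_map X X' j" and cont_k: "continuous_map X' X k"
  using homeo by (auto simp: homeomorphic_maps_def)

lemma homeo_j: "homeomorphic_map X X' j" and homeo_k: "homeomorphic_map X' X k"
  using homeo homeomorphic_maps_sym[of X X' j k] unfolding homeomorphic_map_maps by blast+

lemma push_chart_simps [simp]: "fst (push_chart X j c) = j ` fst c" "snd (push_chart X j c) = snd c \<circ> k"
  by (simp_all add: push_chart_def)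

lemma push_image:
  assumes "c \<in> \<A>" "S \<subseteq> fst c"
  shows "(f \<circ> k) ` (j ` S) = f ` S"
proof -
  have "(f \<circ> k) (j p) = f p" if "p \<in> S" for p
    using that assms chart_topspace[OF assms(1)] by (simp add: subset_iff)
  then show ?thesis unfolding image_image by (intro image_cong refl)
qed

lemma coord_region_push [simp]: "c \<in> \<A> \<Longrightarrow> coord_region (push_chart X j c) = coord_region c"
  using push_image[of c "fst c" "snd c"] by (simp add: coord_region_def)

lemma inv_push_chart:
  assumes c: "c \<in> \<A>" and z: "z \<in> coord_region c"
  shows "inv_into (j ` fst c) (snd c \<circ> k) z = j (inv_into (fst c) (snd c) z)"
proof -
  let ?p = "inv_into (fst c) (snd c) z"
  have p: "?p \<in> fst c" using z by (rule inv_in_chart)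
  have "inj_on (snd c \<circ> k) (j ` fst c)"
  proof (rule inj_onI)
    fix x y assume "x \<in> j ` fst c" "y \<in> j ` fst c" "(snd c \<circ> k) x = (snd c \<circ> k) y"
    then obtain p q where pq: "p \<in> fst c" "q \<in> fst c" "x = j p" "y = j q" "snd c (k (j p)) = snd c (k (j q))" by auto
    moreover have "p \<in> topspace X" "q \<in> topspace X" using pq chart_topspace[OF c] by auto
    ultimately show "x = y" using chart_inj[OF c] by (auto dest: inj_onD)
  qed
  from inv_into_f_f[OF this, of "j ?p"] show ?thesis
    using p z chart_topspace[OF c] by (auto simp: subsetD)
qed

lemma coord_expr_push:
  assumes c: "c \<in> \<A>" and z: "z \<in> coord_region c"
  shows "coord_expr (push_chart X j c) (f \<circ> k) z = coord_expr c f z"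
  using inv_push_chart[OF assms] inv_in_chart[OF z] chart_topspace[OF c]
  by (simp add: coord_expr_def subsetD)

lemma coord_expr_push_ev:
  assumes c: "c \<in> \<A>" and z: "z \<in> coord_region c"
  shows "eventually (\<lambda>w. coord_expr (push_chart X j c) (f \<circ> k) w = coord_expr c f w) (nhds z)"
  using eventually_nhds_in_open[OF region_open[OF c] z] by eventually_elim (rule coord_expr_push[OF c])

lemma deriv_push:
  assumes c: "c \<in> \<A>" and z: "z \<in> coord_region c"
  shows "deriv (coord_expr (push_chart X j c) (f \<circ> k)) z = deriv (coord_expr c f) z"
  by (rule deriv_cong_ev[OF coord_expr_push_ev[OF assms] refl])

lemma riemann_surface_push: "riemann_surface X' \<A>'"
proof
  show "topspace X' \<noteq> {}" using nonempty by simp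
  have hs: "X homeomorphic_space X'" using homeo unfolding homeomorphic_space_def by blast
  show "connected_space X'" using connected homeomorphic_connected_space[OF hs] by simp
  show "Hausdorff_space X'" using Hausdorff homeomorphic_Hausdorff_space[OF hs] by simp
  show "topspace X' = (\<Union>(U, \<phi>)\<in>\<A>'. U)"
    unfolding topspace_X' covering by (force simp: push_chart_def)
next
  fix U \<phi> assume "(U, \<phi>) \<in> \<A>'"
  then obtain c where c: "c \<in> \<A>" "U = j ` fst c" "\<phi> = snd c \<circ> k" by (auto simp: push_chart_def)
  have im: "\<phi> ` U = coord_region c" using c push_image[OF c(1) order_refl] by (simp add: coord_region_def)
  have "openin X' U" using homeomorphic_imp_open_map[OF homeo_j] chart_openin[OF c(1)] c by (simp add: open_map_def)
  moreover have "homeomorphic_map (subtopology X' U) (subtopology X (fst c)) k"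
  proof (rule homeomorphic_map_subtopologies[OF homeo_k])
    have "topspace X' \<inter> U = j ` fst c" "topspace X \<inter> fst c = fst c"
      unfolding c(2) topspace_X' using chart_topspace[OF c(1)] by blast+
    then show "k ` (topspace X' \<inter> U) = topspace X \<inter> fst c"
      using push_image[OF c(1) order_refl, of id] by simp
  qed
  then have "homeomorphic_map (subtopology X' U) (top_of_set (coord_region c)) \<phi>"
    unfolding c(3) using chart_homeo[OF c(1)] by (rule homeomorphic_map_compose)
  ultimately show "openin X' U \<and> open (\<phi> ` U) \<and> homeomorphic_map (subtopology X' U) (top_of_set (\<phi> ` U)) \<phi>"
    using im region_open[OF c(1)] by simp
next
  fix U \<phi> V \<eta> assume "(U, \<phi>) \<in> \<A>'" "(V, \<eta>) \<in> \<A>'"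
  then obtain c d where c: "c \<in> \<A>" "U = j ` fst c" "\<phi> = snd c \<circ> k" and d: "d \<in> \<A>" "V = j ` fst d" "\<eta> = snd d \<circ> k"
    by (auto simp: push_chart_def)
  have UV: "U \<inter> V = j ` (fst c \<inter> fst d)"
    unfolding c d using inj_on_image_Int[OF inj chart_topspace[OF c(1)] chart_topspace[OF d(1)]] by simp
  have im: "\<phi> ` (U \<inter> V) = snd c ` (fst c \<inter> fst d)"
    unfolding UV c(3) by (rule push_image[OF c(1)]) simp
  have eq: "(\<eta> \<circ> inv_into U \<phi>) z = coord_expr c (snd d) z" if "z \<in> snd c ` (fst c \<inter> fst d)" for z
  proof -
    have "z \<in> coord_region c" using that by (auto simp: coord_region_def)
    from coord_expr_push[OF c(1) this, of "snd d"] show ?thesis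
      unfolding c d by (simp add: coord_expr_def)
  qed
  show "(\<eta> \<circ> inv_into U \<phi>) holomorphic_on \<phi> ` (U \<inter> V)"
    unfolding im using transition_holomorphic[OF c(1) d(1)] eq by (simp cong: holomorphic_cong)
qed

lemma metric_coeff_push:
  assumes "c \<in> \<A>" "z \<in> coord_region c"
  shows "metric_coeff (push_chart X j c) (F \<circ> k) (G \<circ> k) z = metric_coeff c F G z"
  by (simp add: metric_coeff_def deriv_push[OF assms])

lemma improper_affine_front_push:
  assumes \<psi>: "improper_affine_front X \<A> F G \<psi>"
  shows "improper_affine_front X' \<A>' (F \<circ> k) (G \<circ> k) (\<psi> \<circ> k)"
proof -
  obtain u where u: "primitive_Re_FdG \<A> F G u" and eq: "\<And>p. p \<in> topspace X \<Longrightarrow> \<psi> p = (G p + cnj (F p),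
               ((cmod (G p))\<^sup>2 - (cmod (F p))\<^sup>2) / 2 + (Re (G p * F p) - 2 * u p))"
    using \<psi> unfolding improper_affine_front_def by blast
  have hol: "holomorphic_fun \<A>' (H \<circ> k)" if "holomorphic_fun \<A> H" for H
    unfolding holomorphic_fun_def
  proof (intro ballI)
    fix c' assume "c' \<in> \<A>'"
    then obtain c where c: "c \<in> \<A>" "c' = push_chart X j c" by blast
    show "coord_expr c' (H \<circ> k) holomorphic_on coord_region c'"
      unfolding c(2) coord_region_push[OF c(1)]
      by (rule holomorphic_transform[OF coord_expr_holomorphic[OF that c(1)]]) (simp add: coord_expr_push[OF c(1)])
  qed
  have "primitive_Re_FdG \<A>' (F \<circ> k) (G \<circ> k) (u \<circ> k)"
    unfolding primitive_Re_FdG_def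
  proof (intro ballI)
    fix c' z assume "c' \<in> \<A>'" "z \<in> coord_region c'"
    then obtain c where c: "c \<in> \<A>" "c' = push_chart X j c" and z: "z \<in> coord_region c" by auto
    have "(coord_expr c u has_derivative (\<lambda>h. Re (coord_expr c F z * deriv (coord_expr c G) z * h))) (at z)"
      using u c z by (auto simp: primitive_Re_FdG_def)
    then show "(coord_expr c' (u \<circ> k) has_derivative
        (\<lambda>h. Re (coord_expr c' (F \<circ> k) z * deriv (coord_expr c' (G \<circ> k)) z * h))) (at z)"
      unfolding c(2) deriv_push[OF c(1) z] coord_expr_push[OF c(1) z]
      by (rule has_derivative_transform_within_open[OF _ region_open[OF c(1)] z]) (simp add: coord_expr_push[OF c(1)])
  qed
  moreover have "(\<psi> \<circ> k) q = ((G \<circ> k) q + cnj ((F \<circ> k) q),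
               ((cmod ((G \<circ> k) q))\<^sup>2 - (cmod ((F \<circ> k) q))\<^sup>2) / 2 + (Re ((G \<circ> k) q * (F \<circ> k) q) - 2 * (u \<circ> k) q))"
    if "q \<in> topspace X'" for q
    using eq[of "k q"] k_in that by simp
  moreover have "\<forall>c\<in>\<A>'. \<forall>z\<in>coord_region c. metric_coeff c (F \<circ> k) (G \<circ> k) z > 0"
    using \<psi> by (auto simp: metric_coeff_push improper_affine_front_def)
  ultimately show ?thesis
    unfolding improper_affine_front_def using hol[OF holF] hol[OF holG] by blast
qed

lemma front_surface_push:
  assumes "improper_affine_front X \<A> F G \<psi>"
  shows "front_surface X' \<A>' (F \<circ> k) (G \<circ> k)"
  by (rule front_surfaceI[OF riemann_surface_push improper_affine_front_push[OF assms]])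

lemma invariants_push:
  assumes \<psi>: "improper_affine_front X \<A> F G \<psi>" and p: "p \<in> topspace X"
  shows "lagrangian_gauss_map \<A>' (F \<circ> k) (G \<circ> k) (j p) = lagrangian_gauss_map \<A> F G p"
    and "\<bar>gaussian_curvature \<A>' (F \<circ> k) (G \<circ> k) (j p)\<bar> = \<bar>gaussian_curvature \<A> F G p\<bar>"
proof -
  interpret P: front_surface X' \<A>' "F \<circ> k" "G \<circ> k" by (rule front_surface_push[OF \<psi>])
  obtain c where c: "c \<in> \<A>" "p \<in> fst c" using ex_chart[OF p] by blast
  let ?c = "push_chart X j c"
  have c': "?c \<in> \<A>'" "j p \<in> fst ?c" using c by auto
  have z: "snd c p \<in> coord_region c" using c by (intro chart_in)
  have s: "snd ?c (j p) = snd c p" using p by simp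
  show "lagrangian_gauss_map \<A>' (F \<circ> k) (G \<circ> k) (j p) = lagrangian_gauss_map \<A> F G p"
    unfolding P.lagrangian_gauss_map_in_chart[OF P.holF P.holG c'] lagrangian_gauss_map_in_chart[OF holF holG c] s
      deriv_push[OF c(1) z] ..
  have W: "wronskian (coord_expr ?c (F \<circ> k)) (coord_expr ?c (G \<circ> k)) (snd c p) = wronskian (coord_expr c F) (coord_expr c G) (snd c p)"
    by (intro wronskian_cong_ev coord_expr_push_ev[OF c(1) z])
  have K': "\<bar>gaussian_curvature \<A>' (F \<circ> k) (G \<circ> k) (j p)\<bar> =
    (cmod (wronskian (coord_expr ?c (F \<circ> k)) (coord_expr ?c (G \<circ> k)) (snd ?c (j p))))\<^sup>2 / energy ?c (F \<circ> k) (G \<circ> k) (snd ?c (j p)) ^ 3"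
    by (rule P.abs_gaussian_curvature[OF P.holF P.holG c']) (rule P.energy_pos)
  have K: "\<bar>gaussian_curvature \<A> F G p\<bar> =
    (cmod (wronskian (coord_expr c F) (coord_expr c G) (snd c p)))\<^sup>2 / energy c F G (snd c p) ^ 3"
    by (rule abs_gaussian_curvature[OF holF holG c]) (rule energy_pos)
  show "\<bar>gaussian_curvature \<A>' (F \<circ> k) (G \<circ> k) (j p)\<bar> = \<bar>gaussian_curvature \<A> F G p\<bar>"
    unfolding K K' s W by (simp add: energy_def deriv_push[OF c(1) z])
qed

text \<open>A divergent curve on the relabelled surface comes from one on the original surface, of the same length.\<close>

lemma boundary_dist_push:
  assumes p: "p \<in> topspace X"
  shows "boundary_dist X \<A> F G p \<le> boundary_dist X' \<A>' (F \<circ> k) (G \<circ> k) (j p)"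
  unfolding boundary_dist_def[of X']
proof (rule Inf_greatest, clarify)
  fix \<gamma> assume \<gamma>: "piecewise_C1_curve X' \<A>' {0..<1} \<gamma>" "divergent_curve X' \<gamma>" "\<gamma> 0 = j p"
  have top: "\<gamma> t \<in> j ` topspace X" if "t \<in> {0..<1}" for t
    using \<gamma>(1) that unfolding piecewise_C1_curve_def continuous_map_def by auto
  have "piecewise_C1_curve X \<A> {0..<1} (k \<circ> \<gamma>)"
    unfolding piecewise_C1_curve_def
  proof (intro conjI allI ballI, goal_cases)
    case 1
    show ?case using \<gamma>(1) cont_k by (auto simp: piecewise_C1_curve_def intro: continuous_map_compose)
  next
    case (2 a b c)
    show ?case
    proof (clarify, goal_cases)
      case (1 U \<phi>)
      have "\<gamma> ` {a..b} \<subseteq> j ` U"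
      proof (rule image_subsetI)
        fix t assume t: "t \<in> {a..b}"
        then have "j ((k \<circ> \<gamma>) t) \<in> j ` U" using 1 by blast
        moreover have "t \<in> {0..<1}" using t 1 by blast
        ultimately show "\<gamma> t \<in> j ` U" using jk[OF top] by simp
      qed
      moreover have "(j ` U, \<phi> \<circ> k) \<in> \<A>'" using 1 2 by (force simp: push_chart_def)
      ultimately have "((\<phi> \<circ> k) \<circ> \<gamma>) piecewise_C1_differentiable_on {a..b}"
        using \<gamma>(1) 1 unfolding piecewise_C1_curve_def by blast
      then show ?case by (simp add: comp_assoc)
    qed
  qed
  moreover have "divergent_curve X (k \<circ> \<gamma>)"
    unfolding divergent_curve_def
  proof (intro allI impI)
    fix K assume K: "compactin X K"
    then have "compactin X' (j ` K)" using cont_j by (rule image_compactin)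
    then obtain t0 where t0: "t0 \<in> {0..<1}" "\<forall>t\<in>{t0..<1}. \<gamma> t \<notin> j ` K"
      using \<gamma>(2) unfolding divergent_curve_def by blast
    have "(k \<circ> \<gamma>) t \<notin> K" if "t \<in> {t0..<1}" for t
    proof
      assume "(k \<circ> \<gamma>) t \<in> K"
      then have "j (k (\<gamma> t)) \<in> j ` K" by simp
      moreover have "t \<in> {0..<1}" using that t0 by auto
      ultimately show False using jk[OF top] t0 that by auto
    qed
    then show "\<exists>t0\<in>{0..<1}. \<forall>t\<in>{t0..<1}. (k \<circ> \<gamma>) t \<notin> K" using t0 by blast
  qed
  moreover have "(k \<circ> \<gamma>) 0 = p" using \<gamma>(3) p by simp
  moreover have "curve_length F G {0..<1} (k \<circ> \<gamma>) = curve_length (F \<circ> k) (G \<circ> k) {0..<1} \<gamma>"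
    by (simp add: curve_length_def comp_assoc)
  ultimately show "boundary_dist X \<A> F G p \<le> curve_length (F \<circ> k) (G \<circ> k) {0..<1} \<gamma>"
    unfolding boundary_dist_def by (intro Inf_lower) force
qed

end

section \<open>Independence of the type of points, and complete fronts with omitted values\<close>

text \<open>When the points are relabelled by complex numbers, the Gauss map and the absolute value of the curvature do not change,
  and the distance to the boundary does not decrease.\<close>

lemma curvature_estimate_transfer:
  fixes A :: "complex option set"
  assumes est: "curvature_estimate TYPE(complex) A C"
  shows "curvature_estimate TYPE('a) A C"
  unfolding curvature_estimate_def
proof (intro allI impI ballI)
  fix X :: "'a topology" and \<A> F G \<psi> p
  assume X: "riemann_surface X \<A>" and \<psi>: "improper_affine_front X \<A> F G \<psi>"
    and om: "lagrangian_gauss_map \<A> F G ` topspace X \<inter> A = {}" and p: "p \<in> topspace X"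
  interpret front_surface X \<A> F G by (rule front_surfaceI[OF X \<psi>])
  obtain j :: "'a \<Rightarrow> complex" where "inj_on j (topspace X)" using ex_inj_points by blast
  then interpret relabelling X \<A> F G j by unfold_locales
  have "lagrangian_gauss_map \<A>' (F \<circ> k) (G \<circ> k) ` topspace X' \<inter> A = {}"
    using om invariants_push(1)[OF \<psi>] by auto
  moreover have "j p \<in> topspace X'" using p by simp
  ultimately have "ennreal (sqrt \<bar>gaussian_curvature \<A>' (F \<circ> k) (G \<circ> k) (j p)\<bar>)
      \<le> ennreal C / boundary_dist X' \<A>' (F \<circ> k) (G \<circ> k) (j p)"
    using est riemann_surface_push improper_affine_front_push[OF \<psi>] unfolding curvature_estimate_def by blast
  also have "\<dots> \<le> ennreal C / boundary_dist X \<A> F G p"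
    by (rule ennreal_divide_antimono[OF boundary_dist_push[OF p]])
  finally show "ennreal (sqrt \<bar>gaussian_curvature \<A> F G p\<bar>) \<le> ennreal C / boundary_dist X \<A> F G p"
    by (simp add: invariants_push(2)[OF \<psi> p])
qed

text \<open>Four omitted values would give a curvature estimate with \<open>d = \<infinity>\<close>, hence a flat metric and a constant Gauss map.\<close>

lemma gauss_map_omits_at_most_three:
  fixes X :: "'a topology"
  assumes X: "riemann_surface X \<A>" and \<psi>: "improper_affine_front X \<A> F G \<psi>"
    and wc: "weakly_complete X \<A> F G"
    and nonconst: "\<not> lagrangian_gauss_map \<A> F G constant_on topspace X"
  shows "finite (UNIV - lagrangian_gauss_map \<A> F G ` topspace X) \<and>
    card (UNIV - lagrangian_gauss_map \<A> F G ` topspace X) \<le> 3"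
proof (rule ccontr)
  let ?S = "UNIV - lagrangian_gauss_map \<A> F G ` topspace X"
  interpret front_surface X \<A> F G by (rule front_surfaceI[OF X \<psi>])
  assume "\<not> ?thesis"
  then have "\<exists>A. finite A \<and> card A = 4 \<and> A \<subseteq> ?S"
    using infinite_arbitrarily_large[of ?S 4] obtain_subset_with_card_n[of 4 ?S]
    by (metis finite_subset not_less_eq_eq numeral_3_eq_3 eval_nat_numeral(2) semiring_norm(26,27))
  then obtain A where A: "finite A" "card A = 4" "A \<subseteq> ?S" by blast
  then obtain C where C: "curvature_estimate TYPE('a) A C" using curvature_estimate_exists[of A] by auto
  have "gaussian_curvature \<A> F G p = 0" if p: "p \<in> topspace X" for p
  proof -
    have "ennreal (sqrt \<bar>gaussian_curvature \<A> F G p\<bar>) \<le> ennreal C / boundary_dist X \<A> F G p"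
      using C X \<psi> A(3) p unfolding curvature_estimate_def by blast
    then have "ennreal (sqrt \<bar>gaussian_curvature \<A> F G p\<bar>) \<le> 0"
      by (simp add: complete_imp_boundary_dist_infinite[OF wc])
    then show ?thesis by (simp add: ennreal_eq_0_iff)
  qed
  then show False using nonconst flat_imp_gauss_constant by blast
qed

theorem theorem3p6:
  shows "(\<forall>A :: complex option set. finite A \<and> card A > 3 \<longrightarrow>
            (\<exists>C>0. curvature_estimate TYPE(complex) A C) \<and>
            (\<forall>C>0. curvature_estimate TYPE(complex) A C \<longrightarrow> curvature_estimate TYPE('a) A C)) \<and>
         (\<forall>(X :: 'a topology) \<A> F G \<psi>.
            riemann_surface X \<A> \<longrightarrow> improper_affine_front X \<A> F G \<psi> \<longrightarrow>
            weakly_complete X \<A> F G \<longrightarrow>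
            \<not> lagrangian_gauss_map \<A> F G constant_on topspace X \<longrightarrow>
            finite (UNIV - lagrangian_gauss_map \<A> F G ` topspace X) \<and>
            card (UNIV - lagrangian_gauss_map \<A> F G ` topspace X) \<le> 3)"
  using curvature_estimate_exists curvature_estimate_transfer gauss_map_omits_at_most_three by blast

end
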